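(* Let $f$ be one of the twelve Jacobi elliptic functions, let $n\ge1$ be an integer, and let $\rho=nS_f$, where $S_f$ is the half period given by the sum of the two poles of $f$ modulo its minimal periods. Let $z_1,\dots,z_{2n-1}$ be generic complex numbers, and let $z$ be defined by $z+z_1+\cdots+z_{2n-1}=0$. Let $\lambda_1,\dots,\lambda_n,\kappa_1,\dots,\kappa_{n-1}$ be the complex numbers, existing for generic $z_1,\dots,z_{2n-1}$ because the determinant of the linear system is then nonzero (and computable by Cramer's formula), such that $$1=\lambda_1f(z_h)+\cdots+\lambda_nf^n(z_h)+\kappa_1f'(z_h)+\cdots+\kappa_{n-1}f^{(n-1)}(z_h)\qquad(h=1,\dots,2n-1).$$ The function $$\varphi(u)=\left(-1+\sum_{j=1}^{n}\lambda_jf^j(u)+\sum_{\substack{1\le j\le n-1\\ 2\mid j}}\kappa_jf^{(j)}(u)\right)^2-\left(\sum_{\substack{1\le j\le n-1\\ 2\nmid j}}\kappa_jf^{(j)}(u)\right)^2$$ is a polynomial in $f(u)$ of degree at most $2n$; let $c_0,\dots,c_{2n}$ be the constants with $\varphi(u)=\sum_{j=0}^{2n}c_jf^j(u)$. Then $$S_jf(z_1,\dots,z_{2n-1},z+\rho)=(-1)^j\frac{c_{2n-j}}{c_{2n}}\qquad(j=0,1,\dots,2n),$$ or $$f(z+\rho)=\frac{1}{S_{j-1}f(z_1,\dots,z_{2n-1})}\left((-1)^j\frac{c_{2n-j}}{c_{2n}}-S_jf(z_1,\dots,z_{2n-1})\right)$$ for $j\neq0$.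
   Context: Fix $\tau$ in the complex upper half-plane, let $\vartheta_1,\dots,\vartheta_4$ be the Jacobi theta functions $\vartheta_j(u)=\vartheta_j(u,\tau)$ in the Whittaker–Watson convention (nome $q=e^{\pi i\tau}$), with $\vartheta_j=\vartheta_j(0)$. Put $k=\vartheta_2^2/\vartheta_3^2$, $K=\pi\vartheta_3^2/2$, $K'=-i\tau K$. Define $\operatorname{sn}u=\frac{\vartheta_3}{\vartheta_2}\frac{\vartheta_1(\pi u/2K)}{\vartheta_4(\pi u/2K)}$, $\operatorname{cn}u=\frac{\vartheta_4}{\vartheta_2}\frac{\vartheta_2(\pi u/2K)}{\vartheta_4(\pi u/2K)}$, $\operatorname{dn}u=\frac{\vartheta_4}{\vartheta_3}\frac{\vartheta_3(\pi u/2K)}{\vartheta_4(\pi u/2K)}$. With Glaisher's notation, for distinct letters $p,q\in\{s,c,d,n\}$ set $\operatorname{pq}=\operatorname{pn}/\operatorname{qn}$ with $\operatorname{nn}=1$; this gives the twelve Jacobi elliptic functions sn, cn, dn, ns, cs, ds, nc, sc, dc, nd, sd, cd. Minimal periods: $4K,2iK'$ for sn, ns, dc, cd; $4K,2K+2iK'$ for cn, nc, ds, sd; $2K,4iK'$ for dn, nd, cs, sc. Poles modulo the minimal periods: $iK',iK'+2K$ for sn, cn; $iK',3iK'$ for dn; $0,2K$ for ns, ds; $0,2iK'$ for cs; $K,3K$ for nc, dc; $K,K+2iK'$ for sc; $K+iK',K+3iK'$ for nd; $K+iK',3K+iK'$ for sd, cd. Only the class of $S_f$ (and of $\rho$) modulo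 the periods of $f$ matters. Each Jacobi function $f$ satisfies $(f')^2=A_ff^4+B_ff^2+C_f$ for constants $A_f,B_f,C_f$. Here $f^{j}$ denotes the $j$-th power and $f^{(j)}$ the $j$-th derivative. $S_r(x_1,\dots,x_N)=\sum_{1\le i_1<\cdots<i_r\le N}x_{i_1}\cdots x_{i_r}$ is the elementary symmetric polynomial, with $S_0=1$ and $S_r=0$ for $r>N$, and $S_rf(x_1,\dots,x_N)=S_r(f(x_1),\dots,f(x_N))$. "Generic" is used in an implicit manner to mean parameters not satisfying any special equations; for example, the values $f(z_1),\dots,f(z_{2n-1}),f(z+\rho)$ are distinct, and the elliptic function $-1+\sum_{j=1}^n\lambda_jf^j+\sum_{j=1}^{n-1}\kappa_jf^{(j)}$ has the maximal order $2n$. Results for non-generic (degenerate) parameters, such as when a pole is encountered or a double root is present, are understood by analytic continuation or taking limits.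
   Formalization: Generic nonvanishing of the determinant is claimed only for n≤2: for n≥3 it vanishes identically, since f''=2A_f f^3+B_f f, and generic z_h admit no λ,κ. The formulas are proved for every n and all λ,κ solving the system; unique solvability is proved whenever the determinant is nonzero. *)

theory Defs
  imports "HOL-Complex_Analysis.Complex_Analysis" "Jordan_Normal_Form.Determinant"
begin

text \<open>Jacobi theta functions in the Whittaker--Watson convention, nome \<open>q = exp (\<pi> i \<tau>)\<close>.
  The power \<open>q^a\<close> is always read as \<open>exp (\<pi> i \<tau> a)\<close>; this fixes the branch for fractional \<open>a\<close>.\<close>

definition nome_pow :: "complex \<Rightarrow> complex \<Rightarrow> complex" where
  "nome_pow \<tau> a = exp (of_real pi * \<i> * \<tau> * a)"

definition theta1 :: "complex \<Rightarrow> complex \<Rightarrow> complex" where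
  "theta1 \<tau> u = 2 * (\<Sum>m. (-1)^m * nome_pow \<tau> ((of_nat m + 1/2)^2) * sin (of_nat (2*m+1) * u))"

definition theta2 :: "complex \<Rightarrow> complex \<Rightarrow> complex" where
  "theta2 \<tau> u = 2 * (\<Sum>m. nome_pow \<tau> ((of_nat m + 1/2)^2) * cos (of_nat (2*m+1) * u))"

definition theta3 :: "complex \<Rightarrow> complex \<Rightarrow> complex" where
  "theta3 \<tau> u = 1 + 2 * (\<Sum>m. nome_pow \<tau> (of_nat (Suc m)^2) * cos (of_nat (2 * Suc m) * u))"

definition theta4 :: "complex \<Rightarrow> complex \<Rightarrow> complex" where
  "theta4 \<tau> u = 1 + 2 * (\<Sum>m. (-1)^(Suc m) * nome_pow \<tau> (of_nat (Suc m)^2) * cos (of_nat (2 * Suc m) * u))"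

definition quarter_K :: "complex \<Rightarrow> complex" where
  "quarter_K \<tau> = of_real pi * (theta3 \<tau> 0)^2 / 2"

definition sn :: "complex \<Rightarrow> complex \<Rightarrow> complex" where
  "sn \<tau> u = theta3 \<tau> 0 / theta2 \<tau> 0 *
     (theta1 \<tau> (of_real pi * u / (2 * quarter_K \<tau>)) / theta4 \<tau> (of_real pi * u / (2 * quarter_K \<tau>)))"

definition cn :: "complex \<Rightarrow> complex \<Rightarrow> complex" where
  "cn \<tau> u = theta4 \<tau> 0 / theta2 \<tau> 0 *
     (theta2 \<tau> (of_real pi * u / (2 * quarter_K \<tau>)) / theta4 \<tau> (of_real pi * u / (2 * quarter_K \<tau>)))"

definition dn :: "complex \<Rightarrow> complex \<Rightarrow> complex" where
  "dn \<tau> u = theta4 \<tau> 0 / theta3 \<tau> 0 *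
     (theta3 \<tau> (of_real pi * u / (2 * quarter_K \<tau>)) / theta4 \<tau> (of_real pi * u / (2 * quarter_K \<tau>)))"

text \<open>Glaisher's notation.\<close>

datatype glaisher = Ls | Lc | Ld | Ln

fun over_n :: "complex \<Rightarrow> glaisher \<Rightarrow> complex \<Rightarrow> complex" where
  "over_n \<tau> Ls = sn \<tau>"
| "over_n \<tau> Lc = cn \<tau>"
| "over_n \<tau> Ld = dn \<tau>"
| "over_n \<tau> Ln = (\<lambda>_. 1)"

text \<open>The quotient \<open>pn/qn\<close> is one of meromorphic functions: e.g. \<open>dc\<close> is regular at the common
  poles of \<open>dn\<close> and \<open>cn\<close>, where the pointwise quotient has a junk value.  Hence \<open>remove_sings\<close>,
  which also assigns the value 0 at the genuine poles.\<close>

definition jacobi :: "complex \<Rightarrow> glaisher \<Rightarrow> glaisher \<Rightarrow> complex \<Rightarrow> complex" where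
  "jacobi \<tau> p q = remove_sings (\<lambda>u. over_n \<tau> p u / over_n \<tau> q u)"

definition periods :: "(complex \<Rightarrow> complex) \<Rightarrow> complex set" where
  "periods f = {\<omega>. \<forall>u. f (u + \<omega>) = f u}"

text \<open>The possible values of \<open>S\<^sub>f\<close>: sums of representatives of the two classes of poles of \<open>f\<close>
  modulo its periods.  They form a single class modulo \<open>periods f\<close>.\<close>

definition pole_sums :: "(complex \<Rightarrow> complex) \<Rightarrow> complex set" where
  "pole_sums f = {p1 + p2 | p1 p2. is_pole f p1 \<and> is_pole f p2 \<and> p1 - p2 \<notin> periods f \<and>
     (\<forall>p. is_pole f p \<longrightarrow> p - p1 \<in> periods f \<or> p - p2 \<in> periods f)}"

text \<open>The number of poles of \<open>g\<close> modulo \<open>\<Lambda>\<close>, counted with multiplicity, for \<open>g\<close> elliptic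
  with respect to \<open>\<Lambda>\<close>.\<close>

definition elliptic_order :: "complex set \<Rightarrow> (complex \<Rightarrow> complex) \<Rightarrow> nat" where
  "elliptic_order \<Lambda> g =
     (\<Sum>P \<in> {p. is_pole g p} // {(x, y). x - y \<in> \<Lambda>}. nat (- zorder g (SOME p. p \<in> P)))"

text \<open>\<open>S\<^sub>r(x\<^sub>1,\<dots>,x\<^sub>N)\<close>; it is 1 for \<open>r = 0\<close> and 0 for \<open>r > N\<close>.\<close>

definition elem_sym :: "nat \<Rightarrow> nat \<Rightarrow> (nat \<Rightarrow> complex) \<Rightarrow> complex" where
  "elem_sym r N x = (\<Sum>I | I \<subseteq> {1..N} \<and> card I = r. \<Prod>i\<in>I. x i)"

definition lincomb ::
  "(complex \<Rightarrow> complex) \<Rightarrow> nat \<Rightarrow> (nat \<Rightarrow> complex) \<Rightarrow> (nat \<Rightarrow> complex) \<Rightarrow> complex \<Rightarrow> complex" where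
  "lincomb f n l k u = (\<Sum>j=1..n. l j * f u ^ j) + (\<Sum>j=1..n-1. k j * (deriv ^^ j) f u)"

definition solves_system ::
  "(complex \<Rightarrow> complex) \<Rightarrow> nat \<Rightarrow> (nat \<Rightarrow> complex) \<Rightarrow> (nat \<Rightarrow> complex) \<Rightarrow> (nat \<Rightarrow> complex) \<Rightarrow> bool" where
  "solves_system f n z l k \<longleftrightarrow> (\<forall>h\<in>{1..2*n-1}. 1 = lincomb f n l k (z h))"

text \<open>The matrix of this system, for the unknowns \<open>\<lambda>\<^sub>1,\<dots>,\<lambda>\<^sub>n,\<kappa>\<^sub>1,\<dots>,\<kappa>\<^sub>n\<^sub>-\<^sub>1\<close> in this order; matrix
  indices start at 0.  For a Jacobi function, \<open>f'' = 2A f\<^sup>3 + B f\<close>, so if \<open>n \<ge> 3\<close> the columns of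
  \<open>\<lambda>\<^sub>1, \<lambda>\<^sub>3, \<kappa>\<^sub>2\<close> are dependent at all non-poles: the determinant can be generically
  nonzero only for \<open>n \<le> 2\<close>.\<close>

definition system_mat :: "(complex \<Rightarrow> complex) \<Rightarrow> nat \<Rightarrow> (nat \<Rightarrow> complex) \<Rightarrow> complex mat" where
  "system_mat f n z = mat (2*n-1) (2*n-1) (\<lambda>(i, j).
     if j < n then f (z (i + 1)) ^ (j + 1) else (deriv ^^ (j - n + 1)) f (z (i + 1)))"

definition phi ::
  "(complex \<Rightarrow> complex) \<Rightarrow> nat \<Rightarrow> (nat \<Rightarrow> complex) \<Rightarrow> (nat \<Rightarrow> complex) \<Rightarrow> complex \<Rightarrow> complex" where
  "phi f n l k u =
     (-1 + (\<Sum>j=1..n. l j * f u ^ j) + (\<Sum>j | j \<in> {1..n-1} \<and> even j. k j * (deriv ^^ j) f u))^2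
     - (\<Sum>j | j \<in> {1..n-1} \<and> odd j. k j * (deriv ^^ j) f u)^2"

text \<open>\<open>\<phi>(u) = \<Sum> c\<^sub>j f\<^sup>j(u)\<close>, as an identity of meromorphic functions.\<close>

definition expands_phi ::
  "(complex \<Rightarrow> complex) \<Rightarrow> nat \<Rightarrow> (nat \<Rightarrow> complex) \<Rightarrow> (nat \<Rightarrow> complex) \<Rightarrow> (nat \<Rightarrow> complex) \<Rightarrow> bool" where
  "expands_phi f n l k c \<longleftrightarrow>
     (\<forall>u. \<not> is_pole f u \<longrightarrow> phi f n l k u = (\<Sum>j=0..2*n. c j * f u ^ j))"

text \<open>\<open>Q\<close> holds off a nowhere dense set of points \<open>(z\<^sub>1,\<dots>,z\<^sub>m)\<close>.  Points are
  represented by functions on \<open>nat\<close>, of which only the values at \<open>1,\<dots>,m\<close> are relevant.\<close>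

definition generically :: "nat \<Rightarrow> ((nat \<Rightarrow> complex) \<Rightarrow> bool) \<Rightarrow> bool" where
  "generically m Q \<longleftrightarrow> (\<forall>a. \<forall>\<epsilon>>0. \<exists>b. \<exists>\<delta>>0. \<forall>z.
     (\<forall>h\<in>{1..m}. dist (z h) (b h) < \<delta>) \<longrightarrow> (\<forall>h\<in>{1..m}. dist (z h) (a h) < \<epsilon>) \<and> Q z)"

end

theory Submission
  imports Defs
begin

text \<open>Let \<open>\<sigma>\<close> be an entire theta function whose zeros are simple and are exactly the periods
  of \<open>f\<close>.  An entire function with the multipliers of a product of \<open>N\<close> translates of \<open>\<sigma>\<close> that vanishes at
  \<open>N - 1\<close> inequivalent points is a constant multiple of such a product, and its multipliers determine
  the last zero.  Applied to \<open>g = -1 + \<Sum> \<lambda>\<^sub>j f\<^sup>j + \<Sum> \<kappa>\<^sub>j f\<^sup>(\<^sup>j\<^sup>)\<close>, cleared of its poles, this gives the zeros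
  \<open>z\<^sub>1, \<dots>, z\<^sub>2\<^sub>n\<^sub>-\<^sub>1, z + \<rho>\<close>.  Since \<open>f (S - u) = f u\<close>, we have \<open>\<phi>(u) = g(u) g(S - u)\<close>, while
  \<open>f(u) - f(v)\<close> vanishes at \<open>v\<close> and \<open>S - v\<close>.  Comparing the \<open>\<sigma>\<close>-factors,
  \<open>\<phi>(u)\<close> is a nonzero constant times \<open>(f(u) - f(z\<^sub>1)) \<dots> (f(u) - f(z + \<rho>))\<close>, also when \<open>f(z + \<rho>)\<close> coincides
  with some \<open>f(z\<^sub>h)\<close>, and Vieta's formulas apply.\<close>

text \<open>Factors \<open>\<sigma> (u - z)\<close> are divided out one at a time, so a repeated
  zero needs no separate treatment and the sum of the zeros can be read off the multipliers. The
  obstacle is that two lattices are in play. The theta functions in the definition of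
  \<open>f\<close> live on the lattice of 2K and 2iK', while the periods of \<open>f\<close> form a
  sublattice of index 2, of one of three kinds. So \<open>\<sigma>\<close> is used twice: on the
  first lattice to write \<open>f\<close> as a theta quotient, on the second to factor everything
  built from \<open>f\<close>. What the twelve functions have in common is isolated in
  \<open>elliptic_order2\<close>, two inequivalent simple poles modulo a lattice of periods; there
  the evenness about S/2 follows from the position of the poles alone. Non-degeneracy of the theta
  constants is drawn from the existence of a pole: in the degenerate cases, division by zero would
  make the function constant.\<close>

section \<open>Division and identity of entire functions\<close>

text \<open>At a zero \<open>a\<close> of \<open>S\<close> the difference quotients of
  \<open>F\<close> and \<open>S\<close> at \<open>a\<close> are entire, and that of \<open>S\<close>
  is nonzero at \<open>a\<close> since the zero is simple. Their quotient continues
  \<open>F / S\<close> across \<open>a\<close>, with the value given by l'Hospital's rule.\<close>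

lemma entire_divide:
  assumes F: "F holomorphic_on UNIV" and S: "S holomorphic_on UNIV"
    and z: "\<And>z. S z = 0 \<Longrightarrow> F z = 0 \<and> deriv S z \<noteq> 0"
  obtains H where "H holomorphic_on UNIV" "\<And>z. F z = S z * H z"
proof -
  define H where "H = (\<lambda>z. if S z = 0 then deriv F z / deriv S z else F z / S z)"
  have op: "open {z. S z \<noteq> 0}"
  proof -
    have "open (S -` (- {0}))"
      using S holomorphic_on_imp_continuous_on continuous_on_open_vimage[of UNIV S] by auto
    thus ?thesis by (simp add: vimage_def)
  qed
  have "H field_differentiable at a" for a
  proof (cases "S a = 0")
    case False
    have "(\<lambda>z. F z / S z) holomorphic_on {z. S z \<noteq> 0}"
      by (intro holomorphic_intros holomorphic_on_subset[OF F] holomorphic_on_subset[OF S]) auto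
    hence "H holomorphic_on {z. S z \<noteq> 0}"
      by (rule holomorphic_transform) (auto simp: H_def)
    thus ?thesis using op False holomorphic_on_imp_differentiable_at by blast
  next
    case True
    note Fa = z[OF True]
    define F1 where "F1 = (\<lambda>z. if z = a then deriv F a else (F z - F a) / (z - a))"
    define S1 where "S1 = (\<lambda>z. if z = a then deriv S a else (S z - S a) / (z - a))"
    have F1: "F1 holomorphic_on UNIV" unfolding F1_def by (rule pole_lemma_open[OF F]) auto
    have S1: "S1 holomorphic_on UNIV" unfolding S1_def by (rule pole_lemma_open[OF S]) auto
    define U where "U = S1 -` (- {0})"
    have U: "open U" unfolding U_def
      using S1 holomorphic_on_imp_continuous_on continuous_on_open_vimage[of UNIV S1] by auto
    have aU: "a \<in> U" using Fa by (simp add: U_def S1_def)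
    have "(\<lambda>z. F1 z / S1 z) holomorphic_on U"
      by (intro holomorphic_intros holomorphic_on_subset[OF F1] holomorphic_on_subset[OF S1])
        (auto simp: U_def)
    hence "H holomorphic_on U"
    proof (rule holomorphic_transform)
      fix w assume w: "w \<in> U"
      show "F1 w / S1 w = H w"
      proof (cases "w = a")
        case True
        thus ?thesis using \<open>S a = 0\<close> by (simp add: F1_def S1_def H_def)
      next
        case False
        with w \<open>S a = 0\<close> have "S w \<noteq> 0" by (auto simp: U_def S1_def)
        with False Fa \<open>S a = 0\<close> show ?thesis by (simp add: F1_def S1_def H_def)
      qed
    qed
    thus ?thesis using U aU holomorphic_on_imp_differentiable_at by blast
  qed
  hence "H holomorphic_on UNIV" by (simp add: holomorphic_on_def field_differentiable_at_within)
  moreover have "F z = S z * H z" for z using z[of z] by (auto simp: H_def)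
  ultimately show ?thesis using that by blast
qed

text \<open>Identity theorem on the open nonempty set where \<open>S\<close> is nonzero. This
  carries identities known only away from poles over to the poles.\<close>

lemma entire_mult_eq_0:
  assumes F: "F holomorphic_on UNIV" and S: "S holomorphic_on UNIV"
    and "S a \<noteq> 0" and FS: "\<And>z. S z \<noteq> 0 \<Longrightarrow> F z = 0"
  shows "F z = (0::complex)"
proof -
  have op: "open (S -` (- {0}))"
    using S holomorphic_on_imp_continuous_on continuous_on_open_vimage[of UNIV S] by auto
  show ?thesis
    by (rule analytic_continuation_open[of "S -` (- {0})" UNIV F "\<lambda>_. 0"])
      (use assms op in auto)
qed

lemma entire_eqI_off_zeros:
  assumes "F holomorphic_on UNIV" "G holomorphic_on UNIV" "S holomorphic_on UNIV"
    and "S a \<noteq> 0" and "\<And>z. S z \<noteq> 0 \<Longrightarrow> F z = G z"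
  shows "F z = (G z :: complex)"
  using entire_mult_eq_0[of "\<lambda>z. F z - G z" S a z] assms by (auto intro!: holomorphic_intros)

lemma holomorphic_shift:
  assumes "H holomorphic_on UNIV" shows "(\<lambda>u. H (u + c)) holomorphic_on UNIV"
  by (rule holomorphic_on_compose_gen[of "\<lambda>u. u + c" UNIV H UNIV, unfolded o_def])
    (use assms in \<open>auto intro!: holomorphic_intros\<close>)

section \<open>Euler's product as a power series\<close>

text \<open>In closed form, (-1)^m Q^(m(m-1)/2) / ((1-Q)...(1-Q^m)).\<close>

fun euler_coeff :: "complex \<Rightarrow> nat \<Rightarrow> complex" where
  "euler_coeff Q 0 = 1"
| "euler_coeff Q (Suc m) = - (Q ^ m) / (1 - Q ^ Suc m) * euler_coeff Q m"

text \<open>Euler's expansion of the product of the factors \<open>1 - Q^m x\<close> over \<open>m \<ge> 0\<close>.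
  The product itself is never needed, only the functional equation \<open>euler_prod_shift\<close>.\<close>

definition euler_prod :: "complex \<Rightarrow> complex \<Rightarrow> complex" where
  "euler_prod Q x = (\<Sum>m. euler_coeff Q m * x ^ m)"

context
  fixes Q :: complex
  assumes Q: "norm Q < 1"
begin

lemma Q_power_neq_1: "Q ^ Suc m \<noteq> 1"
proof
  assume "Q ^ Suc m = 1"
  hence "norm Q ^ Suc m = 1" by (metis norm_one norm_power)
  moreover have "norm Q ^ Suc m < 1 ^ Suc m" using Q by (intro power_strict_mono) auto
  ultimately show False by simp
qed

text \<open>The factor Q^m sends the ratio of consecutive terms to 0 for every \<open>x\<close>, so
  the series is entire.\<close>

lemma summable_euler: "summable (\<lambda>m. euler_coeff Q m * x ^ m)"
proof -
  have lim: "(\<lambda>m. - (Q ^ m) / (1 - Q ^ Suc m) * x) \<longlonglongrightarrow> - 0 / (1 - 0) * x"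
    using Q by (intro tendsto_intros LIMSEQ_power_zero filterlim_compose[OF LIMSEQ_power_zero filterlim_Suc]) auto
  hence "(\<lambda>m. norm (- (Q ^ m) / (1 - Q ^ Suc m) * x)) \<longlonglongrightarrow> 0"
    using tendsto_norm_zero by force
  hence "eventually (\<lambda>m. norm (- (Q ^ m) / (1 - Q ^ Suc m) * x) < 1/2) sequentially"
    by (rule order_tendstoD) auto
  then obtain N where N: "\<And>m. m \<ge> N \<Longrightarrow> norm (- (Q ^ m) / (1 - Q ^ Suc m) * x) < 1/2"
    by (auto simp: eventually_sequentially)
  show ?thesis
  proof (rule summable_ratio_test[of "1/2" N])
    fix m assume "m \<ge> N"
    have "norm (euler_coeff Q (Suc m) * x ^ Suc m)
        = norm (- (Q ^ m) / (1 - Q ^ Suc m) * x) * norm (euler_coeff Q m * x ^ m)"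
      by (simp add: norm_mult norm_divide norm_power)
    also have "\<dots> \<le> 1/2 * norm (euler_coeff Q m * x ^ m)"
      using N[OF \<open>m \<ge> N\<close>] by (intro mult_right_mono) auto
    finally show "norm (euler_coeff Q (Suc m) * x ^ Suc m) \<le> 1/2 * norm (euler_coeff Q m * x ^ m)" .
  qed auto
qed

lemma euler_prod_differentiable: "euler_prod Q field_differentiable at x"
proof -
  have "DERIV (\<lambda>x. \<Sum>m. euler_coeff Q m * x ^ m) x :> (\<Sum>n. diffs (euler_coeff Q) n * x ^ n)"
    by (rule termdiffs_strong_converges_everywhere) (rule summable_euler)
  thus ?thesis unfolding euler_prod_def[abs_def] field_differentiable_def by blast
qed

lemma euler_prod_holomorphic: "euler_prod Q holomorphic_on A"
  by (simp add: holomorphic_on_def euler_prod_differentiable field_differentiable_at_within)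

lemma euler_prod_0 [simp]: "euler_prod Q 0 = 1"
  unfolding euler_prod_def by (subst powser_zero) simp

text \<open>Comparing coefficients of x^(m+1), the equation says e(m+1) (1 - Q^(m+1)) = - Q^m e(m),
  which is the recursion of \<open>euler_coeff\<close>.\<close>

lemma euler_prod_shift: "euler_prod Q x = (1 - x) * euler_prod Q (Q * x)"
proof -
  let ?e = "euler_coeff Q"
  have s1: "euler_prod Q x = 1 + (\<Sum>m. ?e (Suc m) * x ^ Suc m)" for x
    unfolding euler_prod_def using suminf_split_head[OF summable_euler[of x]] by simp
  have s2: "summable (\<lambda>m. ?e (Suc m) * x ^ Suc m)" for x
    using summable_euler[of x] by (subst summable_Suc_iff)
  have "(\<Sum>m. ?e (Suc m) * x ^ Suc m) - (\<Sum>m. ?e (Suc m) * (Q * x) ^ Suc m)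
      = (\<Sum>m. ?e (Suc m) * x ^ Suc m - ?e (Suc m) * (Q * x) ^ Suc m)"
    by (rule suminf_diff[OF s2 s2])
  also have "\<dots> = (\<Sum>m. - x * (?e m * (Q * x) ^ m))"
  proof (rule arg_cong[of _ _ suminf], rule ext)
    fix m
    have "1 - Q ^ Suc m \<noteq> 0" using Q_power_neq_1[of m] by simp
    hence "?e (Suc m) * (1 - Q ^ Suc m) = - (Q ^ m) * ?e m" by (simp add: field_simps)
    have "?e (Suc m) * x ^ Suc m - ?e (Suc m) * (Q * x) ^ Suc m = ?e (Suc m) * (1 - Q ^ Suc m) * x ^ Suc m"
      by (simp add: power_mult_distrib algebra_simps del: euler_coeff.simps)
    also have "\<dots> = - (Q ^ m) * ?e m * x ^ Suc m" by (subst \<open>?e (Suc m) * (1 - Q ^ Suc m) = - (Q ^ m) * ?e m\<close>) simp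
    finally show "?e (Suc m) * x ^ Suc m - ?e (Suc m) * (Q * x) ^ Suc m = - x * (?e m * (Q * x) ^ m)"
      by (simp add: power_mult_distrib)
  qed
  also have "\<dots> = - x * euler_prod Q (Q * x)"
    unfolding euler_prod_def using summable_euler by (rule suminf_mult)
  finally show ?thesis using s1[of x] s1[of "Q * x"] by (simp add: algebra_simps)
qed

lemma euler_prod_shift_power: "euler_prod Q x = (\<Prod>j<n. 1 - Q ^ j * x) * euler_prod Q (Q ^ n * x)"
proof (induction n)
  case (Suc n)
  show ?case using Suc euler_prod_shift[of "Q ^ n * x"] by (simp add: mult_ac)
qed simp

text \<open>Since Q^n x tends to 0, where the function is continuous with value 1, enough shifts
  leave a nonzero remaining factor. A zero must then come from the finite product that was split
  off.\<close>

lemma euler_prod_eq_0_iff: "euler_prod Q x = 0 \<longleftrightarrow> (\<exists>m. Q ^ m * x = 1)"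
proof
  assume 0: "euler_prod Q x = 0"
  have "(\<lambda>n. euler_prod Q (Q ^ n * x)) \<longlonglongrightarrow> euler_prod Q (0 * x)"
    using Q by (intro isCont_tendsto_compose[OF field_differentiable_imp_continuous_at[OF euler_prod_differentiable]]
        tendsto_intros LIMSEQ_power_zero)
  hence "eventually (\<lambda>n. euler_prod Q (Q ^ n * x) \<noteq> 0) sequentially"
    by (rule tendsto_imp_eventually_ne) simp
  then obtain n where "euler_prod Q (Q ^ n * x) \<noteq> 0" by (auto simp: eventually_sequentially)
  with 0 euler_prod_shift_power[of x n] have "(\<Prod>j<n. 1 - Q ^ j * x) = 0" by auto
  thus "\<exists>m. Q ^ m * x = 1" by auto
next
  assume "\<exists>m. Q ^ m * x = 1"
  then obtain m where "Q ^ m * x = 1" by blast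
  thus "euler_prod Q x = 0" using euler_prod_shift_power[of x "Suc m"] by auto
qed

end

section \<open>Theta functions of a lattice\<close>

locale lattice2 =
  fixes \<omega>1 \<omega>2 :: complex
  assumes Im_ratio: "Im (\<omega>2 / \<omega>1) > 0"
begin

definition Lat :: "complex set" where
  "Lat = {of_int m * \<omega>1 + of_int n * \<omega>2 | m n. True}"

lemma \<omega>1_nz: "\<omega>1 \<noteq> 0"
  using Im_ratio by auto

text \<open>Writing functions in terms of \<open>ee u\<close> builds in the period
  \<open>\<omega>1\<close>; \<open>ee \<omega>2\<close> becomes the base of the Euler
  products.\<close>

definition ee :: "complex \<Rightarrow> complex" where "ee u = exp (2 * of_real pi * \<i> * u / \<omega>1)"

lemma ee_nz [simp]: "ee u \<noteq> 0" by (simp add: ee_def)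
lemma ee_0 [simp]: "ee 0 = 1" by (simp add: ee_def)
lemma ee_add: "ee (u + v) = ee u * ee v" by (simp add: ee_def exp_add add_divide_distrib ring_distribs)
lemma ee_minus: "ee (- u) = 1 / ee u" by (simp add: ee_def exp_minus field_simps)
lemma ee_diff: "ee (u - v) = ee u / ee v"
  using ee_add[of u "- v"] ee_minus[of v] by simp
lemma ee_\<omega>1 [simp]: "ee \<omega>1 = 1" using \<omega>1_nz by (simp add: ee_def)
lemma ee_mult_of_nat: "ee (of_nat n * u) = ee u ^ n"
  by (simp add: ee_def exp_of_nat_mult[symmetric] mult_ac)
lemma ee_mult_of_int: "ee (of_int n * u) = ee u powi n"
proof (cases n rule: int_cases2)
  case (nonneg m)
  thus ?thesis by (simp only: of_int_of_nat_eq ee_mult_of_nat power_int_of_nat)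
next
  case (nonpos m)
  thus ?thesis
    using ee_minus[of "of_nat m * u"]
    by (simp only: of_int_of_nat_eq ee_mult_of_nat of_int_minus mult_minus_left power_int_minus
        power_int_of_nat inverse_eq_divide)
qed

lemma norm_ee_\<omega>2: "norm (ee \<omega>2) < 1"
proof -
  have "norm (ee \<omega>2) = exp (- (2 * pi * Im (\<omega>2 / \<omega>1)))"
  proof -
    have "2 * of_real pi * \<i> * \<omega>2 / \<omega>1 = of_real (2 * pi) * (\<i> * (\<omega>2 / \<omega>1))" by simp
    thus ?thesis unfolding ee_def norm_exp_eq_Re by (simp only: times_complex.sel Re_complex_of_real Im_complex_of_real Re_i_times, simp)
  qed
  thus ?thesis using Im_ratio by simp
qed

lemma ee_holomorphic [holomorphic_intros]: "g holomorphic_on A \<Longrightarrow> (\<lambda>u. ee (g u)) holomorphic_on A"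
  unfolding ee_def using \<omega>1_nz by (intro holomorphic_intros) auto

lemma ee_eq_iff: "ee u = ee v \<longleftrightarrow> (\<exists>j::int. u = v + of_int j * \<omega>1)"
proof -
  have "ee u = ee v \<longleftrightarrow> (\<exists>n::int. 2 * of_real pi * \<i> * u / \<omega>1 = 2 * of_real pi * \<i> * v / \<omega>1 + (of_int (2 * n) * pi) * \<i>)"
    unfolding ee_def exp_eq ..
  also have "\<dots> \<longleftrightarrow> (\<exists>j::int. u = v + of_int j * \<omega>1)"
  proof (intro iff_exI)
    fix n :: int
    have "2 * of_real pi * \<i> * u / \<omega>1 = 2 * of_real pi * \<i> * v / \<omega>1 + (of_int (2 * n) * pi) * \<i>
      \<longleftrightarrow> (2 * of_real pi * \<i>) * u = (2 * of_real pi * \<i>) * (v + of_int n * \<omega>1)"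
      using \<omega>1_nz by (auto simp: field_simps)
    also have "\<dots> \<longleftrightarrow> u = v + of_int n * \<omega>1" by (subst mult_cancel_left) simp
    finally show "2 * of_real pi * \<i> * u / \<omega>1 = 2 * of_real pi * \<i> * v / \<omega>1 + (of_int (2 * n) * pi) * \<i> \<longleftrightarrow> u = v + of_int n * \<omega>1" .
  qed
  finally show ?thesis .
qed

text \<open>The product side of Jacobi's triple product: up to a constant this is theta_1 without
  its exponential factor, so that \<open>\<omega>1\<close> is a genuine period. Each lattice point
  is a zero of exactly one factor.\<close>

definition \<sigma> :: "complex \<Rightarrow> complex" where
  "\<sigma> u = euler_prod (ee \<omega>2) (ee \<omega>2 * ee u) * euler_prod (ee \<omega>2) (1 / ee u)"

lemma \<sigma>_holomorphic [holomorphic_intros]: "g holomorphic_on A \<Longrightarrow> (\<lambda>u. \<sigma> (g u)) holomorphic_on A"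
  unfolding \<sigma>_def
  by (intro holomorphic_intros holomorphic_on_compose_gen[OF _ euler_prod_holomorphic[OF norm_ee_\<omega>2], of _ _ UNIV, unfolded o_def]) auto

lemma \<sigma>_\<omega>1: "\<sigma> (u + \<omega>1) = \<sigma> u"
  by (simp add: \<sigma>_def ee_add)

text \<open>With Q = \<open>ee \<omega>2\<close> and x = \<open>ee u\<close>, the first product
  loses the factor 1 - Q x and the second gains 1 - 1/(Q x); the quotient of these two is the
  multiplier.\<close>

lemma \<sigma>_\<omega>2: "\<sigma> (u + \<omega>2) = - (1 / (ee \<omega>2 * ee u)) * \<sigma> u"
proof -
  let ?P = "euler_prod (ee \<omega>2)" and ?Q = "ee \<omega>2" and ?w = "ee u"
  have 1: "?P (?Q * ?w) = (1 - ?Q * ?w) * ?P (?Q * (?Q * ?w))"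
    by (rule euler_prod_shift[OF norm_ee_\<omega>2])
  have 2: "?P (1 / (?Q * ?w)) = (1 - 1 / (?Q * ?w)) * ?P (1 / ?w)"
    using euler_prod_shift[OF norm_ee_\<omega>2, of "1 / (?Q * ?w)"] by simp
  have "\<sigma> (u + \<omega>2) = ?P (?Q * (?Q * ?w)) * ?P (1 / (?Q * ?w))"
    by (simp add: \<sigma>_def ee_add mult_ac)
  also have "\<dots> = - (1 / (?Q * ?w)) * ((1 - ?Q * ?w) * ?P (?Q * (?Q * ?w)) * ?P (1 / ?w))"
    unfolding 2 by (simp add: field_simps)
  also have "\<dots> = - (1 / (?Q * ?w)) * \<sigma> u"
    unfolding 1[symmetric] \<sigma>_def ..
  finally show ?thesis .
qed

text \<open>Once the factor vanishing at 0 is split off, the rest is even in \<open>u\<close>. This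
  yields the reflection formula and the derivative at 0.\<close>

lemma \<sigma>_alt: "\<sigma> u = (1 - 1 / ee u) * (euler_prod (ee \<omega>2) (ee \<omega>2 * ee u) * euler_prod (ee \<omega>2) (ee \<omega>2 / ee u))"
  using euler_prod_shift[OF norm_ee_\<omega>2, of "1 / ee u"] by (simp add: \<sigma>_def)

lemma \<sigma>_minus: "\<sigma> (- u) = - ee u * \<sigma> u"
  unfolding \<sigma>_alt[of u] \<sigma>_alt[of "-u"] by (simp add: ee_minus field_simps)

text \<open>The second product vanishes when \<open>ee u\<close> is a nonnegative power of
  \<open>ee \<omega>2\<close>, the first when it is a negative one. Equal values of
  \<open>ee\<close> differ by multiples of \<open>\<omega>1\<close>.\<close>

lemma \<sigma>_eq_0_iff: "\<sigma> u = 0 \<longleftrightarrow> u \<in> Lat"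
proof -
  have "\<sigma> u = 0 \<longleftrightarrow> (\<exists>m. ee \<omega>2 ^ m * (ee \<omega>2 * ee u) = 1) \<or> (\<exists>m. ee \<omega>2 ^ m * (1 / ee u) = 1)"
    unfolding \<sigma>_def mult_eq_0_iff euler_prod_eq_0_iff[OF norm_ee_\<omega>2] ..
  also have "\<dots> \<longleftrightarrow> (\<exists>n::int. ee u = ee (of_int n * \<omega>2))"
  proof safe
    fix m assume "ee \<omega>2 ^ m * (ee \<omega>2 * ee u) = 1"
    hence "ee u = ee (of_int (- int (Suc m)) * \<omega>2)"
      unfolding ee_mult_of_int power_int_minus power_int_of_nat by (simp add: field_simps)
    thus "\<exists>n::int. ee u = ee (of_int n * \<omega>2)" ..
  next
    fix m assume "ee \<omega>2 ^ m * (1 / ee u) = 1"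
    hence "ee u = ee (of_int (int m) * \<omega>2)"
      unfolding ee_mult_of_int power_int_of_nat by (simp add: field_simps)
    thus "\<exists>n::int. ee u = ee (of_int n * \<omega>2)" ..
  next
    fix n :: int
    assume n: "ee u = ee (of_int n * \<omega>2)" and no: "\<nexists>m. ee \<omega>2 ^ m * (1 / ee u) = 1"
    show "\<exists>m. ee \<omega>2 ^ m * (ee \<omega>2 * ee u) = 1"
    proof (cases "n \<ge> 0")
      case True
      then obtain m where "n = int m" using nonneg_int_cases by blast
      thus ?thesis using n no unfolding ee_mult_of_int by auto
    next
      case False
      then obtain m where m: "n = - int (Suc m)" by (cases n rule: int_cases) auto
      have "ee u * ee \<omega>2 ^ Suc m = 1"
        using n unfolding ee_mult_of_int m power_int_minus power_int_of_nat by (simp add: field_simps)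
      thus ?thesis by (intro exI[of _ m]) (simp add: mult_ac)
    qed
  qed
  also have "\<dots> \<longleftrightarrow> u \<in> Lat"
    unfolding ee_eq_iff Lat_def mem_Collect_eq by (metis add.commute)
  finally show ?thesis .
qed

lemma deriv_\<sigma>_0: "deriv \<sigma> 0 \<noteq> 0"
proof -
  let ?G = "\<lambda>u. euler_prod (ee \<omega>2) (ee \<omega>2 * ee u) * euler_prod (ee \<omega>2) (ee \<omega>2 / ee u)"
  have "?G holomorphic_on UNIV"
    by (intro holomorphic_intros holomorphic_on_compose_gen[OF _ euler_prod_holomorphic[OF norm_ee_\<omega>2], of _ _ UNIV, unfolded o_def]) auto
  then obtain G' where G': "(?G has_field_derivative G') (at 0)"
    by (metis UNIV_I holomorphic_derivI open_UNIV)
  have "((\<lambda>u. 1 - 1 / ee u) has_field_derivative (2 * of_real pi * \<i> / \<omega>1)) (at 0)"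
    unfolding ee_def using \<omega>1_nz by (auto intro!: derivative_eq_intros)
  from DERIV_mult[OF this G'] have "(\<sigma> has_field_derivative (2 * of_real pi * \<i> / \<omega>1) * ?G 0) (at 0)"
    unfolding \<sigma>_alt[abs_def] by simp
  hence "deriv \<sigma> 0 = (2 * of_real pi * \<i> / \<omega>1) * ?G 0" by (rule DERIV_imp_deriv)
  moreover have "euler_prod (ee \<omega>2) (ee \<omega>2) \<noteq> 0"
    using euler_prod_eq_0_iff[OF norm_ee_\<omega>2, of "ee \<omega>2"] Q_power_neq_1[OF norm_ee_\<omega>2]
    by (auto simp: mult.commute)
  ultimately show ?thesis using \<omega>1_nz by simp
qed

lemma Lat_0 [simp]: "0 \<in> Lat"
  unfolding Lat_def by (auto intro!: exI[of _ "0::int"])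

lemma Lat_add: "x \<in> Lat \<Longrightarrow> y \<in> Lat \<Longrightarrow> x + y \<in> Lat"
proof -
  assume "x \<in> Lat" "y \<in> Lat"
  then obtain m n m' n' where "x = of_int m * \<omega>1 + of_int n * \<omega>2" "y = of_int m' * \<omega>1 + of_int n' * \<omega>2"
    unfolding Lat_def by auto
  hence "x + y = of_int (m + m') * \<omega>1 + of_int (n + n') * \<omega>2" by (simp add: algebra_simps)
  thus ?thesis unfolding Lat_def by blast
qed

lemma Lat_minus: "x \<in> Lat \<Longrightarrow> - x \<in> Lat"
proof -
  assume "x \<in> Lat"
  then obtain m n where "x = of_int m * \<omega>1 + of_int n * \<omega>2" unfolding Lat_def by auto
  hence "- x = of_int (- m) * \<omega>1 + of_int (- n) * \<omega>2" by (simp add: algebra_simps)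
  thus ?thesis unfolding Lat_def by blast
qed

lemma Lat_diff: "x \<in> Lat \<Longrightarrow> y \<in> Lat \<Longrightarrow> x - y \<in> Lat"
  using Lat_add[OF _ Lat_minus] by fastforce

lemma Lat_diff_commute: "x - y \<in> Lat \<longleftrightarrow> y - x \<in> Lat"
  using Lat_minus[of "x - y"] Lat_minus[of "y - x"] by auto

lemma Lat_\<omega>1 [simp]: "\<omega>1 \<in> Lat"
proof -
  have "\<omega>1 = of_int 1 * \<omega>1 + of_int 0 * \<omega>2" by simp
  thus ?thesis unfolding Lat_def by blast
qed

lemma Lat_\<omega>2 [simp]: "\<omega>2 \<in> Lat"
proof -
  have "\<omega>2 = of_int 0 * \<omega>1 + of_int 1 * \<omega>2" by simp
  thus ?thesis unfolding Lat_def by blast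
qed

lemma Lat_induct [consumes 1, case_names zero \<omega>1 \<omega>2 add minus]:
  assumes "x \<in> Lat" "P 0" "P \<omega>1" "P \<omega>2"
    and add: "\<And>x y. P x \<Longrightarrow> P y \<Longrightarrow> P (x + y)" and minus: "\<And>x. P x \<Longrightarrow> P (- x)"
  shows "P x"
proof -
  have nat: "P (of_nat n * y)" if "P y" for n y
    by (induction n) (use assms that in \<open>auto simp: algebra_simps\<close>)
  have int: "P (of_int n * y)" if "P y" for n y
    by (cases n rule: int_cases2) (use nat[OF that] minus in auto)
  show ?thesis using assms(1) unfolding Lat_def by (auto intro!: add int assms)
qed

section \<open>Entire functions with theta multipliers and their factorization\<close>

text \<open>These are the multipliers of a product of \<open>N\<close> factors
  \<open>\<sigma> (u - z)\<close> whose zeros \<open>z\<close> add up to \<open>s\<close>.\<close>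

definition Theta :: "nat \<Rightarrow> complex \<Rightarrow> (complex \<Rightarrow> complex) \<Rightarrow> bool" where
  "Theta N s F \<longleftrightarrow> F holomorphic_on UNIV \<and> (\<forall>u. F (u + \<omega>1) = F u) \<and>
     (\<forall>u. F (u + \<omega>2) = (-1) ^ N * ee (s - of_nat N * (u + \<omega>2)) * F u)"

lemma Theta_holomorphic: "Theta N s F \<Longrightarrow> F holomorphic_on A"
  unfolding Theta_def using holomorphic_on_subset by blast

lemma Theta_\<sigma>: "Theta 1 z (\<lambda>u. \<sigma> (u - z))"
proof -
  have "\<sigma> (u + \<omega>1 - z) = \<sigma> (u - z)" for u
    using \<sigma>_\<omega>1[of "u - z"] by (simp add: algebra_simps)
  moreover have "\<sigma> (u + \<omega>2 - z) = - ee (z - (u + \<omega>2)) * \<sigma> (u - z)" for u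
    using \<sigma>_\<omega>2[of "u - z"] by (simp add: algebra_simps ee_diff ee_add)
  ultimately show ?thesis by (auto simp: Theta_def intro!: holomorphic_intros)
qed

lemma Theta_const: "Theta 0 0 (\<lambda>_. c)"
  by (simp add: Theta_def)

lemma Theta_mult: "Theta N s F \<Longrightarrow> Theta N' s' F' \<Longrightarrow> Theta (N + N') (s + s') (\<lambda>u. F u * F' u)"
proof -
  have "ee (s + s' - of_nat (N + N') * v) = ee (s - of_nat N * v) * ee (s' - of_nat N' * v)" for v
    unfolding ee_add[symmetric] by (simp add: algebra_simps)
  thus "Theta N s F \<Longrightarrow> Theta N' s' F' \<Longrightarrow> Theta (N + N') (s + s') (\<lambda>u. F u * F' u)"
    unfolding Theta_def by (auto intro!: holomorphic_intros simp: power_add)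
qed

lemma Theta_cmult: "Theta N s F \<Longrightarrow> Theta N s (\<lambda>u. c * F u)"
  using Theta_mult[OF Theta_const] by fastforce

lemma Theta_diff: "Theta N s F \<Longrightarrow> Theta N s F' \<Longrightarrow> Theta N s (\<lambda>u. F u - F' u)"
  unfolding Theta_def by (auto intro!: holomorphic_intros simp: ring_distribs)

text \<open>The multiplier for a lattice translation depends on \<open>N\<close> and \<open>s\<close> only, and being an
  exponential it is the same for the derivatives at a zero.\<close>

lemma Theta_translate:
  assumes "x \<in> Lat"
  shows "\<exists>c d. c \<noteq> 0 \<and> (\<forall>F u. Theta N s F \<longrightarrow> F (u + x) = c * exp (d * u) * F u)"
  using assms
proof (induction rule: Lat_induct)
  case zero
  show ?case by (rule exI[of _ 1], rule exI[of _ 0]) simp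
next
  case \<omega>1
  show ?case by (rule exI[of _ 1], rule exI[of _ 0]) (simp add: Theta_def)
next
  case \<omega>2
  have "ee (s - of_nat N * (u + \<omega>2)) = ee (s - of_nat N * \<omega>2) * exp ((- 2 * of_real pi * \<i> * of_nat N / \<omega>1) * u)" for u
    unfolding ee_def exp_add[symmetric] using \<omega>1_nz by (intro arg_cong[of _ _ exp]) (simp add: field_simps)
  thus ?case
    by (intro exI[of _ "(-1) ^ N * ee (s - of_nat N * \<omega>2)"] exI[of _ "- 2 * of_real pi * \<i> * of_nat N / \<omega>1"])
      (simp add: Theta_def)
next
  case (add x y)
  then obtain c d c' d' where 1: "c \<noteq> 0" "\<And>F u. Theta N s F \<Longrightarrow> F (u + x) = c * exp (d * u) * F u"
    and 2: "c' \<noteq> 0" "\<And>F u. Theta N s F \<Longrightarrow> F (u + y) = c' * exp (d' * u) * F u" by metis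
  have "F (u + (x + y)) = (c * c' * exp (d' * x)) * exp ((d + d') * u) * F u" if "Theta N s F" for F u
    using 1(2)[OF that, of u] 2(2)[OF that, of "u + x"] by (simp add: exp_add ring_distribs mult_ac add_ac)
  thus ?case using 1 2 by (intro exI[of _ "c * c' * exp (d' * x)"] exI[of _ "d + d'"]) auto
next
  case (minus x)
  then obtain c d where 1: "c \<noteq> 0" "\<And>F u. Theta N s F \<Longrightarrow> F (u + x) = c * exp (d * u) * F u" by metis
  have "F (u + - x) = (exp (d * x) / c) * exp (- d * u) * F u" if "Theta N s F" for F u
    using 1(1) 1(2)[OF that, of "u - x"] by (simp add: exp_minus exp_diff ring_distribs field_simps)
  thus ?case using 1 by (intro exI[of _ "exp (d * x) / c"] exI[of _ "- d"]) auto
qed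

lemma Theta_zero_translate:
  assumes "Theta N s F" "u - v \<in> Lat" "F u = 0" shows "F v = 0"
proof -
  have "v - u \<in> Lat" using assms(2) Lat_diff_commute by blast
  from Theta_translate[OF this, of N s] assms(1) obtain c where "F (u + (v - u)) = c * F u" by metis
  thus ?thesis using assms(3) by simp
qed

text \<open>A lattice translation multiplies \<open>\<sigma>\<close> by c exp(d v) with nonzero c,
  so the zero at \<open>u\<close> is simple because the zero at 0 is.\<close>

lemma deriv_\<sigma>_nz:
  assumes "\<sigma> (u - z) = 0" shows "deriv (\<lambda>u. \<sigma> (u - z)) u \<noteq> 0"
proof -
  have "u - z \<in> Lat" using assms by (simp add: \<sigma>_eq_0_iff)
  from Theta_translate[OF this, of 1 0] Theta_\<sigma>[of 0] obtain c d where c: "c \<noteq> 0"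
    and cd: "\<And>v. \<sigma> (v + (u - z)) = c * exp (d * v) * \<sigma> v" by auto
  have "(\<sigma> has_field_derivative deriv \<sigma> 0) (at 0)"
    using \<sigma>_holomorphic[of "\<lambda>u. u" UNIV] holomorphic_derivI by (metis UNIV_I holomorphic_on_ident open_UNIV)
  hence "((\<lambda>v. c * exp (d * v) * \<sigma> v) has_field_derivative c * deriv \<sigma> 0) (at 0)"
    by (auto intro!: derivative_eq_intros simp: \<sigma>_eq_0_iff)
  hence "((\<lambda>v. \<sigma> (v + (u - z))) has_field_derivative c * deriv \<sigma> 0) (at (u - u))"
    unfolding cd by simp
  from DERIV_shift[of "\<lambda>v. \<sigma> (v + (u - z))" _ "u" "-u"] this
  have "((\<lambda>v. \<sigma> (v - z)) has_field_derivative c * deriv \<sigma> 0) (at u)"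
    by (simp add: algebra_simps)
  thus ?thesis using c deriv_\<sigma>_0 DERIV_imp_deriv by fastforce
qed

lemma real_coords:
  obtains a b :: real where "u = of_real a * \<omega>1 + of_real b * \<omega>2"
proof -
  define b where "b = Im (u / \<omega>1) / Im (\<omega>2 / \<omega>1)"
  define a where "a = Re (u / \<omega>1) - b * Re (\<omega>2 / \<omega>1)"
  have "u / \<omega>1 = of_real a + of_real b * (\<omega>2 / \<omega>1)"
  proof (rule complex_eqI)
    show "Re (u / \<omega>1) = Re (of_real a + of_real b * (\<omega>2 / \<omega>1))"
      unfolding a_def plus_complex.sel times_complex.sel Re_complex_of_real Im_complex_of_real by simp
    show "Im (u / \<omega>1) = Im (of_real a + of_real b * (\<omega>2 / \<omega>1))"
      using Im_ratio unfolding b_def plus_complex.sel times_complex.sel Re_complex_of_real Im_complex_of_real by simp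
  qed
  hence "u = of_real a * \<omega>1 + of_real b * \<omega>2" using \<omega>1_nz by (simp add: field_simps)
  thus ?thesis using that by blast
qed

lemma real_coords_unique:
  assumes "of_real a * \<omega>1 + of_real b * \<omega>2 = 0" shows "a = 0 \<and> b = 0"
proof -
  have eq: "of_real a + of_real b * (\<omega>2 / \<omega>1) = 0" using assms \<omega>1_nz by (simp add: field_simps)
  from arg_cong[OF eq, of Im] have "b * Im (\<omega>2 / \<omega>1) = 0"
    unfolding plus_complex.sel times_complex.sel Re_complex_of_real Im_complex_of_real by simp
  hence "b = 0" using Im_ratio by simp
  thus ?thesis using eq by simp
qed

lemma of_real_in_Lat_iff: "of_real a * \<omega>1 + of_real b * \<omega>2 \<in> Lat \<longleftrightarrow> a \<in> \<int> \<and> b \<in> \<int>"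
proof
  assume "of_real a * \<omega>1 + of_real b * \<omega>2 \<in> Lat"
  then obtain m n where "of_real a * \<omega>1 + of_real b * \<omega>2 = of_int m * \<omega>1 + of_int n * \<omega>2"
    unfolding Lat_def by auto
  hence "of_real (a - of_int m) * \<omega>1 + of_real (b - of_int n) * \<omega>2 = 0" by (simp add: algebra_simps)
  from real_coords_unique[OF this] show "a \<in> \<int> \<and> b \<in> \<int>" by (auto simp: Ints_def)
next
  assume "a \<in> \<int> \<and> b \<in> \<int>"
  then obtain m n where "a = of_int m" "b = of_int n" by (auto elim!: Ints_cases)
  thus "of_real a * \<omega>1 + of_real b * \<omega>2 \<in> Lat" unfolding Lat_def by auto
qed

text \<open>Every value is taken on a period parallelogram, which lies in the disc of radius
  |\<omega>1| + |\<omega>2|. So \<open>F\<close> is bounded and Liouville's theorem applies.\<close>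

lemma elliptic_entire_constant:
  assumes hol: "F holomorphic_on UNIV" and "\<And>u. F (u + \<omega>1) = F u" "\<And>u. F (u + \<omega>2) = F u"
  shows "\<exists>k. \<forall>u. F u = k"
proof -
  have per: "F (u + x) = F u" if "x \<in> Lat" for x u
    using that
  proof (induction arbitrary: u rule: Lat_induct)
    case (add x y)
    thus ?case by (metis add.assoc)
  next
    case (minus x)
    thus ?case by (metis diff_add_cancel uminus_add_conv_diff add.commute)
  qed (use assms in auto)
  define R where "R = norm \<omega>1 + norm \<omega>2"
  have "bounded (F ` cball 0 R)"
    by (intro compact_imp_bounded compact_continuous_image holomorphic_on_imp_continuous_on
        holomorphic_on_subset[OF hol]) auto
  moreover have "range F \<subseteq> F ` cball 0 R"
  proof safe
    fix u
    obtain a b where u: "u = of_real a * \<omega>1 + of_real b * \<omega>2" by (rule real_coords)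
    define v where "v = of_real (frac a) * \<omega>1 + of_real (frac b) * \<omega>2"
    have "u = v + (of_int \<lfloor>a\<rfloor> * \<omega>1 + of_int \<lfloor>b\<rfloor> * \<omega>2)"
      unfolding u v_def frac_def by (simp add: algebra_simps)
    moreover have "of_int \<lfloor>a\<rfloor> * \<omega>1 + of_int \<lfloor>b\<rfloor> * \<omega>2 \<in> Lat" unfolding Lat_def by blast
    ultimately have "F u = F v" using per by blast
    moreover have "norm v \<le> frac a * norm \<omega>1 + frac b * norm \<omega>2"
      unfolding v_def by (intro order.trans[OF norm_triangle_ineq]) (simp add: norm_mult)
    moreover have "\<dots> \<le> 1 * norm \<omega>1 + 1 * norm \<omega>2"
      by (intro add_mono mult_right_mono) (auto simp: frac_lt_1 less_imp_le)
    ultimately show "F u \<in> F ` cball 0 R" by (auto simp: R_def)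
  qed
  ultimately have "bounded (range F)" using bounded_subset by blast
  from Liouville_theorem[OF hol this] show ?thesis by (auto simp: constant_on_def)
qed

lemma Theta_0: "Theta 0 0 F \<Longrightarrow> \<exists>k. \<forall>u. F u = k"
  using elliptic_entire_constant[of F] unfolding Theta_def by simp

lemma ex_not_Lat: "\<exists>u. u \<notin> Lat"
proof -
  have "of_real (1/2) * \<omega>1 + of_real 0 * \<omega>2 \<notin> Lat"
    unfolding of_real_in_Lat_iff by simp
  thus ?thesis by blast
qed

lemma \<sigma>_shifted_nz: "\<exists>u. \<sigma> (u - z) \<noteq> 0"
  using ex_not_Lat by (metis \<sigma>_eq_0_iff add_diff_cancel_right')

lemma \<sigma>_cancel:
  assumes "F holomorphic_on UNIV" "G holomorphic_on UNIV" "\<And>u. \<sigma> (u - z) * F u = \<sigma> (u - z) * G u"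
  shows "F u = G u"
proof -
  obtain a where "\<sigma> (a - z) \<noteq> 0" using \<sigma>_shifted_nz by blast
  thus ?thesis
    by (rule entire_eqI_off_zeros[OF assms(1,2), of "\<lambda>u. \<sigma> (u - z)", rotated])
      (use assms(3) in \<open>auto intro!: holomorphic_intros\<close>)
qed

text \<open>The zero \<open>z\<close> spreads to all its lattice translates, which are all the zeros
  of \<open>\<sigma> (u - z)\<close>, and these are simple. The multipliers of the quotient are the
  quotients of the multipliers.\<close>

lemma Theta_divide:
  assumes F: "Theta (Suc N) s F" and z: "F z = 0"
  obtains H where "Theta N (s - z) H" "\<And>u. F u = \<sigma> (u - z) * H u"
proof -
  obtain H where H: "H holomorphic_on UNIV" "\<And>u. F u = \<sigma> (u - z) * H u"
  proof (rule entire_divide[of F "\<lambda>u. \<sigma> (u - z)"])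
    fix u assume "\<sigma> (u - z) = 0"
    moreover from this have "z - u \<in> Lat" using \<sigma>_eq_0_iff Lat_diff_commute by blast
    ultimately show "F u = 0 \<and> deriv (\<lambda>u. \<sigma> (u - z)) u \<noteq> 0"
      using Theta_zero_translate[OF F _ z] deriv_\<sigma>_nz by blast
  qed (use Theta_holomorphic[OF F] in \<open>auto intro!: holomorphic_intros\<close>)
  note \<sigma>z = Theta_\<sigma>[of z, unfolded Theta_def]
  have "Theta N (s - z) H" unfolding Theta_def
  proof (intro conjI allI)
    show "H holomorphic_on UNIV" by fact
    note Hs = holomorphic_shift[OF H(1)]
    show "H (u + \<omega>1) = H u" for u
    proof (rule \<sigma>_cancel[OF Hs H(1), of z])
      fix u
      have "F (u + \<omega>1) = F u" "\<sigma> (u + \<omega>1 - z) = \<sigma> (u - z)" using F \<sigma>z unfolding Theta_def by auto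
      thus "\<sigma> (u - z) * H (u + \<omega>1) = \<sigma> (u - z) * H u"
        using H(2)[of u] H(2)[of "u + \<omega>1"] by metis
    qed
    show "H (u + \<omega>2) = (-1) ^ N * ee (s - z - of_nat N * (u + \<omega>2)) * H u" for u
    proof (rule \<sigma>_cancel[OF Hs, of _ z])
      show "(\<lambda>u. (-1) ^ N * ee (s - z - of_nat N * (u + \<omega>2)) * H u) holomorphic_on UNIV"
        by (intro holomorphic_intros H)
      fix u
      have "F (u + \<omega>2) = (-1) ^ Suc N * ee (s - of_nat (Suc N) * (u + \<omega>2)) * F u"
        using F unfolding Theta_def by blast
      \<comment> \<open>The exponent is split into the one wanted for \<open>H\<close> and the one
        belonging to \<open>\<sigma> (u - z)\<close>.\<close>
      also have "s - of_nat (Suc N) * (u + \<omega>2) = (s - z - of_nat N * (u + \<omega>2)) + (z - (u + \<omega>2))"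
        by (simp add: algebra_simps)
      finally have e: "F (u + \<omega>2) = (-1) ^ Suc N * (ee (s - z - of_nat N * (u + \<omega>2)) * ee (z - (u + \<omega>2))) * F u"
        unfolding ee_add .
      have "\<sigma> (u + \<omega>2 - z) = - ee (z - (u + \<omega>2)) * \<sigma> (u - z)" using \<sigma>z by simp
      hence "- ee (z - (u + \<omega>2)) * (\<sigma> (u - z) * H (u + \<omega>2)) = F (u + \<omega>2)"
        using H(2)[of "u + \<omega>2"] by simp
      also have "\<dots> = - ee (z - (u + \<omega>2)) * (\<sigma> (u - z) * ((-1) ^ N * ee (s - z - of_nat N * (u + \<omega>2)) * H u))"
        unfolding e H(2)[of u] by simp
      finally have "- ee (z - (u + \<omega>2)) * (\<sigma> (u - z) * H (u + \<omega>2))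
          = - ee (z - (u + \<omega>2)) * (\<sigma> (u - z) * ((-1) ^ N * ee (s - z - of_nat N * (u + \<omega>2)) * H u))" .
      thus "\<sigma> (u - z) * H (u + \<omega>2) = \<sigma> (u - z) * ((-1) ^ N * ee (s - z - of_nat N * (u + \<omega>2)) * H u)"
        by (subst (asm) mult_cancel_left) simp
    qed
  qed
  with H(2) show ?thesis using that by blast
qed

text \<open>Subtracting a multiple of the logarithmic derivative of \<open>\<sigma>\<close> removes the only possible pole of
  \<open>F u / \<sigma> (u - s)\<close>.  The remaining entire function is additively quasi-periodic, hence affine, and its
  periods force it to be constant and the pole to be absent.\<close>

lemma Theta_1:
  assumes F: "Theta 1 s F"
  shows "\<exists>k. \<forall>u. F u = k * \<sigma> (u - s)"
proof -
  let ?S = "\<lambda>u. \<sigma> (u - s)"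
  have S: "Theta 1 s ?S" by (rule Theta_\<sigma>)
  have holS: "?S holomorphic_on UNIV" using S by (rule Theta_holomorphic)
  have S0: "\<sigma> 0 = 0" by (simp add: \<sigma>_eq_0_iff)
  \<comment> \<open>The logarithmic derivative of the multiplier \<open>m\<close> of
    \<open>?S\<close> for \<open>\<omega>2\<close>.\<close>
  define \<alpha> where "\<alpha> = - (2 * of_real pi * \<i> / \<omega>1)"
  \<comment> \<open>The residue of \<open>F / ?S\<close> at \<open>s\<close>.\<close>
  define r where "r = F s / deriv ?S s"
  have dS: "(?S has_field_derivative deriv ?S u) (at u)" for u
    using holS holomorphic_derivI by blast
  have dS1: "deriv ?S (u + \<omega>1) = deriv ?S u" for u
  proof -
    have "((\<lambda>u. ?S (u + \<omega>1)) has_field_derivative deriv ?S (u + \<omega>1)) (at u)"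
      by (rule DERIV_shift[THEN iffD1, OF dS])
    moreover have "(\<lambda>u. ?S (u + \<omega>1)) = ?S" using S unfolding Theta_def by auto
    ultimately show ?thesis using DERIV_imp_deriv by fastforce
  qed
  define m where "m = (\<lambda>u. - ee (s - (u + \<omega>2)))"
  have m_nz: "m u \<noteq> 0" for u by (simp add: m_def)
  have Sm: "?S (u + \<omega>2) = m u * ?S u" for u using S unfolding Theta_def m_def by simp
  have Fm: "F (u + \<omega>2) = m u * F u" for u using F unfolding Theta_def m_def by simp
  have dm: "(m has_field_derivative \<alpha> * m u) (at u)" for u
    unfolding m_def ee_def \<alpha>_def using \<omega>1_nz by (auto intro!: derivative_eq_intros)
  have dS2: "deriv ?S (u + \<omega>2) = m u * deriv ?S u + \<alpha> * m u * ?S u" for u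
  proof -
    have "((\<lambda>u. ?S (u + \<omega>2)) has_field_derivative deriv ?S (u + \<omega>2)) (at u)"
      by (rule DERIV_shift[THEN iffD1, OF dS])
    moreover have "((\<lambda>u. m u * ?S u) has_field_derivative m u * deriv ?S u + \<alpha> * m u * ?S u) (at u)"
      by (rule DERIV_cong[OF DERIV_mult[OF dm dS]]) simp
    ultimately show ?thesis unfolding Sm using DERIV_unique by blast
  qed
  define N where "N = (\<lambda>u. F u - r * deriv ?S u)"
  have holN: "N holomorphic_on UNIV" unfolding N_def
    by (intro holomorphic_intros holomorphic_deriv holS Theta_holomorphic[OF F]) auto
  obtain H where H: "H holomorphic_on UNIV" "\<And>u. N u = ?S u * H u"
  proof (rule entire_divide[OF holN holS])
    \<comment> \<open>The choice of \<open>r\<close> makes \<open>N\<close> vanish at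
      \<open>s\<close>. Translation to any other zero multiplies \<open>F\<close> and
      \<open>deriv ?S\<close> by the same factor, so the same \<open>r\<close> works there.\<close>
    fix u assume u: "?S u = 0"
    hence "u - s \<in> Lat" by (simp add: \<sigma>_eq_0_iff)
    from Theta_translate[OF this, of 1 s] obtain c d where cd:
      "\<And>F v. Theta 1 s F \<Longrightarrow> F (v + (u - s)) = c * exp (d * v) * F v" by metis
    have 1: "F u = c * exp (d * s) * F s" using cd[OF F, of s] by simp
    have "((\<lambda>v. ?S (v + (u - s))) has_field_derivative deriv ?S (s + (u - s))) (at s)"
      by (rule DERIV_shift[THEN iffD1, OF dS])
    moreover have "((\<lambda>v. c * exp (d * v) * ?S v) has_field_derivative c * exp (d * s) * deriv ?S s) (at s)"
      by (rule DERIV_cong, (rule derivative_intros refl dS)+) (simp add: S0)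
    moreover have "?S (v + (u - s)) = c * exp (d * v) * ?S v" for v using cd[OF S, of v] .
    hence "(\<lambda>v. ?S (v + (u - s))) = (\<lambda>v. c * exp (d * v) * ?S v)" by (rule ext)
    ultimately have "deriv ?S u = c * exp (d * s) * deriv ?S s"
      using DERIV_unique by (metis add_diff_cancel_left' diff_add_cancel)
    with 1 show "N u = 0 \<and> deriv ?S u \<noteq> 0"
      using deriv_\<sigma>_nz[OF u] deriv_\<sigma>_nz[of s s] S0 by (simp add: N_def r_def)
  qed blast
  note Hs = holomorphic_shift[OF H(1)]
  have H1: "H (u + \<omega>1) = H u" for u
  proof (rule \<sigma>_cancel[OF Hs H(1), of s])
    fix u
    have "?S (u + \<omega>1) = ?S u" "F (u + \<omega>1) = F u" using S F unfolding Theta_def by auto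
    thus "?S u * H (u + \<omega>1) = ?S u * H u"
      using H(2)[of u] H(2)[of "u + \<omega>1"] dS1[of u] by (auto simp: N_def)
  qed
  \<comment> \<open>\<open>H\<close> is F/S - r S'/S, and S'/S grows by \<open>\<alpha>\<close>
    under translation by \<open>\<omega>2\<close>.\<close>
  have H2: "H (u + \<omega>2) = H u - r * \<alpha>" for u
  proof (rule \<sigma>_cancel[OF Hs, of _ s])
    show "(\<lambda>u. H u - r * \<alpha>) holomorphic_on UNIV" by (intro holomorphic_intros H)
    fix u
    have "m u * (?S u * H (u + \<omega>2)) = N (u + \<omega>2)" using H(2)[of "u + \<omega>2"] Sm[of u] by simp
    also have "\<dots> = m u * (N u - r * \<alpha> * ?S u)"
      unfolding N_def Fm dS2 by (simp add: algebra_simps)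
    also have "\<dots> = m u * (?S u * (H u - r * \<alpha>))" unfolding H(2) by (simp add: algebra_simps)
    finally show "?S u * H (u + \<omega>2) = ?S u * (H u - r * \<alpha>)"
      using m_nz by (subst (asm) mult_cancel_left) simp
  qed
  have dH: "(H has_field_derivative deriv H u) (at u)" for u
    using H(1) holomorphic_derivI by blast
  \<comment> \<open>Differentiation removes the additive constant, so \<open>deriv H\<close> is
    elliptic and entire, hence constant.\<close>
  have per: "deriv H (u + \<omega>) = deriv H u" if "\<And>u. H (u + \<omega>) = H u - c" for u \<omega> c
  proof -
    have "((\<lambda>u. H (u + \<omega>)) has_field_derivative deriv H (u + \<omega>)) (at u)"
      by (rule DERIV_shift[THEN iffD1, OF dH])
    moreover have "((\<lambda>u. H u - c) has_field_derivative deriv H u - 0) (at u)"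
      by (intro derivative_intros dH)
    ultimately show ?thesis unfolding that using DERIV_unique by fastforce
  qed
  obtain k where k: "\<And>u. deriv H u = k"
    using elliptic_entire_constant[of "deriv H"] per[OF H2] per[of \<omega>1 0] H1 holomorphic_deriv[OF H(1)] by auto
  have "\<exists>b. \<forall>u\<in>UNIV. H u - k * u = b"
  proof (rule has_field_derivative_zero_constant)
    fix u
    have "((\<lambda>u. H u - k * u) has_field_derivative k - k) (at u)"
      using dH[of u] unfolding k by (auto intro!: derivative_eq_intros)
    thus "((\<lambda>u. H u - k * u) has_field_derivative 0) (at u within UNIV)" by simp
  qed simp
  then obtain b where b: "\<And>u. H u = k * u + b" by (metis UNIV_I diff_add_cancel add.commute)
  \<comment> \<open>The period \<open>\<omega>1\<close> kills the slope of the affine function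
    \<open>H\<close>; then its increment - r \<alpha> over \<open>\<omega>2\<close> must
    vanish.\<close>
  have "k = 0" using H1[of 0] b[of 0] b[of "\<omega>1"] \<omega>1_nz by simp
  hence "r * \<alpha> = 0" using H2[of 0] b by simp
  hence "r = 0" using \<omega>1_nz by (simp add: \<alpha>_def)
  hence "F u = b * ?S u" for u using H(2)[of u] b[of u] \<open>k = 0\<close> by (simp add: N_def)
  thus ?thesis by blast
qed

text \<open>Inequivalence ensures that after division by \<open>\<sigma> (u - z a)\<close> the other
  points are still zeros. When all have been divided out, \<open>Theta_1\<close> applies and places
  the last zero at \<open>s\<close> minus the sum of the given ones.\<close>

lemma Theta_factor:
  assumes "finite I" "Theta (Suc (card I)) s F" "\<And>i. i \<in> I \<Longrightarrow> F (z i) = 0"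
    and "\<And>i j. i \<in> I \<Longrightarrow> j \<in> I \<Longrightarrow> i \<noteq> j \<Longrightarrow> z i - z j \<notin> Lat"
  shows "\<exists>k. \<forall>u. F u = k * \<sigma> (u - (s - (\<Sum>i\<in>I. z i))) * (\<Prod>i\<in>I. \<sigma> (u - z i))"
  using assms
proof (induction I arbitrary: F s rule: finite_induct)
  case empty
  thus ?case using Theta_1 by simp
next
  case (insert a I)
  from insert.prems(1) insert.hyps have "Theta (Suc (Suc (card I))) s F" by simp
  then obtain H where H: "Theta (Suc (card I)) (s - z a) H" "\<And>u. F u = \<sigma> (u - z a) * H u"
    using insert.prems(2)[of a] Theta_divide by blast
  have "H (z i) = 0" if "i \<in> I" for i
  proof -
    have "i \<noteq> a" using that insert.hyps by auto
    hence "z i - z a \<notin> Lat" using insert.prems(3)[of i a] that by auto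
    thus ?thesis using H(2)[of "z i"] insert.prems(2)[of i] that by (auto simp: \<sigma>_eq_0_iff)
  qed
  then obtain k where "\<And>u. H u = k * \<sigma> (u - (s - z a - (\<Sum>i\<in>I. z i))) * (\<Prod>i\<in>I. \<sigma> (u - z i))"
    using insert.IH[OF H(1)] insert.prems(3) by blast
  thus ?case using H(2) insert.hyps by (intro exI[of _ k]) (simp add: algebra_simps)
qed

end

section \<open>Elliptic functions with two simple poles\<close>

lemma elem_sym_0 [simp]: "elem_sym 0 N x = 1"
proof -
  have "{I. I \<subseteq> {1..N} \<and> card I = 0} = {{}}" using finite_subset[of _ "{1..N}"] by auto
  thus ?thesis by (simp add: elem_sym_def)
qed

lemma elem_sym_cong: "(\<And>i. i \<in> {1..N} \<Longrightarrow> x i = y i) \<Longrightarrow> elem_sym r N x = elem_sym r N y"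
  unfolding elem_sym_def by (intro sum.cong prod.cong) auto

text \<open>The subsets are split by whether they contain \<open>Suc N\<close>. Linearity in the
  last variable is what allows solving for the last value of \<open>f\<close>.\<close>

lemma elem_sym_Suc:
  "elem_sym (Suc r) (Suc N) x = elem_sym (Suc r) N x + x (Suc N) * elem_sym r N x"
proof -
  let ?A = "{I. I \<subseteq> {1..N} \<and> card I = Suc r}" and ?B = "{I. I \<subseteq> {1..N} \<and> card I = r}"
  have fin: "finite ?A" "finite ?B" by (auto intro: finite_subset[of _ "Pow {1..N}"])
  have B: "finite I \<and> Suc N \<notin> I" if "I \<in> ?B" for I
    using that finite_subset[of I "{1..N}"] by auto
  have eq: "{I. I \<subseteq> {1..Suc N} \<and> card I = Suc r} = ?A \<union> insert (Suc N) ` ?B" (is "?C = _")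
  proof (intro equalityI subsetI)
    fix I assume I: "I \<in> ?C"
    show "I \<in> ?A \<union> insert (Suc N) ` ?B"
    proof (cases "Suc N \<in> I")
      case True
      have "finite I" using I finite_subset[of I "{1..Suc N}"] by auto
      hence "card (I - {Suc N}) = r" using I True by simp
      hence "I - {Suc N} \<in> ?B" using I by auto
      moreover have "I = insert (Suc N) (I - {Suc N})" using True by auto
      ultimately show ?thesis by blast
    next
      case False
      hence "I \<subseteq> {1..N}" using I by (auto simp: atLeastAtMostSuc_conv)
      thus ?thesis using I by auto
    qed
  next
    fix I assume "I \<in> ?A \<union> insert (Suc N) ` ?B"
    thus "I \<in> ?C"
    proof
      assume "I \<in> ?A"
      thus ?thesis by (auto simp: atLeastAtMostSuc_conv)
    next
      assume "I \<in> insert (Suc N) ` ?B"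
      then obtain J where J: "J \<in> ?B" "I = insert (Suc N) J" by blast
      have "card I = Suc r" using B[OF J(1)] J by simp
      moreover have "I \<subseteq> {1..Suc N}" using J by (auto simp: atLeastAtMostSuc_conv)
      ultimately show ?thesis by blast
    qed
  qed
  have inj: "inj_on (insert (Suc N)) ?B"
  proof (rule inj_onI)
    fix I J assume "I \<in> ?B" "J \<in> ?B" "insert (Suc N) I = insert (Suc N) J"
    thus "I = J" using B[of I] B[of J] insert_ident[of "Suc N" I J] by blast
  qed
  have "elem_sym (Suc r) (Suc N) x = (\<Sum>I\<in>?A. \<Prod>i\<in>I. x i) + (\<Sum>I\<in>insert (Suc N) ` ?B. \<Prod>i\<in>I. x i)"
    unfolding elem_sym_def eq by (rule sum.union_disjoint) (use fin in auto)
  also have "(\<Sum>I\<in>insert (Suc N) ` ?B. \<Prod>i\<in>I. x i) = (\<Sum>I\<in>?B. x (Suc N) * (\<Prod>i\<in>I. x i))"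
    unfolding sum.reindex[OF inj] o_def
  proof (rule sum.cong[OF refl])
    fix I assume "I \<in> ?B"
    from B[OF this] show "(\<Prod>i\<in>insert (Suc N) I. x i) = x (Suc N) * (\<Prod>i\<in>I. x i)" by simp
  qed
  finally show ?thesis by (simp add: elem_sym_def sum_distrib_left)
qed

text \<open>Vieta's formula: the product is expanded over subsets, which are then grouped by
  cardinality.\<close>

lemma prod_diff_elem_sym:
  "(\<Prod>i=1..N. x - y i) = (\<Sum>j=0..N. (-1) ^ j * elem_sym j N y * x ^ (N - j))"
proof -
  have "(\<Prod>i=1..N. x - y i) = (\<Sum>I\<in>Pow {1..N}. (\<Prod>i\<in>I. - y i) * (\<Prod>i\<in>{1..N} - I. x))"
    using prod_add[of "{1..N}" "\<lambda>i. - y i" "\<lambda>_. x"] by simp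
  also have "\<dots> = (\<Sum>I\<in>Pow {1..N}. (-1) ^ card I * (\<Prod>i\<in>I. y i) * x ^ (N - card I))"
  proof (rule sum.cong[OF refl])
    fix I assume "I \<in> Pow {1..N}"
    hence "finite I" "I \<subseteq> {1..N}" using finite_subset by auto
    thus "(\<Prod>i\<in>I. - y i) * (\<Prod>i\<in>{1..N} - I. x) = (-1) ^ card I * (\<Prod>i\<in>I. y i) * x ^ (N - card I)"
      by (simp add: prod_uminus card_Diff_subset)
  qed
  also have "\<dots> = (\<Sum>j=0..N. \<Sum>I\<in>{I \<in> Pow {1..N}. card I = j}. (-1) ^ card I * (\<Prod>i\<in>I. y i) * x ^ (N - card I))"
    by (rule sum.group[symmetric]) (use card_mono[of "{1..N}"] in auto)
  also have "\<dots> = (\<Sum>j=0..N. (-1) ^ j * elem_sym j N y * x ^ (N - j))"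
    unfolding elem_sym_def sum_distrib_left sum_distrib_right
    by (intro sum.cong refl) auto
  finally show ?thesis .
qed

lemma eventually_entire_nz:
  fixes F :: "complex \<Rightarrow> complex"
  assumes "F holomorphic_on UNIV" "F a \<noteq> 0"
  shows "eventually (\<lambda>w. F w \<noteq> 0) (at z)"
  using non_zero_neighbour_alt[OF assms(1), of z a] assms(2) connected_UNIV by simp

lemma higher_deriv_periodic:
  assumes "\<And>u. f (u + w) = f u" shows "(deriv ^^ j) f (u + w) = (deriv ^^ j) f u"
proof -
  have "f \<circ> (\<lambda>x. u + w + x) = f \<circ> (\<lambda>x. u + x)"
    using assms[of "u + _"] by (auto simp: fun_eq_iff add_ac)
  thus ?thesis using higher_deriv_shift_0[of j f "u + w"] higher_deriv_shift_0[of j f u] by simp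
qed

text \<open>Difference of squares: the signs (-1)^j flip exactly the odd derivatives. By
  \<open>lincomb_reflect\<close> the second factor is the first one at the reflected point.\<close>

lemma phi_eq_lincomb:
  "phi f n l k u = (-1 + lincomb f n l k u) * (-1 + lincomb f n l (\<lambda>j. (-1) ^ j * k j) u)"
proof -
  define e where "e = (\<Sum>j | j \<in> {1..n-1} \<and> even j. k j * (deriv ^^ j) f u)"
  define d where "d = (\<Sum>j | j \<in> {1..n-1} \<and> odd j. k j * (deriv ^^ j) f u)"
  define p where "p = -1 + (\<Sum>j=1..n. l j * f u ^ j)"
  have split: "(\<Sum>j=1..n-1. h j) = (\<Sum>j | j \<in> {1..n-1} \<and> even j. h j) + (\<Sum>j | j \<in> {1..n-1} \<and> odd j. h j)"
    for h :: "nat \<Rightarrow> complex"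
    by (subst sum.union_disjoint[symmetric]) (auto intro!: sum.cong)
  have "-1 + lincomb f n l k u = p + e + d"
    unfolding lincomb_def split p_def e_def d_def by simp
  moreover have "-1 + lincomb f n l (\<lambda>j. (-1) ^ j * k j) u = p + e - d"
    unfolding lincomb_def split p_def e_def d_def by (simp add: sum_negf)
  moreover have "phi f n l k u = (p + e)\<^sup>2 - d\<^sup>2"
    by (simp add: phi_def p_def e_def d_def)
  ultimately show ?thesis by (simp only:) (simp add: power2_eq_square algebra_simps)
qed

section \<open>Reflection, numerators and symmetric functions\<close>

text \<open>\<open>ex_X\<close> encodes that the poles are simple. It speaks only of points off the
  poles, since the value of \<open>f\<close> at a pole is a convention.\<close>

locale elliptic_order2 = lattice2 +
  fixes f :: "complex \<Rightarrow> complex" and p1 p2 :: complex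
  assumes p12: "p1 - p2 \<notin> Lat"
    and per1: "f (u + \<omega>1) = f u" and per2: "f (u + \<omega>2) = f u"
    and ex_X: "\<exists>X. X holomorphic_on UNIV \<and> (\<forall>u. \<sigma> (u - p1) * \<sigma> (u - p2) \<noteq> 0 \<longrightarrow>
                  f u = X u / (\<sigma> (u - p1) * \<sigma> (u - p2)))"
    and pole_iff: "is_pole f u \<longleftrightarrow> u - p1 \<in> Lat \<or> u - p2 \<in> Lat"
begin

definition S :: complex where "S = p1 + p2"

definition M :: "complex \<Rightarrow> complex" where "M u = \<sigma> (u - p1) * \<sigma> (u - p2)"

definition X :: "complex \<Rightarrow> complex" where
  "X = (SOME X. X holomorphic_on UNIV \<and> (\<forall>u. M u \<noteq> 0 \<longrightarrow> f u = X u / M u))"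

lemma M_eq_0_iff: "M u = 0 \<longleftrightarrow> is_pole f u"
  by (simp add: M_def \<sigma>_eq_0_iff pole_iff)

lemma p21: "p2 - p1 \<notin> Lat" using p12 Lat_diff_commute by blast

lemma M_p [simp]: "M p1 = 0" "M p2 = 0"
  by (simp_all add: M_def \<sigma>_eq_0_iff)

lemma Theta_M: "Theta 2 S M"
  using Theta_mult[OF Theta_\<sigma>[of p1] Theta_\<sigma>[of p2]] by (simp add: M_def[abs_def] S_def numeral_2_eq_2)

lemma M_holomorphic: "M holomorphic_on A" using Theta_M by (rule Theta_holomorphic)

lemma ex_M_nz: obtains a where "M a \<noteq> 0"
proof -
  obtain a where "\<sigma> (a - p1) \<noteq> 0" using \<sigma>_shifted_nz by blast
  hence "eventually (\<lambda>u. \<sigma> (u - p1) \<noteq> 0) (at 0)"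
    by (rule eventually_entire_nz[rotated]) (auto intro!: holomorphic_intros)
  moreover obtain b where "\<sigma> (b - p2) \<noteq> 0" using \<sigma>_shifted_nz by blast
  hence "eventually (\<lambda>u. \<sigma> (u - p2) \<noteq> 0) (at 0)"
    by (rule eventually_entire_nz[rotated]) (auto intro!: holomorphic_intros)
  ultimately have "eventually (\<lambda>u. M u \<noteq> 0) (at 0)" by eventually_elim (simp add: M_def)
  from eventually_happens'[OF at_neq_bot this] show ?thesis using that by blast
qed

lemma eventually_M_nz: "eventually (\<lambda>u. M u \<noteq> 0) (at z)"
  using ex_M_nz eventually_entire_nz[OF M_holomorphic] by metis

lemma eqI_off_poles:
  assumes "F holomorphic_on UNIV" "G holomorphic_on UNIV" "\<And>u. M u \<noteq> 0 \<Longrightarrow> F u = G u"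
  shows "F u = G u"
  using ex_M_nz entire_eqI_off_zeros[OF assms(1,2) M_holomorphic] assms(3) by metis

lemma X: "X holomorphic_on UNIV" "M u \<noteq> 0 \<Longrightarrow> f u = X u / M u"
proof -
  have "X holomorphic_on UNIV \<and> (\<forall>u. M u \<noteq> 0 \<longrightarrow> f u = X u / M u)"
    using ex_X unfolding M_def[symmetric] X_def by (rule someI_ex)
  thus "X holomorphic_on UNIV" "M u \<noteq> 0 \<Longrightarrow> f u = X u / M u" by auto
qed

lemma M_shift:
  "M (u + \<omega>1) = M u" "M (u + \<omega>2) = ee (S - 2 * (u + \<omega>2)) * M u"
  using Theta_M by (auto simp: Theta_def)

lemma \<sigma>_0 [simp]: "\<sigma> 0 = 0" by (simp add: \<sigma>_eq_0_iff)

text \<open>S - u - p1 = -(u - p2), so the reflection swaps the two factors, and the two minus signs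
  of \<open>\<sigma>_minus\<close> cancel.\<close>

lemma M_reflect: "M (S - u) = ee (u - p1) * ee (u - p2) * M u"
  using \<sigma>_minus[of "u - p1"] \<sigma>_minus[of "u - p2"] by (simp add: M_def S_def)

text \<open>An elliptic \<open>h\<close> does not affect the multipliers of M^m, and as
  \<open>F\<close> is entire they need checking only off the poles.\<close>

lemma Theta_elliptic:
  assumes F: "F holomorphic_on UNIV" and Fh: "\<And>u. M u \<noteq> 0 \<Longrightarrow> F u = h u * M u ^ m"
    and h1: "\<And>u. M u \<noteq> 0 \<Longrightarrow> h (u + \<omega>1) = h u" and h2: "\<And>u. M u \<noteq> 0 \<Longrightarrow> h (u + \<omega>2) = h u"
  shows "Theta (2 * m) (of_nat m * S) F"
  unfolding Theta_def
proof (intro conjI allI)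
  show "F (u + \<omega>1) = F u" for u
    by (rule eqI_off_poles[OF holomorphic_shift[OF F] F]) (simp add: Fh h1 M_shift)
  have "F (u + \<omega>2) = ee (of_nat m * (S - 2 * (u + \<omega>2))) * F u" for u
    by (rule eqI_off_poles[OF holomorphic_shift[OF F]])
      (auto simp: Fh h2 M_shift ee_mult_of_nat power_mult_distrib intro!: holomorphic_intros F)
  moreover have "of_nat m * (S - 2 * (u + \<omega>2)) = of_nat m * S - of_nat (2 * m) * (u + \<omega>2)" for u
    by (simp add: algebra_simps)
  ultimately show "F (u + \<omega>2) = (- 1) ^ (2 * m) * ee (of_nat m * S - of_nat (2 * m) * (u + \<omega>2)) * F u" for u
    by simp
qed fact

lemma Theta_X: "Theta 2 S X"
  using Theta_elliptic[of X f 1] X per1 per2 by simp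

lemma filterlim_p1: "filterlim f at_infinity (at p1)"
  using pole_iff[of p1] by (simp add: is_pole_def)

lemma f_nonconst: obtains u where "M u \<noteq> 0" "f u \<noteq> k"
proof -
  have "eventually (\<lambda>u. f u \<noteq> k) (at p1)"
    using filterlim_p1 by (rule filterlim_at_infinity_imp_eventually_ne)
  with eventually_M_nz[of p1] have "eventually (\<lambda>u. M u \<noteq> 0 \<and> f u \<noteq> k) (at p1)" by eventually_elim auto
  from eventually_happens'[OF at_neq_bot this] show ?thesis using that by blast
qed

text \<open>A finite set of values would be bounded, contrary to the pole at \<open>p1\<close>.
  Serves to identify coefficients of polynomials in \<open>f\<close>.\<close>

lemma infinite_range: "infinite (f ` {u. M u \<noteq> 0})"
proof
  assume "finite (f ` {u. M u \<noteq> 0})"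
  hence "bounded (f ` {u. M u \<noteq> 0})" by (rule finite_imp_bounded)
  then obtain B where B: "\<And>u. M u \<noteq> 0 \<Longrightarrow> norm (f u) \<le> B"
    unfolding bounded_iff by blast
  have "eventually (\<lambda>u. norm (f u) > B) (at p1)"
    using filterlim_at_infinity_imp_norm_at_top[OF filterlim_p1]
    unfolding filterlim_at_top_dense by simp
  with eventually_M_nz[of p1] have "eventually (\<lambda>u. False) (at p1)"
    by eventually_elim (use B in force)
  thus False by simp
qed

text \<open>The left side has the multipliers of \<open>M\<close>, so the zero at \<open>z\<close>
  forces the other one to \<open>S - z\<close>. The constant is nonzero because \<open>f\<close> is
  not constant.\<close>

lemma f_factor:
  assumes "M z \<noteq> 0"
  obtains k where "k \<noteq> 0" "\<And>u. X u - f z * M u = k * (\<sigma> (u - z) * \<sigma> (u - (S - z)))"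
proof -
  have "\<exists>k. \<forall>u. X u - f z * M u = k * \<sigma> (u - (S - (\<Sum>i\<in>{0::nat}. z))) * (\<Prod>i\<in>{0::nat}. \<sigma> (u - z))"
  proof (rule Theta_factor)
    show "Theta (Suc (card {0::nat})) S (\<lambda>u. X u - f z * M u)"
      using Theta_diff[OF Theta_X Theta_cmult[OF Theta_M]] by (simp add: numeral_2_eq_2)
    show "X z - f z * M z = 0" using X(2)[OF assms] assms by simp
  qed auto
  then obtain k where k: "\<And>u. X u - f z * M u = k * (\<sigma> (u - z) * \<sigma> (u - (S - z)))"
    by (auto simp: mult_ac)
  moreover have "k \<noteq> 0"
  proof
    assume "k = 0"
    obtain u where "M u \<noteq> 0" "f u \<noteq> f z" using f_nonconst .
    with k[of u] X(2)[of u] \<open>k = 0\<close> show False by simp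
  qed
  ultimately show ?thesis using that by blast
qed

lemma f_reflect:
  assumes "M u \<noteq> 0" shows "f (S - u) = f u"
proof -
  obtain k where "\<And>v. X v - f u * M v = k * (\<sigma> (v - u) * \<sigma> (v - (S - u)))"
    using f_factor[OF assms] by metis
  from this[of "S - u"] have "X (S - u) = f u * M (S - u)" by simp
  moreover have "M (S - u) \<noteq> 0" using assms by (simp add: M_reflect)
  ultimately show ?thesis by (simp add: X(2))
qed

text \<open>A zero at \<open>p1\<close> would force the other zero to \<open>p2\<close>, making
  \<open>X\<close> a multiple of \<open>M\<close> and \<open>f\<close> constant.\<close>

lemma X_p1: "X p1 \<noteq> 0"
proof
  assume 0: "X p1 = 0"
  have "\<exists>k. \<forall>u. X u = k * \<sigma> (u - (S - (\<Sum>i\<in>{0::nat}. p1))) * (\<Prod>i\<in>{0::nat}. \<sigma> (u - p1))"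
    by (rule Theta_factor) (use Theta_X 0 in \<open>auto simp: numeral_2_eq_2\<close>)
  then obtain k where k: "\<And>u. X u = k * M u" by (auto simp: S_def M_def mult_ac)
  obtain u where "M u \<noteq> 0" "f u \<noteq> k" using f_nonconst .
  thus False using X(2)[of u] k[of u] by simp
qed

text \<open>Induction on the bound \<open>m\<close> for the pole order. Subtracting a multiple of
  the top power of \<open>f\<close> removes the leading term at \<open>p1\<close>; the reflection
  exchanges \<open>p1\<close> and \<open>p2\<close>, so it goes at \<open>p2\<close> as well, and
  one factor \<open>M\<close> can be cancelled. For m = 0 the function is entire and
  elliptic.\<close>

lemma symmetric_imp_polynomial:
  assumes "F holomorphic_on UNIV" "\<And>u. M u \<noteq> 0 \<Longrightarrow> F u = h u * M u ^ m"
    and "\<And>u. M u \<noteq> 0 \<Longrightarrow> h (u + \<omega>1) = h u" "\<And>u. M u \<noteq> 0 \<Longrightarrow> h (u + \<omega>2) = h u"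
    and "\<And>u. M u \<noteq> 0 \<Longrightarrow> h (S - u) = h u"
  shows "\<exists>c. \<forall>u. M u \<noteq> 0 \<longrightarrow> h u = (\<Sum>j=0..m. c j * f u ^ j)"
  using assms
proof (induction m arbitrary: F h)
  case 0
  have "Theta 0 0 F" using Theta_elliptic[OF "0.prems"(1-4)] by simp
  then obtain k where "\<And>u. F u = k" using Theta_0 by blast
  thus ?case using "0.prems"(2) by (intro exI[of _ "\<lambda>_. k"]) auto
next
  case (Suc m)
  \<comment> \<open>The quotient of the leading coefficients of \<open>h\<close> and of f^(m+1) at
    \<open>p1\<close>.\<close>
  define a where "a = F p1 / X p1 ^ Suc m"
  define F1 where "F1 = (\<lambda>u. F u - a * X u ^ Suc m)"
  define h1 where "h1 = (\<lambda>u. h u - a * f u ^ Suc m)"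
  have F1: "F1 holomorphic_on UNIV" unfolding F1_def by (intro holomorphic_intros Suc.prems X)
  have F1h1: "F1 u = h1 u * M u ^ Suc m" if "M u \<noteq> 0" for u
  proof -
    have "X u = f u * M u" using X(2)[OF that] that by simp
    thus ?thesis using Suc.prems(2)[OF that]
      by (simp add: F1_def h1_def power_mult_distrib algebra_simps del: power_Suc)
  qed
  have h1_per: "h1 (u + \<omega>1) = h1 u" "h1 (u + \<omega>2) = h1 u" if "M u \<noteq> 0" for u
    using Suc.prems(3,4)[OF that] per1[of u] per2[of u] by (auto simp: h1_def)
  have h1_sym: "h1 (S - u) = h1 u" if "M u \<noteq> 0" for u
    using Suc.prems(5)[OF that] f_reflect[OF that] by (simp add: h1_def)
  \<comment> \<open>Stated for the entire numerator, the symmetry may be evaluated at the pole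
    \<open>p1\<close>, where \<open>S - p1\<close> is \<open>p2\<close>.\<close>
  have F1_refl: "F1 (S - u) = (ee (u - p1) * ee (u - p2)) ^ Suc m * F1 u" for u
  proof (rule eqI_off_poles[of "\<lambda>u. F1 (S - u)" "\<lambda>u. (ee (u - p1) * ee (u - p2)) ^ Suc m * F1 u"])
    show "(\<lambda>u. F1 (S - u)) holomorphic_on UNIV"
      by (rule holomorphic_on_compose_gen[of "\<lambda>u. S - u" UNIV F1 UNIV, unfolded o_def])
        (use F1 in \<open>auto intro!: holomorphic_intros\<close>)
    show "(\<lambda>u. (ee (u - p1) * ee (u - p2)) ^ Suc m * F1 u) holomorphic_on UNIV"
      by (intro holomorphic_intros F1)
    fix u assume u: "M u \<noteq> 0"
    hence "M (S - u) \<noteq> 0" by (simp add: M_reflect)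
    hence "F1 (S - u) = h1 (S - u) * M (S - u) ^ Suc m" by (rule F1h1)
    thus "F1 (S - u) = (ee (u - p1) * ee (u - p2)) ^ Suc m * F1 u"
      unfolding M_reflect h1_sym[OF u] F1h1[OF u] power_mult_distrib by (simp only: mult_ac)
  qed
  have F1_p1: "F1 p1 = 0" using X_p1 by (simp add: F1_def a_def del: power_Suc)
  hence F1_p2: "F1 p2 = 0" using F1_refl[of p1] by (simp add: S_def)
  have "Theta (2 * Suc m) (of_nat (Suc m) * S) F1" by (rule Theta_elliptic[OF F1 F1h1 h1_per])
  then obtain H where H: "Theta (Suc (2 * m)) (of_nat (Suc m) * S - p1) H" "\<And>u. F1 u = \<sigma> (u - p1) * H u"
    using Theta_divide[of "Suc (2 * m)" _ F1 p1] F1_p1 by auto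
  have "H p2 = 0" using H(2)[of p2] F1_p2 p21 by (simp add: \<sigma>_eq_0_iff)
  then obtain F2 where F2: "Theta (2 * m) (of_nat (Suc m) * S - p1 - p2) F2" "\<And>u. H u = \<sigma> (u - p2) * F2 u"
    using Theta_divide[OF H(1), of p2] by auto
  have F2h1: "F2 u = h1 u * M u ^ m" if u: "M u \<noteq> 0" for u
  proof -
    have "M u * F2 u = M u * (h1 u * M u ^ m)"
      using F1h1[OF u] unfolding H(2) F2(2) by (simp add: M_def mult_ac)
    thus ?thesis using u by simp
  qed
  have "\<exists>c. \<forall>u. M u \<noteq> 0 \<longrightarrow> h1 u = (\<Sum>j=0..m. c j * f u ^ j)"
    by (rule Suc.IH[of F2 h1, OF Theta_holomorphic[OF F2(1)]]) (simp_all add: F2h1 h1_per h1_sym)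
  then obtain c where c: "\<And>u. M u \<noteq> 0 \<Longrightarrow> h1 u = (\<Sum>j=0..m. c j * f u ^ j)" by blast
  have "h u = (\<Sum>j=0..Suc m. (c(Suc m := a)) j * f u ^ j)" if "M u \<noteq> 0" for u
    using c[OF that] by (simp add: h1_def algebra_simps)
  thus ?case by blast
qed

section \<open>Derivatives, the linear combination and the factorization of phi\<close>

text \<open>Numerators of the derivatives over M^(j+1), given by the quotient rule. They bound the
  pole order of the j-th derivative by j + 1.\<close>

fun Xd :: "nat \<Rightarrow> complex \<Rightarrow> complex" where
  "Xd 0 = X"
| "Xd (Suc j) = (\<lambda>u. deriv (Xd j) u * M u - of_nat (Suc j) * Xd j u * deriv M u)"

lemma Xd_holomorphic: "Xd j holomorphic_on UNIV"
proof (induction j)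
  case 0
  thus ?case using X(1) by simp
next
  case (Suc j)
  thus ?case by (auto intro!: holomorphic_intros holomorphic_deriv M_holomorphic)
qed

lemma open_M_nz: "open {u. M u \<noteq> 0}"
proof -
  have "open (M -` (- {0}))"
    using M_holomorphic holomorphic_on_imp_continuous_on continuous_on_open_vimage[of UNIV M] by auto
  thus ?thesis by (simp add: vimage_def)
qed

lemma higher_deriv_f: "M u \<noteq> 0 \<Longrightarrow> (deriv ^^ j) f u = Xd j u / M u ^ Suc j"
proof (induction j arbitrary: u)
  case 0
  thus ?case using X(2) by simp
next
  case (Suc j)
  have dX: "(Xd j has_field_derivative deriv (Xd j) u) (at u)"
    using Xd_holomorphic holomorphic_derivI by blast
  have dM: "(M has_field_derivative deriv M u) (at u)"
    using M_holomorphic[of UNIV] holomorphic_derivI by blast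
  have "((\<lambda>u. Xd j u / M u ^ Suc j) has_field_derivative
      (deriv (Xd j) u * M u ^ Suc j - Xd j u * (of_nat (Suc j) * (M u ^ j * deriv M u))) / (M u ^ Suc j * M u ^ Suc j)) (at u)"
    using DERIV_divide[OF dX DERIV_power[OF dM, of "Suc j"]] Suc.prems by (simp add: mult_ac)
  moreover have "(deriv (Xd j) u * M u ^ Suc j - Xd j u * (of_nat (Suc j) * (M u ^ j * deriv M u))) / (M u ^ Suc j * M u ^ Suc j)
      = Xd (Suc j) u / M u ^ Suc (Suc j)"
    using Suc.prems by (simp add: field_simps)
  ultimately have "((\<lambda>u. Xd j u / M u ^ Suc j) has_field_derivative Xd (Suc j) u / M u ^ Suc (Suc j)) (at u)" by metis
  hence "((deriv ^^ j) f has_field_derivative Xd (Suc j) u / M u ^ Suc (Suc j)) (at u)"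
    by (rule has_field_derivative_transform_within_open[OF _ open_M_nz]) (use Suc in auto)
  thus ?case by (simp add: DERIV_imp_deriv)
qed

lemma higher_deriv_f_has_deriv:
  assumes "M u \<noteq> 0" shows "((deriv ^^ j) f has_field_derivative (deriv ^^ Suc j) f u) (at u)"
proof -
  have "(\<lambda>u. Xd j u / M u ^ Suc j) holomorphic_on {u. M u \<noteq> 0}"
    by (intro holomorphic_intros M_holomorphic holomorphic_on_subset[OF Xd_holomorphic]) auto
  hence "(deriv ^^ j) f holomorphic_on {u. M u \<noteq> 0}"
    by (rule holomorphic_transform) (simp add: higher_deriv_f)
  thus ?thesis using open_M_nz assms holomorphic_derivI by fastforce
qed

lemma higher_deriv_reflect:
  "M u \<noteq> 0 \<Longrightarrow> (deriv ^^ j) f (S - u) = (-1) ^ j * (deriv ^^ j) f u"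
proof (induction j arbitrary: u)
  case 0
  thus ?case using f_reflect by simp
next
  case (Suc j)
  hence "M (S - u) \<noteq> 0" by (simp add: M_reflect)
  from higher_deriv_f_has_deriv[OF this]
  have "((\<lambda>u. (deriv ^^ j) f (S - u)) has_field_derivative (deriv ^^ Suc j) f (S - u) * (- 1)) (at u)"
    by (rule DERIV_chain2) (auto intro!: derivative_eq_intros)
  moreover have "((\<lambda>u. (-1) ^ j * (deriv ^^ j) f u) has_field_derivative (-1) ^ j * (deriv ^^ Suc j) f u) (at u)"
    by (intro DERIV_cmult higher_deriv_f_has_deriv Suc.prems)
  hence "((\<lambda>u. (deriv ^^ j) f (S - u)) has_field_derivative (-1) ^ j * (deriv ^^ Suc j) f u) (at u)"
    by (rule has_field_derivative_transform_within_open[OF _ open_M_nz]) (use Suc in auto)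
  ultimately have "(deriv ^^ Suc j) f (S - u) * (- 1) = (-1) ^ j * (deriv ^^ Suc j) f u"
    by (rule DERIV_unique)
  hence "- (deriv ^^ Suc j) f (S - u) = (-1) ^ j * (deriv ^^ Suc j) f u" by (simp only: mult_minus1_right)
  hence "(deriv ^^ Suc j) f (S - u) = - ((-1) ^ j * (deriv ^^ Suc j) f u)" by (metis minus_minus)
  thus ?case by (simp only: power_Suc mult_minus1 mult_minus_left mult_1_left)
qed

lemma lincomb_periodic:
  "lincomb f n l k (u + \<omega>1) = lincomb f n l k u" "lincomb f n l k (u + \<omega>2) = lincomb f n l k u"
  using higher_deriv_periodic[of f \<omega>1] higher_deriv_periodic[of f \<omega>2] per1 per2 by (simp_all add: lincomb_def)

lemma lincomb_reflect:
  assumes "M u \<noteq> 0"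
  shows "lincomb f n l k (S - u) = lincomb f n l (\<lambda>j. (-1) ^ j * k j) u"
  using f_reflect[OF assms] higher_deriv_reflect[OF assms] by (simp add: lincomb_def mult_ac)

text \<open>The powers up to f^n and the derivatives up to order n - 1 have poles of order at most
  n, so M^n clears them. The sum of the 2n zeros is then n S, which is where \<open>\<rho>\<close>
  comes from.\<close>

lemma lincomb_Theta:
  assumes "n \<ge> 1"
  obtains G where "Theta (2 * n) (of_nat n * S) G" "\<And>u. M u \<noteq> 0 \<Longrightarrow> G u = (-1 + lincomb f n l k u) * M u ^ n"
proof -
  define G where "G = (\<lambda>u. - (M u ^ n) + (\<Sum>j=1..n. l j * X u ^ j * M u ^ (n - j))
      + (\<Sum>j=1..n-1. k j * Xd j u * M u ^ (n - Suc j)))"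
  have hol: "G holomorphic_on UNIV"
    unfolding G_def by (intro holomorphic_intros M_holomorphic X Xd_holomorphic)
  have G: "G u = (-1 + lincomb f n l k u) * M u ^ n" if u: "M u \<noteq> 0" for u
  proof -
    have "(\<Sum>j=1..n. l j * X u ^ j * M u ^ (n - j)) = (\<Sum>j=1..n. l j * f u ^ j * M u ^ n)"
    proof (rule sum.cong[OF refl])
      fix j assume "j \<in> {1..n}"
      hence "M u ^ n = M u ^ j * M u ^ (n - j)" by (simp flip: power_add)
      thus "l j * X u ^ j * M u ^ (n - j) = l j * f u ^ j * M u ^ n"
        using X(2)[OF u] u by (simp add: power_divide)
    qed
    moreover have "(\<Sum>j=1..n-1. k j * Xd j u * M u ^ (n - Suc j)) = (\<Sum>j=1..n-1. k j * (deriv ^^ j) f u * M u ^ n)"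
    proof (rule sum.cong[OF refl])
      fix j assume "j \<in> {1..n-1}"
      hence "Suc j + (n - Suc j) = n" using assms by auto
      hence "M u ^ n = M u ^ Suc j * M u ^ (n - Suc j)" by (simp only: power_add[symmetric])
      thus "k j * Xd j u * M u ^ (n - Suc j) = k j * (deriv ^^ j) f u * M u ^ n"
        using higher_deriv_f[OF u, of j] u by (simp del: power_Suc)
    qed
    ultimately show ?thesis by (simp add: G_def lincomb_def ring_distribs sum_distrib_right)
  qed
  have "Theta (2 * n) (of_nat n * S) G"
    by (rule Theta_elliptic[OF hol G]) (simp_all add: lincomb_periodic)
  thus ?thesis using G that by blast
qed

lemma expands_phi_exists:
  assumes "n \<ge> 1" shows "\<exists>c. expands_phi f n l k c"
proof -
  let ?k = "\<lambda>j. (-1) ^ j * k j"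
  obtain G where G: "Theta (2 * n) (of_nat n * S) G" "\<And>u. M u \<noteq> 0 \<Longrightarrow> G u = (-1 + lincomb f n l k u) * M u ^ n"
    using lincomb_Theta[OF assms, of l k] by blast
  obtain G' where G': "Theta (2 * n) (of_nat n * S) G'" "\<And>u. M u \<noteq> 0 \<Longrightarrow> G' u = (-1 + lincomb f n l ?k u) * M u ^ n"
    using lincomb_Theta[OF assms, of l ?k] by blast
  have "\<exists>c. \<forall>u. M u \<noteq> 0 \<longrightarrow> phi f n l k u = (\<Sum>j=0..2*n. c j * f u ^ j)"
  proof (rule symmetric_imp_polynomial)
    show "(\<lambda>u. G u * G' u) holomorphic_on UNIV"
      by (intro holomorphic_intros Theta_holomorphic[OF G(1)] Theta_holomorphic[OF G'(1)])
    show "G u * G' u = phi f n l k u * M u ^ (2 * n)" if "M u \<noteq> 0" for u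
      using G(2)[OF that] G'(2)[OF that] by (simp add: phi_eq_lincomb mult_2 power_add)
    show "phi f n l k (u + \<omega>1) = phi f n l k u" "phi f n l k (u + \<omega>2) = phi f n l k u" for u
      by (simp_all add: phi_eq_lincomb lincomb_periodic)
    show "phi f n l k (S - u) = phi f n l k u" if "M u \<noteq> 0" for u
    proof -
      \<comment> \<open>Reflecting twice restores the coefficients, so the reflection merely swaps
        the two factors of phi.\<close>
      have "(\<lambda>j. (-1) ^ j * ((-1) ^ j * k j)) = k" by (simp add: fun_eq_iff flip: mult.assoc power_mult_distrib)
      thus ?thesis by (simp add: phi_eq_lincomb lincomb_reflect[OF that])
    qed
  qed
  thus ?thesis by (simp add: expands_phi_def M_eq_0_iff)
qed

lemma f_Lat_periodic: "x \<in> Lat \<Longrightarrow> f (u + x) = f u"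
proof (induction arbitrary: u rule: Lat_induct)
  case (add x y)
  thus ?case by (metis add.assoc)
next
  case (minus x)
  show ?case using minus[of "u - x"] by simp
qed (simp_all add: per1 per2)

text \<open>\<open>G\<close> and its reflected companion \<open>G'\<close> both split by
  \<open>Theta_factor\<close>. By \<open>f_factor\<close>, each pair
  \<open>\<sigma> (u - v) * \<sigma> (u - (S - v))\<close> is f(u) - f(v) times M(u) up to a nonzero
  constant. The point \<open>a\<close> ensures that neither factorization has constant 0.\<close>

lemma phi_factor:
  assumes n: "n \<ge> 1" and z: "\<And>h. h \<in> {1..2*n-1} \<Longrightarrow> M (z h) \<noteq> 0"
    and inj: "inj_on (\<lambda>h. f (z h)) {1..2*n-1}"
    and zero: "\<And>h. h \<in> {1..2*n-1} \<Longrightarrow> -1 + lincomb f n l k (z h) = 0"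
    and nz: "M a \<noteq> 0" "-1 + lincomb f n l k a \<noteq> 0"
    and w: "w = of_nat n * S - (\<Sum>h=1..2*n-1. z h)" "M w \<noteq> 0"
  obtains \<kappa> where "\<kappa> \<noteq> 0"
    "\<And>u. M u \<noteq> 0 \<Longrightarrow> phi f n l k u = \<kappa> * ((\<Prod>h=1..2*n-1. f u - f (z h)) * (f u - f w))"
proof -
  let ?I = "{1..2*n-1}" and ?k = "\<lambda>j. (-1) ^ j * k j"
  have card: "2 * n = Suc (card ?I)" using n by simp
  \<comment> \<open>Equivalent points would have equal values of \<open>f\<close>.\<close>
  have ineq: "z i - z j \<notin> Lat" if "i \<in> ?I" "j \<in> ?I" "i \<noteq> j" for i j
    using f_Lat_periodic[of "z i - z j" "z j"] inj that by (auto simp: inj_on_def)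
  obtain G where G: "Theta (2 * n) (of_nat n * S) G" "\<And>u. M u \<noteq> 0 \<Longrightarrow> G u = (-1 + lincomb f n l k u) * M u ^ n"
    using lincomb_Theta[OF n, of l k] by blast
  obtain G' where G': "Theta (2 * n) (of_nat n * S) G'" "\<And>u. M u \<noteq> 0 \<Longrightarrow> G' u = (-1 + lincomb f n l ?k u) * M u ^ n"
    using lincomb_Theta[OF n, of l ?k] by blast
  have "\<exists>c. \<forall>u. G u = c * \<sigma> (u - (of_nat n * S - (\<Sum>h\<in>?I. z h))) * (\<Prod>h\<in>?I. \<sigma> (u - z h))"
    by (rule Theta_factor) (use G z zero ineq card in auto)
  then obtain c where c: "\<And>u. G u = c * \<sigma> (u - w) * (\<Prod>h\<in>?I. \<sigma> (u - z h))"
    using w by auto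
  have Mz': "M (S - z h) \<noteq> 0" if "h \<in> ?I" for h using z[OF that] by (simp add: M_reflect)
  have zero': "G' (S - z h) = 0" if "h \<in> ?I" for h
  proof -
    have "lincomb f n l k (S - (S - z h)) = lincomb f n l ?k (S - z h)"
      by (rule lincomb_reflect[OF Mz'[OF that]])
    thus ?thesis using G'(2)[OF Mz'[OF that]] zero[OF that] by simp
  qed
  have "\<exists>c. \<forall>u. G' u = c * \<sigma> (u - (of_nat n * S - (\<Sum>h\<in>?I. S - z h))) * (\<Prod>h\<in>?I. \<sigma> (u - (S - z h)))"
  proof (rule Theta_factor)
    show "Theta (Suc (card ?I)) (of_nat n * S) G'" using G'(1) card by simp
    show "S - z i - (S - z j) \<notin> Lat" if "i \<in> ?I" "j \<in> ?I" "i \<noteq> j" for i j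
      using ineq[OF that(2,1)] that(3) by simp
  qed (use zero' in auto)
  \<comment> \<open>The remaining zero of \<open>G'\<close> is the reflection of \<open>w\<close>: n
    S - (2n - 1) S + sum z = S - (n S - sum z).\<close>
  moreover have "of_nat n * S - (\<Sum>h\<in>?I. S - z h) = S - w"
    using n by (simp add: w sum_subtractf of_nat_diff algebra_simps)
  ultimately obtain c' where c': "\<And>u. G' u = c' * \<sigma> (u - (S - w)) * (\<Prod>h\<in>?I. \<sigma> (u - (S - z h)))"
    by auto
  have "c \<noteq> 0" using G(2)[OF nz(1)] nz c[of a] by auto
  have "c' \<noteq> 0"
  proof
    assume "c' = 0"
    have Ma: "M (S - a) \<noteq> 0" using nz(1) by (simp add: M_reflect)
    have "lincomb f n l k (S - (S - a)) = lincomb f n l ?k (S - a)"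
      by (rule lincomb_reflect[OF Ma])
    thus False using G'(2)[OF Ma] nz(2) Ma c'[of "S - a"] \<open>c' = 0\<close> by simp
  qed
  have "\<exists>r. r \<noteq> 0 \<and> (\<forall>u. X u - f v * M u = r * (\<sigma> (u - v) * \<sigma> (u - (S - v))))" if "M v \<noteq> 0" for v
    using f_factor[OF that] by metis
  then obtain r where r: "\<And>v. M v \<noteq> 0 \<Longrightarrow> r v \<noteq> 0"
    "\<And>v u. M v \<noteq> 0 \<Longrightarrow> X u - f v * M u = r v * (\<sigma> (u - v) * \<sigma> (u - (S - v)))" by metis
  define R where "R = (\<Prod>h\<in>?I. r (z h)) * r w"
  have "R \<noteq> 0" using r(1) z w(2) by (simp add: R_def)
  have "phi f n l k u = (c * c' / R) * ((\<Prod>h\<in>?I. f u - f (z h)) * (f u - f w))" if u: "M u \<noteq> 0" for u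
  proof -
    have diff: "(f u - f v) * M u = r v * (\<sigma> (u - v) * \<sigma> (u - (S - v)))" if "M v \<noteq> 0" for v
    proof -
      have "X u = f u * M u" using X(2)[OF u] u by simp
      thus ?thesis using r(2)[OF that, of u] by (simp only: left_diff_distrib)
    qed
    have "Suc (2 * n - 1) = 2 * n" using n by simp
    hence "M u ^ (2 * n) = M u * M u ^ (2 * n - 1)" by (simp only: power_Suc[symmetric])
    hence "((\<Prod>h\<in>?I. f u - f (z h)) * (f u - f w)) * M u ^ (2 * n)
        = (\<Prod>h\<in>?I. (f u - f (z h)) * M u) * ((f u - f w) * M u)"
      by (simp add: prod.distrib mult_ac)
    also have "\<dots> = (\<Prod>h\<in>?I. r (z h) * (\<sigma> (u - z h) * \<sigma> (u - (S - z h)))) * (r w * (\<sigma> (u - w) * \<sigma> (u - (S - w))))"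
      unfolding diff[OF w(2)] using diff[OF z] by (simp only: cong: prod.cong)
    also have "c * c' * \<dots> = R * (G u * G' u)"
      unfolding c c' R_def by (simp add: prod.distrib mult_ac)
    also have "\<dots> = R * phi f n l k u * M u ^ (2 * n)"
      using G(2)[OF u] G'(2)[OF u] by (simp add: phi_eq_lincomb mult_2 power_add)
    finally have "(c * c' * ((\<Prod>h\<in>?I. f u - f (z h)) * (f u - f w))) * M u ^ (2 * n) = (R * phi f n l k u) * M u ^ (2 * n)"
      by (simp add: mult_ac)
    hence "c * c' * ((\<Prod>h\<in>?I. f u - f (z h)) * (f u - f w)) = R * phi f n l k u" using u by simp
    thus ?thesis using \<open>R \<noteq> 0\<close> by (simp add: field_simps)
  qed
  moreover have "c * c' / R \<noteq> 0" using \<open>c \<noteq> 0\<close> \<open>c' \<noteq> 0\<close> \<open>R \<noteq> 0\<close> by simp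
  ultimately show ?thesis using that by blast
qed

text \<open>The difference of the two polynomials vanishes at the infinitely many values of
  \<open>f\<close>.\<close>

lemma coeff_unique:
  assumes "\<And>u. M u \<noteq> 0 \<Longrightarrow> (\<Sum>j=0..N. c j * f u ^ j) = (\<Sum>j=0..N. d j * f u ^ j)" "j \<le> N"
  shows "c j = d j"
proof -
  have "f ` {u. M u \<noteq> 0} \<subseteq> {x. (\<Sum>i\<le>N. (c i - d i) * x ^ i) = 0}"
    using assms(1) by (auto simp: ring_distribs sum_subtractf atLeast0AtMost)
  hence "infinite {x. (\<Sum>i\<le>N. (c i - d i) * x ^ i) = 0}" using infinite_range finite_subset by blast
  thus ?thesis using polyfun_finite_roots[of "\<lambda>i. c i - d i" N] assms(2) by auto
qed

lemma coeff_elem_sym: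
  assumes "\<And>u. M u \<noteq> 0 \<Longrightarrow> (\<Sum>j=0..N. c j * f u ^ j) = \<kappa> * (\<Prod>i=1..N. f u - y i)" "j \<le> N"
  shows "c (N - j) = \<kappa> * (-1) ^ j * elem_sym j N y"
proof -
  have "c (N - j) = \<kappa> * (-1) ^ (N - (N - j)) * elem_sym (N - (N - j)) N y"
  proof (rule coeff_unique[where c = c and d = "\<lambda>j. \<kappa> * (-1) ^ (N - j) * elem_sym (N - j) N y"])
    fix u assume "M u \<noteq> 0"
    from assms(1)[OF this] have "(\<Sum>j=0..N. c j * f u ^ j)
        = (\<Sum>j=0..N. \<kappa> * ((-1) ^ j * elem_sym j N y * f u ^ (N - j)))"
      by (simp only: prod_diff_elem_sym sum_distrib_left)
    also have "\<dots> = (\<Sum>j=0..N. \<kappa> * ((-1) ^ (N - j) * elem_sym (N - j) N y * f u ^ (N - (N - j))))"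
      by (subst sum.atLeastAtMost_rev) simp
    also have "\<dots> = (\<Sum>j=0..N. \<kappa> * (-1) ^ (N - j) * elem_sym (N - j) N y * f u ^ j)"
      by (intro sum.cong) auto
    finally show "(\<Sum>j=0..N. c j * f u ^ j) = (\<Sum>j=0..N. \<kappa> * (-1) ^ (N - j) * elem_sym (N - j) N y * f u ^ j)" .
  qed simp
  thus ?thesis using assms(2) by simp
qed

text \<open>A function that vanishes off the poles of \<open>f\<close> is zero on a punctured
  neighbourhood of every point. It has no poles, and the sum defining its order is empty.\<close>

lemma elliptic_order_nz:
  assumes "elliptic_order \<Lambda> (\<lambda>u. -1 + lincomb f n l k u) \<noteq> 0"
  obtains a where "M a \<noteq> 0" "-1 + lincomb f n l k a \<noteq> 0"
proof (rule ccontr)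
  assume *: "\<not> thesis"
  have "\<not> is_pole (\<lambda>u. -1 + lincomb f n l k u) v" for v
  proof -
    have "eventually (\<lambda>u. -1 + lincomb f n l k u = 0) (at v)"
      using eventually_M_nz[of v] by eventually_elim (use * that in blast)
    from is_pole_cong[OF this refl] show ?thesis by simp
  qed
  hence "elliptic_order \<Lambda> (\<lambda>u. -1 + lincomb f n l k u) = 0"
    by (simp add: elliptic_order_def quotient_def)
  with assms show False by contradiction
qed

theorem elem_sym_values:
  assumes n: "n \<ge> 1" and sum0: "z0 + (\<Sum>h=1..2*n-1. z h) = 0"
    and z: "\<forall>h\<in>{1..2*n-1}. \<not> is_pole f (z h)" and z0: "\<not> is_pole f (z0 + of_nat n * S)"
    and inj: "inj_on (\<lambda>h. f (z h)) {1..2*n-1}" and sol: "solves_system f n z l k"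
    and ord: "elliptic_order \<Lambda> (\<lambda>u. -1 + lincomb f n l k u) = 2 * n"
    and c: "expands_phi f n l k c"
  shows "c (2*n) \<noteq> 0"
    and "j \<le> 2*n \<Longrightarrow> elem_sym j (2*n) (\<lambda>h. if h = 2*n then f (z0 + of_nat n * S) else f (z h))
               = (-1) ^ j * (c (2*n - j) / c (2*n))"
    and "j \<in> {1..2*n} \<Longrightarrow> elem_sym (j-1) (2*n-1) (\<lambda>h. f (z h)) \<noteq> 0 \<Longrightarrow>
             f (z0 + of_nat n * S) = 1 / elem_sym (j-1) (2*n-1) (\<lambda>h. f (z h))
               * ((-1)^j * (c (2*n - j) / c (2*n)) - elem_sym j (2*n-1) (\<lambda>h. f (z h)))"
proof -
  let ?w = "z0 + of_nat n * S" and ?I = "{1..2*n-1}"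
  let ?y = "\<lambda>h. if h = 2*n then f ?w else f (z h)"
  obtain a where a: "M a \<noteq> 0" "-1 + lincomb f n l k a \<noteq> 0"
    using elliptic_order_nz[of \<Lambda> n l k] ord n by auto
  have zero: "-1 + lincomb f n l k (z h) = 0" if "h \<in> ?I" for h
    using sol that unfolding solves_system_def by auto
  \<comment> \<open>The condition on the sum of the points identifies z0 + n S with the last zero
    found by \<open>Theta_factor\<close>.\<close>
  have w: "?w = of_nat n * S - (\<Sum>h=1..2*n-1. z h)" "M ?w \<noteq> 0"
    using sum0 z0 by (auto simp: M_eq_0_iff algebra_simps add_eq_0_iff2)
  have Mz: "M (z h) \<noteq> 0" if "h \<in> ?I" for h using z that by (simp add: M_eq_0_iff)
  obtain \<kappa> where \<kappa>: "\<kappa> \<noteq> 0"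
    "\<And>u. M u \<noteq> 0 \<Longrightarrow> phi f n l k u = \<kappa> * ((\<Prod>h\<in>?I. f u - f (z h)) * (f u - f ?w))"
    using phi_factor[OF n Mz inj zero a w] by blast
  have coeff: "c (2*n - j) = \<kappa> * (-1) ^ j * elem_sym j (2*n) ?y" if "j \<le> 2 * n" for j
  proof (rule coeff_elem_sym[OF _ that])
    fix u assume u: "M u \<noteq> 0"
    have "{1..2*n} = insert (2*n) ?I" using n by auto
    hence "(\<Prod>i=1..2*n. f u - ?y i) = (f u - f ?w) * (\<Prod>i\<in>?I. f u - ?y i)" using n by simp
    also have "(\<Prod>i\<in>?I. f u - ?y i) = (\<Prod>i\<in>?I. f u - f (z i))" by (intro prod.cong) auto
    finally show "(\<Sum>j=0..2*n. c j * f u ^ j) = \<kappa> * (\<Prod>i=1..2*n. f u - ?y i)"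
      using \<kappa>(2)[OF u] c u by (simp add: expands_phi_def M_eq_0_iff mult_ac)
  qed
  have c0: "c (2*n) = \<kappa>" using coeff[of 0] by simp
  thus "c (2*n) \<noteq> 0" using \<kappa>(1) by simp
  show sym: "elem_sym j (2*n) ?y = (-1) ^ j * (c (2*n - j) / c (2*n))" if "j \<le> 2*n" for j
    using coeff[OF that] c0 \<kappa>(1) by (simp flip: mult.assoc power_mult_distrib)
  assume j: "j \<in> {1..2*n}" and nz: "elem_sym (j-1) (2*n-1) (\<lambda>h. f (z h)) \<noteq> 0"
  obtain i where i: "j = Suc i" using j by (cases j) auto
  obtain N where N: "2 * n = Suc N" using n by (cases "2 * n") auto
  have "elem_sym r N ?y = elem_sym r N (\<lambda>h. f (z h))" for r
    by (rule elem_sym_cong) (use N in auto)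
  \<comment> \<open>Separating the variable with index 2n makes f(z0 + n S) appear linearly.\<close>
  hence eq: "elem_sym j (2*n) ?y = elem_sym j (2*n-1) (\<lambda>h. f (z h)) + f ?w * elem_sym (j-1) (2*n-1) (\<lambda>h. f (z h))"
    unfolding i N elem_sym_Suc by simp
  have "j \<le> 2*n" using j by simp
  from sym[OF this, unfolded eq] have "f ?w * elem_sym (j-1) (2*n-1) (\<lambda>h. f (z h))
      = (-1) ^ j * (c (2*n - j) / c (2*n)) - elem_sym j (2*n-1) (\<lambda>h. f (z h))"
    unfolding eq_diff_eq by (subst add.commute)
  thus "f ?w = 1 / elem_sym (j-1) (2*n-1) (\<lambda>h. f (z h))
      * ((-1)^j * (c (2*n - j) / c (2*n)) - elem_sym j (2*n-1) (\<lambda>h. f (z h)))"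
    using nz by (simp add: field_simps)
qed

end

section \<open>The Jacobi functions\<close>

text \<open>Used contrapositively. If \<open>quarter_K\<close> or all four theta functions vanished,
  then with x / 0 = 0 each of sn, cn, dn would be constant, so a given pole excludes these
  cases.\<close>

lemma no_pole_if_constant:
  assumes "\<And>x u. over_n \<tau> x u = over_n \<tau> x 0"
  shows "\<not> is_pole (jacobi \<tau> p q) u"
proof -
  have "jacobi \<tau> p q = (\<lambda>_. over_n \<tau> p 0 / over_n \<tau> q 0)"
  proof
    fix v
    have "(\<lambda>u. over_n \<tau> p u / over_n \<tau> q u) = (\<lambda>_. over_n \<tau> p 0 / over_n \<tau> q 0)"
      using assms[of p] assms[of q] by (intro ext) metis
    thus "jacobi \<tau> p q v = over_n \<tau> p 0 / over_n \<tau> q 0" by (simp add: jacobi_def)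
  qed
  thus ?thesis by simp
qed

lemma cos_add_npi: "cos (x + of_nat k * of_real pi) = (-1) ^ k * cos x" for x :: complex
proof (induction k)
  case (Suc k)
  have "cos (x + of_nat (Suc k) * of_real pi) = cos ((x + of_nat k * of_real pi) + of_real pi)"
    by (simp add: algebra_simps)
  also have "\<dots> = - cos (x + of_nat k * of_real pi)"
    by (subst cos_add) (simp flip: cos_of_real sin_of_real)
  finally show ?case using Suc by simp
qed simp

lemma half_eqI: "2 * x = y \<Longrightarrow> x = y / 2" for x y :: complex
  by auto

section \<open>The four theta series as translates of sigma\<close>

text \<open>\<open>\<omega>\<close> stands for 2K, so that \<open>\<omega> * \<tau>\<close> is
  2iK'.\<close>

locale theta_lat =
  fixes \<omega> \<tau> :: complex
  assumes \<omega>_nz: "\<omega> \<noteq> 0" and Im_\<tau>: "Im \<tau> > 0"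
begin

sublocale lattice2 \<omega> "\<omega> * \<tau>"
  by unfold_locales (use \<omega>_nz Im_\<tau> in simp)

definition q :: complex where "q = exp (of_real pi * \<i> * \<tau>)"

lemma q_nz [simp]: "q \<noteq> 0" by (simp add: q_def)

lemma norm_q: "norm q < 1"
proof -
  have "of_real pi * \<i> * \<tau> = of_real pi * (\<i> * \<tau>)" by simp
  hence "Re (of_real pi * \<i> * \<tau>) = - (pi * Im \<tau>)"
    by (simp only: times_complex.sel Re_complex_of_real Im_complex_of_real Re_i_times, simp)
  thus ?thesis using Im_\<tau> by (simp add: q_def norm_exp_eq_Re)
qed

lemma nome_pow_of_nat: "nome_pow \<tau> (of_nat n) = q ^ n"
  by (simp add: nome_pow_def q_def exp_of_nat_mult[symmetric] mult_ac)

lemma nome_pow_add: "nome_pow \<tau> (a + b) = nome_pow \<tau> a * nome_pow \<tau> b"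
  by (simp add: nome_pow_def exp_add ring_distribs)

text \<open>Half of the bilateral theta series.  It turns every manipulation of the one-sided cosine
  series into a manipulation of power series.\<close>

definition A :: "complex \<Rightarrow> complex" where "A w = (\<Sum>m. q ^ (m\<^sup>2) * w ^ m)"

lemma summable_A: "summable (\<lambda>m. q ^ (m\<^sup>2) * w ^ m)"
proof -
  have "(\<lambda>m. q ^ m * q ^ m * q * w) \<longlonglongrightarrow> 0 * 0 * q * w"
    by (intro tendsto_intros LIMSEQ_power_zero norm_q)
  hence "(\<lambda>m. norm (q ^ m * q ^ m * q * w)) \<longlonglongrightarrow> 0" using tendsto_norm_zero by force
  hence "eventually (\<lambda>m. norm (q ^ m * q ^ m * q * w) < 1/2) sequentially"
    by (rule order_tendstoD) auto
  then obtain N where N: "\<And>m. m \<ge> N \<Longrightarrow> norm (q ^ m * q ^ m * q * w) < 1/2"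
    by (auto simp: eventually_sequentially)
  show ?thesis
  proof (rule summable_ratio_test[of "1/2" N])
    fix m assume "m \<ge> N"
    have "q ^ ((Suc m)\<^sup>2) = q ^ (m\<^sup>2) * (q ^ m * q ^ m * q)"
      by (simp add: power2_eq_square power_add mult_ac)
    hence "norm (q ^ ((Suc m)\<^sup>2) * w ^ Suc m) = norm (q ^ m * q ^ m * q * w) * norm (q ^ (m\<^sup>2) * w ^ m)"
      by (simp add: norm_mult)
    also have "\<dots> \<le> 1/2 * norm (q ^ (m\<^sup>2) * w ^ m)"
      using N[OF \<open>m \<ge> N\<close>] by (intro mult_right_mono) auto
    finally show "norm (q ^ ((Suc m)\<^sup>2) * w ^ Suc m) \<le> 1/2 * norm (q ^ (m\<^sup>2) * w ^ m)" .
  qed auto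
qed

lemma A_holomorphic: "A holomorphic_on UNIV"
proof -
  have "A field_differentiable (at x)" for x
  proof -
    have "DERIV (\<lambda>x. \<Sum>m. q ^ (m\<^sup>2) * x ^ m) x :> (\<Sum>n. diffs (\<lambda>m. q ^ (m\<^sup>2)) n * x ^ n)"
      by (rule termdiffs_strong_converges_everywhere) (rule summable_A)
    thus ?thesis unfolding A_def[abs_def] field_differentiable_def by blast
  qed
  thus ?thesis by (simp add: holomorphic_on_def field_differentiable_at_within)
qed

lemma A_split: "A w = 1 + (\<Sum>m. q ^ ((Suc m)\<^sup>2) * w ^ Suc m)"
  unfolding A_def using suminf_split_head[OF summable_A[of w]] by simp

text \<open>Splits off the term m = 0, using (m+1)^2 = m^2 + 2m + 1.\<close>

lemma A_shift: "A w = 1 + q * w * A (q\<^sup>2 * w)"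
proof -
  have "(\<Sum>m. q ^ ((Suc m)\<^sup>2) * w ^ Suc m) = (\<Sum>m. q * w * (q ^ (m\<^sup>2) * (q\<^sup>2 * w) ^ m))"
  proof (rule arg_cong[of _ _ suminf], rule ext)
    fix m
    have "q ^ ((Suc m)\<^sup>2) = q * q ^ (m\<^sup>2) * q\<^sup>2 ^ m"
      by (simp add: power2_eq_square power_add power_mult_distrib mult_ac)
    thus "q ^ ((Suc m)\<^sup>2) * w ^ Suc m = q * w * (q ^ (m\<^sup>2) * (q\<^sup>2 * w) ^ m)"
      by (simp add: power_mult_distrib mult_ac)
  qed
  also have "\<dots> = q * w * A (q\<^sup>2 * w)"
    unfolding A_def using summable_A by (rule suminf_mult)
  finally show ?thesis using A_split[of w] by simp
qed

lemma two_cos: "2 * cos (of_nat k * u) = exp (\<i> * u) ^ k + exp (- (\<i> * u)) ^ k" for u :: complex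
  by (simp add: cos_exp_eq exp_of_nat_mult[symmetric] mult_ac)

text \<open>The two halves of the bilateral series share the term m = 0, hence the - 1.\<close>

lemma theta3_eq: "theta3 \<tau> u = A (exp (2 * \<i> * u)) + A (exp (- (2 * \<i> * u))) - 1"
proof -
  let ?w = "exp (2 * \<i> * u)" and ?w' = "exp (- (2 * \<i> * u))"
  have s: "summable (\<lambda>m. q ^ ((Suc m)\<^sup>2) * w ^ Suc m)" for w
    using summable_A[of w] by (subst summable_Suc_iff)
  have "(\<lambda>m. nome_pow \<tau> (of_nat (Suc m)^2) * cos (of_nat (2 * Suc m) * u))
      = (\<lambda>m. (q ^ ((Suc m)\<^sup>2) * ?w ^ Suc m + q ^ ((Suc m)\<^sup>2) * ?w' ^ Suc m) / 2)"
  proof (rule ext)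
    fix m
    have "exp (\<i> * u) ^ (2 * Suc m) = ?w ^ Suc m" "exp (- (\<i> * u)) ^ (2 * Suc m) = ?w' ^ Suc m"
      unfolding power_mult by (simp_all add: exp_double[symmetric] mult_ac del: power_Suc)
    with two_cos[of "2 * Suc m" u] have "2 * cos (of_nat (2 * Suc m) * u) = ?w ^ Suc m + ?w' ^ Suc m"
      by simp
    hence c: "cos (of_nat (2 * Suc m) * u) = (?w ^ Suc m + ?w' ^ Suc m) / 2" by (rule half_eqI)
    have "nome_pow \<tau> (of_nat (Suc m)^2) = q ^ ((Suc m)\<^sup>2)"
      using nome_pow_of_nat[of "(Suc m)\<^sup>2"] by (simp only: of_nat_power)
    thus "nome_pow \<tau> (of_nat (Suc m)^2) * cos (of_nat (2 * Suc m) * u)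
        = (q ^ ((Suc m)\<^sup>2) * ?w ^ Suc m + q ^ ((Suc m)\<^sup>2) * ?w' ^ Suc m) / 2"
      unfolding c by (simp only: distrib_left times_divide_eq_right)
  qed
  hence "2 * (\<Sum>m. nome_pow \<tau> (of_nat (Suc m)^2) * cos (of_nat (2 * Suc m) * u))
      = (\<Sum>m. q ^ ((Suc m)\<^sup>2) * ?w ^ Suc m) + (\<Sum>m. q ^ ((Suc m)\<^sup>2) * ?w' ^ Suc m)"
    unfolding suminf_add[OF s[of ?w] s[of ?w']]
    by (simp only: suminf_divide[OF summable_add[OF s[of ?w] s[of ?w']], of 2]) simp
  thus ?thesis unfolding theta3_def A_split[of ?w] A_split[of ?w'] by simp
qed

text \<open>(m + 1/2)^2 = m^2 + m + 1/4: the middle term goes into the argument of \<open>A\<close>,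
  the last one into the constant.\<close>

lemma theta2_eq:
  "theta2 \<tau> u = nome_pow \<tau> (1/4) * (exp (\<i> * u) * A (q * exp (2 * \<i> * u)) + exp (- (\<i> * u)) * A (q * exp (- (2 * \<i> * u))))"
proof -
  let ?w = "exp (2 * \<i> * u)" and ?w' = "exp (- (2 * \<i> * u))"
  let ?g = "\<lambda>m. nome_pow \<tau> (1/4) * (exp (\<i> * u) * (q ^ (m\<^sup>2) * (q * ?w) ^ m) + exp (- (\<i> * u)) * (q ^ (m\<^sup>2) * (q * ?w') ^ m))"
  have term_eq: "nome_pow \<tau> ((of_nat m + 1/2)^2) * cos (of_nat (2*m+1) * u) = ?g m / 2" for m
  proof -
    have "exp (\<i> * u) ^ (2 * m + 1) = exp (\<i> * u) * ?w ^ m" "exp (- (\<i> * u)) ^ (2 * m + 1) = exp (- (\<i> * u)) * ?w' ^ m"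
      unfolding power_add power_mult by (simp_all add: exp_double[symmetric] mult_ac)
    with two_cos[of "2 * m + 1" u]
    have c: "cos (of_nat (2*m+1) * u) = (exp (\<i> * u) * ?w ^ m + exp (- (\<i> * u)) * ?w' ^ m) / 2"
      by (simp add: field_simps)
    have "(of_nat m + 1/2)^2 = (of_nat (m\<^sup>2) + of_nat m + 1/4 :: complex)"
      by (simp add: power2_eq_square field_simps)
    hence "nome_pow \<tau> ((of_nat m + 1/2)^2) = q ^ (m\<^sup>2) * q ^ m * nome_pow \<tau> (1/4)"
      by (simp only: nome_pow_add nome_pow_of_nat)
    thus ?thesis unfolding c by (simp add: power_mult_distrib field_simps)
  qed
  have s: "(\<lambda>m. q ^ (m\<^sup>2) * w ^ m) sums A w" for w
    unfolding A_def using summable_A by (rule summable_sums)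
  have "(\<lambda>m. ?g m / 2) sums (nome_pow \<tau> (1/4) * (exp (\<i> * u) * A (q * ?w) + exp (- (\<i> * u)) * A (q * ?w')) / 2)"
    by (intro sums_divide sums_mult sums_add s)
  hence eq: "(\<Sum>m. nome_pow \<tau> ((of_nat m + 1/2)^2) * cos (of_nat (2*m+1) * u))
      = nome_pow \<tau> (1/4) * (exp (\<i> * u) * A (q * ?w) + exp (- (\<i> * u)) * A (q * ?w')) / 2"
    unfolding term_eq by (rule sums_unique[symmetric])
  show ?thesis unfolding theta2_def eq by simp
qed

lemma exp_2pi\<tau>: "exp (2 * \<i> * (of_real pi * \<tau>)) = q\<^sup>2"
  unfolding q_def exp_double[symmetric] by (simp add: mult_ac)

lemma theta3_pi: "theta3 \<tau> (u + of_real pi) = theta3 \<tau> u"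
proof -
  have "exp (2 * \<i> * (u + of_real pi)) = exp (2 * \<i> * u)"
    using exp_two_pi_i by (simp add: ring_distribs exp_add mult_ac)
  moreover from this have "exp (- (2 * \<i> * (u + of_real pi))) = exp (- (2 * \<i> * u))"
    by (simp only: exp_minus)
  ultimately show ?thesis by (simp add: theta3_eq)
qed

text \<open>Re-indexing the bilateral series by one: \<open>A_shift\<close> takes a term from one
  half and adds one to the other.\<close>

lemma theta3_pi\<tau>: "theta3 \<tau> (u + of_real pi * \<tau>) = 1 / (q * exp (2 * \<i> * u)) * theta3 \<tau> u"
proof -
  let ?w = "exp (2 * \<i> * u)"
  have w: "exp (2 * \<i> * (u + of_real pi * \<tau>)) = q\<^sup>2 * ?w"
    using exp_2pi\<tau> by (simp add: ring_distribs exp_add mult_ac)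
  have w': "exp (- (2 * \<i> * (u + of_real pi * \<tau>))) = 1 / (q\<^sup>2 * ?w)"
    unfolding exp_minus w by (simp add: field_simps)
  have "A (q\<^sup>2 * ?w) = (A ?w - 1) / (q * ?w)"
    using A_shift[of ?w] by (simp add: field_simps)
  moreover have "A (1 / (q\<^sup>2 * ?w)) = 1 + A (1 / ?w) / (q * ?w)"
    using A_shift[of "1 / (q\<^sup>2 * ?w)"] by (simp add: field_simps power2_eq_square)
  ultimately have "A (q\<^sup>2 * ?w) + A (1 / (q\<^sup>2 * ?w)) - 1 = 1 / (q * ?w) * (A ?w + A (1 / ?w) - 1)"
    by (simp add: field_simps)
  thus ?thesis unfolding theta3_eq w w' by (simp add: exp_minus inverse_eq_divide)
qed

lemma theta4_eq: "theta4 \<tau> u = theta3 \<tau> (u + of_real pi / 2)"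
proof -
  have "cos (of_nat (2 * Suc m) * (u + of_real pi / 2)) = (-1) ^ Suc m * cos (of_nat (2 * Suc m) * u)" for m
  proof -
    have "of_nat (2 * Suc m) * (u + of_real pi / 2) = of_nat (2 * Suc m) * u + of_nat (Suc m) * of_real pi"
      by (simp add: field_simps)
    thus ?thesis by (simp only: cos_add_npi)
  qed
  thus ?thesis unfolding theta3_def theta4_def by (simp add: mult_ac del: power_Suc)
qed

lemma theta1_eq: "theta1 \<tau> u = theta2 \<tau> (u - of_real pi / 2)"
proof -
  have "cos (of_nat (2*m+1) * (u - of_real pi / 2)) = (-1) ^ m * sin (of_nat (2*m+1) * u)" for m
  proof -
    have "of_nat (2*m+1) * u - of_real pi / 2
        = of_nat (2*m+1) * (u - of_real pi / 2) + of_nat m * of_real pi" by (simp add: field_simps)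
    hence "cos (of_nat (2*m+1) * u - of_real pi / 2) = (-1) ^ m * cos (of_nat (2*m+1) * (u - of_real pi / 2))"
      using cos_add_npi[of "of_nat (2*m+1) * (u - of_real pi / 2)" m] by simp
    moreover have "cos (of_nat (2*m+1) * u - of_real pi / 2) = sin (of_nat (2*m+1) * u)"
      using cos_of_real_pi_half sin_of_real_pi_half by (simp add: cos_diff)
    ultimately have "(-1) ^ m * ((-1) ^ m * cos (of_nat (2*m+1) * (u - of_real pi / 2)))
        = (-1) ^ m * sin (of_nat (2*m+1) * u)" by simp
    thus ?thesis by (simp flip: mult.assoc power_mult_distrib)
  qed
  thus ?thesis unfolding theta1_def theta2_def by (simp add: mult_ac)
qed

lemma theta2_eq_theta3:
  "theta2 \<tau> u = nome_pow \<tau> (1/4) * exp (\<i> * u) * theta3 \<tau> (u + of_real pi * \<tau> / 2)"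
proof -
  let ?w = "exp (2 * \<i> * u)"
  have w: "exp (2 * \<i> * (u + of_real pi * \<tau> / 2)) = q * ?w"
    by (simp add: q_def ring_distribs exp_add mult_ac)
  have w': "exp (- (2 * \<i> * (u + of_real pi * \<tau> / 2))) = 1 / (q * ?w)"
    unfolding exp_minus w by (simp add: field_simps)
  have 1: "A (1 / (q * ?w)) = 1 + 1 / ?w * A (q / ?w)"
    using A_shift[of "1 / (q * ?w)"] by (simp add: field_simps power2_eq_square)
  have "exp (- (\<i> * u)) = exp (\<i> * u) / ?w"
    by (simp add: exp_diff[symmetric])
  hence "exp (\<i> * u) * (A (q * ?w) + A (1 / (q * ?w)) - 1) = exp (\<i> * u) * A (q * ?w) + exp (- (\<i> * u)) * A (q / ?w)"
    unfolding 1 by (simp add: field_simps)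
  thus ?thesis unfolding theta3_eq theta2_eq w w' by (simp add: exp_minus inverse_eq_divide mult.assoc)
qed

abbreviation W :: "complex \<Rightarrow> complex" where "W u \<equiv> of_real pi * u / \<omega>"

text \<open>The multipliers are those of a single translate of \<open>\<sigma>\<close>, whose zero
  they reveal. The constant may still be 0 here; the lemma \<open>jacobi_ratio\<close> rules that
  out.\<close>

lemma theta3_\<sigma>: "\<exists>k. \<forall>u. theta3 \<tau> (W u) = k * \<sigma> (u - (\<omega> + \<omega> * \<tau>) / 2)"
proof (rule Theta_1)
  have "(\<lambda>u. theta3 \<tau> (W u)) holomorphic_on UNIV"
    unfolding theta3_eq using \<omega>_nz
    by (intro holomorphic_intros holomorphic_on_compose_gen[OF _ A_holomorphic, of _ _, unfolded o_def]) auto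
  moreover have "W (u + \<omega>) = W u + of_real pi" "W (u + \<omega> * \<tau>) = W u + of_real pi * \<tau>" for u
    using \<omega>_nz by (simp_all add: field_simps)
  moreover have "1 / (q * exp (2 * \<i> * W u)) = - ee ((\<omega> + \<omega> * \<tau>) / 2 - (u + \<omega> * \<tau>))" for u
  proof -
    have "ee ((\<omega> + \<omega> * \<tau>) / 2 - (u + \<omega> * \<tau>)) = exp (of_real pi * \<i> - (of_real pi * \<i> * \<tau> + 2 * \<i> * W u))"
      unfolding ee_def using \<omega>_nz by (intro arg_cong[of _ _ exp]) (simp add: field_simps)
    also have "\<dots> = - 1 / (q * exp (2 * \<i> * W u))"
      by (simp add: exp_diff exp_add q_def)
    finally show ?thesis by simp
  qed
  ultimately show "Theta 1 ((\<omega> + \<omega> * \<tau>) / 2) (\<lambda>u. theta3 \<tau> (W u))"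
    unfolding Theta_def by (simp add: theta3_pi theta3_pi\<tau>)
qed

fun theta :: "glaisher \<Rightarrow> complex \<Rightarrow> complex" where
  "theta Ls = theta1 \<tau>" | "theta Lc = theta2 \<tau>" | "theta Ld = theta3 \<tau>" | "theta Ln = theta4 \<tau>"

fun theta_zero :: "glaisher \<Rightarrow> complex" where
  "theta_zero Ls = 0" | "theta_zero Lc = \<omega> / 2" | "theta_zero Ld = (\<omega> + \<omega> * \<tau>) / 2" | "theta_zero Ln = \<omega> * \<tau> / 2"

text \<open>The shift by half a quasi-period in \<open>theta2_eq_theta3\<close> costs a factor exp(i
  W(u)); this is its exponent, with 0 where no such shift occurs.\<close>

fun theta_exponent :: "glaisher \<Rightarrow> complex" where
  "theta_exponent Ls = of_real pi * \<i> / \<omega>" | "theta_exponent Lc = of_real pi * \<i> / \<omega>" | "theta_exponent Ld = 0" | "theta_exponent Ln = 0"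

text \<open>All four functions are shifts of theta_3, so they share its constant \<open>k\<close>
  and differ only by the nonzero \<open>c x\<close>. In quotients \<open>k\<close> cancels.\<close>

lemma theta_\<sigma>:
  obtains k c where "\<And>x. c x \<noteq> 0" "\<And>x u. theta x (W u) = k * c x * exp (theta_exponent x * u) * \<sigma> (u - theta_zero x)"
proof -
  obtain k where k: "\<And>u. theta3 \<tau> (W u) = k * \<sigma> (u - (\<omega> + \<omega> * \<tau>) / 2)" using theta3_\<sigma> by blast
  have np: "nome_pow \<tau> (1/4) \<noteq> 0" by (simp add: nome_pow_def)
  have h: "W u + of_real pi / 2 = W (u + \<omega> / 2)" "W u - of_real pi / 2 = W (u - \<omega> / 2)"
    "W u + of_real pi * \<tau> / 2 = W (u + \<omega> * \<tau> / 2)" for u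
    using \<omega>_nz by (simp_all add: field_simps)
  have 4: "theta4 \<tau> (W u) = k * \<sigma> (u - \<omega> * \<tau> / 2)" for u
  proof -
    have "u + \<omega> / 2 - (\<omega> + \<omega> * \<tau>) / 2 = u - \<omega> * \<tau> / 2" by (simp add: field_simps)
    thus ?thesis unfolding theta4_eq h k by (simp only:)
  qed
  have 2: "theta2 \<tau> (W u) = k * nome_pow \<tau> (1/4) * exp (of_real pi * \<i> / \<omega> * u) * \<sigma> (u - \<omega> / 2)" for u
  proof -
    have "u + \<omega> * \<tau> / 2 - (\<omega> + \<omega> * \<tau>) / 2 = u - \<omega> / 2" by (simp add: field_simps)
    hence "theta2 \<tau> (W u) = nome_pow \<tau> (1/4) * exp (\<i> * W u) * (k * \<sigma> (u - \<omega> / 2))"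
      unfolding theta2_eq_theta3 h k by (simp only:)
    thus ?thesis by (simp add: mult_ac)
  qed
  have 1: "theta1 \<tau> (W u) = k * (nome_pow \<tau> (1/4) * exp (- (of_real pi * \<i> / 2))) * exp (of_real pi * \<i> / \<omega> * u) * \<sigma> u" for u
  proof -
    have "of_real pi * \<i> / \<omega> * (u - \<omega> / 2) = - (of_real pi * \<i> / 2) + of_real pi * \<i> / \<omega> * u"
      using \<omega>_nz by (simp add: field_simps)
    hence "exp (of_real pi * \<i> / \<omega> * (u - \<omega> / 2)) = exp (- (of_real pi * \<i> / 2)) * exp (of_real pi * \<i> / \<omega> * u)"
      by (simp only: exp_add)
    moreover have "\<sigma> (u - \<omega> / 2 - \<omega> / 2) = \<sigma> u" using \<sigma>_\<omega>1[of "u - \<omega>"] by simp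
    ultimately show ?thesis unfolding theta1_eq h 2 by (simp only: mult.assoc)
  qed
  define c where "c = (\<lambda>x. case x of Ls \<Rightarrow> nome_pow \<tau> (1/4) * exp (- (of_real pi * \<i> / 2))
    | Lc \<Rightarrow> nome_pow \<tau> (1/4) | Ld \<Rightarrow> 1 | Ln \<Rightarrow> 1)"
  have "c x \<noteq> 0" for x using np by (cases x) (auto simp: c_def)
  moreover have "theta x (W u) = k * c x * exp (theta_exponent x * u) * \<sigma> (u - theta_zero x)" for x u
    using 1 2 4 k by (cases x) (simp_all add: c_def)
  ultimately show ?thesis using that by blast
qed

section \<open>Theta quotients and their signs\<close>

definition N :: "glaisher \<Rightarrow> complex \<Rightarrow> complex" where
  "N x u = exp (theta_exponent x * u) * \<sigma> (u - theta_zero x)"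

text \<open>The multipliers of the four \<open>N x\<close> agree up to the signs \<open>sgn1\<close>
  for \<open>\<omega>\<close> and \<open>sgn2\<close> for \<open>\<omega> * \<tau>\<close>. Distinct
  letters have distinct sign pairs, which decides the periods of each quotient.\<close>

fun sgn1 :: "glaisher \<Rightarrow> complex" where
  "sgn1 Ls = -1" | "sgn1 Lc = -1" | "sgn1 Ld = 1" | "sgn1 Ln = 1"

fun sgn2 :: "glaisher \<Rightarrow> complex" where
  "sgn2 Ls = 1" | "sgn2 Lc = -1" | "sgn2 Ld = -1" | "sgn2 Ln = 1"

lemma sgn_nz [simp]: "sgn1 x \<noteq> 0" "sgn2 x \<noteq> 0"
  by (cases x; simp)+

lemma N_holomorphic: "N x holomorphic_on B"
  unfolding N_def[abs_def] by (intro holomorphic_intros)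

lemma N_eq_0_iff: "N x u = 0 \<longleftrightarrow> u - theta_zero x \<in> Lat"
  by (simp add: N_def \<sigma>_eq_0_iff)

lemma eventually_N_nz: "eventually (\<lambda>u. N x u \<noteq> 0) (at u0)"
proof -
  obtain a where "\<sigma> (a - theta_zero x) \<noteq> 0" using \<sigma>_shifted_nz by blast
  hence "N x a \<noteq> 0" by (simp add: N_def)
  thus ?thesis by (rule eventually_entire_nz[OF N_holomorphic])
qed

lemma N_\<omega>: "N x (u + \<omega>) = sgn1 x * N x u"
proof -
  have "exp (theta_exponent x * \<omega>) = sgn1 x" using \<omega>_nz by (cases x) simp_all
  moreover have "\<sigma> (u + \<omega> - theta_zero x) = \<sigma> (u - theta_zero x)" using \<sigma>_\<omega>1[of "u - theta_zero x"] by (simp add: algebra_simps)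
  ultimately show ?thesis by (simp add: N_def exp_add ring_distribs)
qed

lemma N_\<omega>\<tau>: "N x (u + \<omega> * \<tau>) = sgn2 x * (- q * ee (- (u + \<omega> * \<tau>))) * N x u"
proof -
  have e: "ee (\<omega> / 2) = -1" "ee ((\<omega> + \<omega> * \<tau>) / 2) = - q" "ee (\<omega> * \<tau> / 2) = q"
    using \<omega>_nz by (simp_all add: ee_def q_def exp_add ring_distribs add_divide_distrib mult_ac)
  have "theta_exponent x * (\<omega> * \<tau>) = (if x = Ls \<or> x = Lc then of_real pi * \<i> * \<tau> else 0)"
    using \<omega>_nz by (cases x) simp_all
  hence 1: "exp (theta_exponent x * (\<omega> * \<tau>)) * ee (theta_zero x) = sgn2 x * q"
    using e by (cases x) (simp_all add: q_def)
  have "\<sigma> (u + \<omega> * \<tau> - theta_zero x) = - ee (theta_zero x - (u + \<omega> * \<tau>)) * \<sigma> (u - theta_zero x)"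
    using Theta_\<sigma>[of "theta_zero x"] by (simp add: Theta_def)
  also have "theta_zero x - (u + \<omega> * \<tau>) = theta_zero x + - (u + \<omega> * \<tau>)" by simp
  finally have "N x (u + \<omega> * \<tau>) = (exp (theta_exponent x * (\<omega> * \<tau>)) * ee (theta_zero x)) * (- ee (- (u + \<omega> * \<tau>))) * N x u"
    unfolding ee_add N_def by (simp add: exp_add ring_distribs)
  thus ?thesis unfolding 1 by simp
qed

text \<open>The zeros represent the four classes of half periods. Thus numerator and denominator of
  a Jacobi function never vanish together.\<close>

lemma theta_zero_diff:
  assumes "x \<noteq> y" shows "theta_zero x - theta_zero y \<notin> Lat"
proof -
  have h: "(1/2::real) \<notin> \<int>" "- (1/2::real) \<notin> \<int>"
    using fraction_not_in_Ints[of 2 1, where 'a = real] minus_in_Ints_iff[of "1/2::real"] by auto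
  define a where "a = (\<lambda>x. if x = Lc \<or> x = Ld then 1/2 else 0::real)"
  define b where "b = (\<lambda>x. if x = Ln \<or> x = Ld then 1/2 else 0::real)"
  have "theta_zero x = of_real (a x) * \<omega> + of_real (b x) * (\<omega> * \<tau>)" for x
    by (cases x) (simp_all add: a_def b_def field_simps)
  hence "theta_zero x - theta_zero y = of_real (a x - a y) * \<omega> + of_real (b x - b y) * (\<omega> * \<tau>)"
    by (simp add: algebra_simps)
  moreover have "a x - a y \<notin> \<int> \<or> b x - b y \<notin> \<int>"
    using assms h by (cases x; cases y) (auto simp: a_def b_def)
  ultimately show ?thesis by (simp only: of_real_in_Lat_iff) blast
qed

text \<open>The common denominator theta_4 cancels away from its isolated zeros, which
  \<open>remove_sings\<close> ignores. The pole shows that \<open>k\<close> and \<open>C\<close> are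
  nonzero.\<close>

lemma jacobi_ratio:
  assumes \<omega>: "\<omega> = 2 * quarter_K \<tau>" and pole: "is_pole (jacobi \<tau> x y) u0"
  obtains C where "C \<noteq> 0" "jacobi \<tau> x y = remove_sings (\<lambda>u. C * N x u / N y u)"
proof -
  obtain k c where c: "\<And>x. c x \<noteq> 0" and theta: "\<And>x u. theta x (W u) = k * c x * exp (theta_exponent x * u) * \<sigma> (u - theta_zero x)"
    using theta_\<sigma> by metis
  hence theta_N: "theta x (W u) = k * c x * N x u" for x u by (simp add: N_def)
  define D where "D = (\<lambda>x. case x of Ls \<Rightarrow> theta3 \<tau> 0 / theta2 \<tau> 0 | Lc \<Rightarrow> theta4 \<tau> 0 / theta2 \<tau> 0
    | Ld \<Rightarrow> theta4 \<tau> 0 / theta3 \<tau> 0 | Ln \<Rightarrow> 1)"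
  have over_n: "over_n \<tau> x u = (if x = Ln then 1 else D x * (theta x (W u) / theta Ln (W u)))" for x u
    by (cases x) (simp_all add: D_def sn_def cn_def dn_def \<omega>)
  have k: "k \<noteq> 0"
  proof
    assume "k = 0"
    hence "over_n \<tau> x u = over_n \<tau> x 0" for x u unfolding over_n theta_N by simp
    from no_pole_if_constant[OF this] pole show False by blast
  qed
  define E where "E = (\<lambda>x. D x * c x / c Ln)"
  have over_N: "over_n \<tau> x u = E x * N x u / N Ln u" if "N Ln u \<noteq> 0" for x u
    using that c[of Ln] k unfolding over_n theta_N by (auto simp: E_def D_def)
  define C where "C = E x / E y"
  have "remove_sings (\<lambda>u. over_n \<tau> x u / over_n \<tau> y u) v = remove_sings (\<lambda>u. C * N x u / N y u) v" for v
  proof (rule remove_sings_cong[OF _ refl])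
    show "eventually (\<lambda>u. over_n \<tau> x u / over_n \<tau> y u = C * N x u / N y u) (at v)"
      using eventually_N_nz[of Ln v] by eventually_elim (simp add: over_N C_def)
  qed
  hence jac: "jacobi \<tau> x y = remove_sings (\<lambda>u. C * N x u / N y u)" by (auto simp: jacobi_def)
  have "C \<noteq> 0"
  proof
    assume "C = 0"
    hence "jacobi \<tau> x y = (\<lambda>_. 0)" unfolding jac by (intro ext) simp
    thus False using pole by simp
  qed
  thus ?thesis using jac that by blast
qed

end

lemma minus_one_powi: "(-1) powi m = (1::complex) \<longleftrightarrow> even m"
  by (cases m rule: int_cases2) (auto simp: power_int_minus minus_one_power_iff)

lemma minus_one_powi2: "(-1) powi m * (-1) powi n = (1::complex) \<longleftrightarrow> even (m + n)"
  using minus_one_powi[of "m + n"] by (simp add: power_int_add)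

section \<open>Poles and periods of the Jacobi functions\<close>

locale jacobi_ratio = theta_lat +
  fixes x y :: glaisher and C :: complex and f :: "complex \<Rightarrow> complex"
  assumes xy: "x \<noteq> y" and C_nz: "C \<noteq> 0" and f_def: "f = remove_sings (\<lambda>u. C * N x u / N y u)"
begin

lemma open_N_nz: "open {u. N y u \<noteq> 0}"
proof -
  have "open (N y -` (- {0}))"
    using N_holomorphic holomorphic_on_imp_continuous_on continuous_on_open_vimage[of UNIV "N y"] by auto
  thus ?thesis by (simp add: vimage_def)
qed

lemma ratio_holomorphic: "(\<lambda>u. C * N x u / N y u) holomorphic_on {u. N y u \<noteq> 0}"
  by (intro holomorphic_intros N_holomorphic) auto

lemma f_eq: "N y u \<noteq> 0 \<Longrightarrow> f u = C * N x u / N y u"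
  unfolding f_def using ratio_holomorphic open_N_nz by (intro remove_sings_at_analytic) (auto simp: analytic_at)

lemma N_x_nz: assumes "N y u = 0" shows "N x u \<noteq> 0"
proof
  assume "N x u = 0"
  with assms have "u - theta_zero y \<in> Lat" "u - theta_zero x \<in> Lat" by (simp_all add: N_eq_0_iff)
  from Lat_diff[OF this] theta_zero_diff[OF xy] show False by simp
qed

text \<open>The default value 0 at poles matters: with it the sign rules \<open>f_\<omega>\<close>
  and \<open>f_\<omega>\<tau>\<close> hold at every point, as the definition of
  \<open>periods\<close> demands.\<close>

lemma f_pole: assumes "N y u = 0" shows "is_pole f u" "f u = 0"
proof -
  have cont: "isCont (N z) u" for z
    using holomorphic_on_imp_continuous_on[OF N_holomorphic[of z UNIV]] by (simp add: continuous_on_eq_continuous_at)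
  have "filterlim (N y) (at 0) (at u)"
    using cont[of y] assms eventually_N_nz[of y u] by (auto simp: filterlim_at isCont_def)
  hence R: "is_pole (\<lambda>u. C * N x u / N y u) u"
    by (rule is_pole_divide[rotated]) (use C_nz N_x_nz[OF assms] cont in auto)
  thus "f u = 0" unfolding f_def by (rule remove_sings_at_pole)
  have "eventually (\<lambda>u. C * N x u / N y u = f u) (at u)"
    using eventually_N_nz[of y u] by eventually_elim (simp add: f_eq)
  from is_pole_transform[OF R this refl] show "is_pole f u" .
qed

lemma f_pole_iff: "is_pole f u \<longleftrightarrow> u - theta_zero y \<in> Lat"
proof
  assume pole: "is_pole f u"
  show "u - theta_zero y \<in> Lat"
  proof (rule ccontr)
    assume "u - theta_zero y \<notin> Lat"
    hence u: "u \<in> {u. N y u \<noteq> 0}" by (simp add: N_eq_0_iff)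
    have "f holomorphic_on {u. N y u \<noteq> 0}"
      by (rule holomorphic_transform[OF ratio_holomorphic]) (simp add: f_eq)
    from not_is_pole_holomorphic[OF open_N_nz u this] pole show False by contradiction
  qed
qed (use f_pole in \<open>simp add: N_eq_0_iff\<close>)

definition e1 :: complex where "e1 = sgn1 x * sgn1 y"
definition e2 :: complex where "e2 = sgn2 x * sgn2 y"

lemma f_\<omega>: "f (u + \<omega>) = e1 * f u"
proof (cases "N y u = 0")
  case True
  thus ?thesis using f_pole(2)[of u] f_pole(2)[of "u + \<omega>"] by (simp add: N_\<omega>)
next
  case False
  hence nz: "N y (u + \<omega>) \<noteq> 0" by (simp add: N_\<omega>)
  have sgn: "sgn1 x / sgn1 y = sgn1 x * sgn1 y" by (cases y) simp_all
  have "f (u + \<omega>) = (sgn1 x / sgn1 y) * (C * N x u / N y u)"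
    unfolding f_eq[OF nz] N_\<omega> by (simp add: mult_ac)
  thus ?thesis using sgn f_eq[OF False] by (simp only: e1_def)
qed

lemma f_\<omega>\<tau>: "f (u + \<omega> * \<tau>) = e2 * f u"
proof (cases "N y u = 0")
  case True
  thus ?thesis using f_pole(2)[of u] f_pole(2)[of "u + \<omega> * \<tau>"] by (simp add: N_\<omega>\<tau>)
next
  case False
  hence nz: "N y (u + \<omega> * \<tau>) \<noteq> 0" by (simp add: N_\<omega>\<tau>)
  have sgn: "sgn2 x / sgn2 y = sgn2 x * sgn2 y" by (cases y) simp_all
  have "f (u + \<omega> * \<tau>) = (sgn2 x / sgn2 y) * (C * N x u / N y u)"
    unfolding f_eq[OF nz] N_\<omega>\<tau> by (simp add: mult_ac)
  thus ?thesis using sgn f_eq[OF False] by (simp only: e2_def)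
qed

lemma e_nz: "e1 \<noteq> 0" "e2 \<noteq> 0" by (simp_all add: e1_def e2_def)

lemma shift_int:
  assumes "\<And>u. f (u + w) = e * f u" "e \<noteq> 0" shows "f (u + of_int m * w) = e powi m * f u"
proof -
  have nat: "f (u + of_nat n * w) = e ^ n * f u" for n u
  proof (induction n)
    case (Suc n)
    have "f (u + of_nat (Suc n) * w) = f (u + of_nat n * w + w)" by (simp add: algebra_simps)
    thus ?case using Suc assms(1) by simp
  qed simp
  show ?thesis
  proof (cases m rule: int_cases2)
    case (nonneg n)
    thus ?thesis using nat by simp
  next
    case (nonpos n)
    thus ?thesis using nat[of "u - of_nat n * w" n] assms(2) by (simp add: power_int_minus field_simps)
  qed
qed

text \<open>A period permutes the poles, which form a single class modulo \<open>Lat\<close>, so it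
  lies in \<open>Lat\<close>. Its total sign is then tested at a point where \<open>f\<close> is
  nonzero.\<close>

lemma periods_f: "periods f = {of_int m * \<omega> + of_int n * (\<omega> * \<tau>) | m n. e1 powi m * e2 powi n = 1}"
proof -
  have shift: "f (u + (of_int m * \<omega> + of_int n * (\<omega> * \<tau>))) = e1 powi m * e2 powi n * f u" for u m n
    using shift_int[OF f_\<omega> e_nz(1), of "u + of_int n * (\<omega> * \<tau>)" m] shift_int[OF f_\<omega>\<tau> e_nz(2), of u n]
    by (simp add: algebra_simps)
  obtain a where a: "f a \<noteq> 0"
  proof -
    from eventually_happens'[OF at_neq_bot eventually_conj[OF eventually_N_nz[of x 0] eventually_N_nz[of y 0]]]
    obtain a where "N x a \<noteq> 0" "N y a \<noteq> 0" by blast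
    thus ?thesis using that[of a] C_nz by (simp add: f_eq)
  qed
  show ?thesis
  proof (intro equalityI subsetI)
    fix w assume "w \<in> periods f"
    hence w: "f (u + w) = f u" for u by (simp add: periods_def)
    have "(\<lambda>u. f (w + u)) = f" using w by (simp add: add.commute)
    moreover have "is_pole f (theta_zero y)" by (simp add: f_pole_iff)
    ultimately have "is_pole (\<lambda>u. f (w + u)) (theta_zero y)" by simp
    hence "is_pole f (theta_zero y + w)" using is_pole_shift_iff[of f w "theta_zero y"] by (simp add: o_def)
    hence "w \<in> Lat" by (simp add: f_pole_iff)
    then obtain m n where mn: "w = of_int m * \<omega> + of_int n * (\<omega> * \<tau>)" unfolding Lat_def by auto
    have "f (a + w) = e1 powi m * e2 powi n * f a" unfolding mn by (rule shift)
    hence "e1 powi m * e2 powi n = 1" using w[of a] a by simp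
    thus "w \<in> {of_int m * \<omega> + of_int n * (\<omega> * \<tau>) | m n. e1 powi m * e2 powi n = 1}" using mn by blast
  next
    fix w assume "w \<in> {of_int m * \<omega> + of_int n * (\<omega> * \<tau>) | m n. e1 powi m * e2 powi n = 1}"
    thus "w \<in> periods f" using shift by (auto simp: periods_def)
  qed
qed

text \<open>As \<open>x\<close> and \<open>y\<close> differ, \<open>e1\<close> and \<open>e2\<close>
  are not both 1. The three remaining sign patterns are those of sn, dn and cn, in this order, and
  each cuts out a sublattice of index 2.\<close>

lemma periods_lattice:
  obtains \<omega>1 \<omega>2 where "lattice2 \<omega>1 \<omega>2" "periods f = lattice2.Lat \<omega>1 \<omega>2"
proof -
  have Im2: "Im (\<tau> / 2) > 0" "Im (2 * \<tau>) > 0" "Im ((1 + \<tau>) / 2) > 0" using Im_\<tau> by simp_all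
  have "e1 = -1 \<and> e2 = 1 \<or> e1 = 1 \<and> e2 = -1 \<or> e1 = -1 \<and> e2 = -1"
    unfolding e1_def e2_def using xy by (cases x; cases y) auto
  then consider "e1 = -1" "e2 = 1" | "e1 = 1" "e2 = -1" | "e1 = -1" "e2 = -1" by blast
  thus ?thesis
  proof cases
    case 1
    have "\<omega> * \<tau> / (2 * \<omega>) = \<tau> / 2" using \<omega>_nz by simp
    hence L: "lattice2 (2 * \<omega>) (\<omega> * \<tau>)" using Im2 by unfold_locales (simp only:)
    have "periods f = lattice2.Lat (2 * \<omega>) (\<omega> * \<tau>)"
      unfolding periods_f lattice2.Lat_def[OF L] 1 power_int_1_left mult_1_right minus_one_powi
    proof (intro equalityI subsetI)
      fix w assume "w \<in> {of_int m * \<omega> + of_int n * (\<omega> * \<tau>) | m n. even m}"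
      then obtain m n where "w = of_int m * \<omega> + of_int n * (\<omega> * \<tau>)" "even m" by blast
      moreover from \<open>even m\<close> obtain i where "m = 2 * i" by blast
      ultimately have "w = of_int i * (2 * \<omega>) + of_int n * (\<omega> * \<tau>)" by simp
      thus "w \<in> {of_int m * (2 * \<omega>) + of_int n * (\<omega> * \<tau>) | m n. True}" by blast
    next
      fix w assume "w \<in> {of_int m * (2 * \<omega>) + of_int n * (\<omega> * \<tau>) | m n. True}"
      then obtain m n where "w = of_int m * (2 * \<omega>) + of_int n * (\<omega> * \<tau>)" by blast
      hence "w = of_int (2 * m) * \<omega> + of_int n * (\<omega> * \<tau>)" by simp
      moreover have "even (2 * m)" by simp
      ultimately show "w \<in> {of_int m * \<omega> + of_int n * (\<omega> * \<tau>) | m n. even m}" by blast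
    qed
    thus ?thesis using L that by blast
  next
    case 2
    have "2 * (\<omega> * \<tau>) / \<omega> = 2 * \<tau>" using \<omega>_nz by simp
    hence L: "lattice2 \<omega> (2 * (\<omega> * \<tau>))" using Im2 by unfold_locales (simp only:)
    have "periods f = lattice2.Lat \<omega> (2 * (\<omega> * \<tau>))"
      unfolding periods_f lattice2.Lat_def[OF L] 2 power_int_1_left mult_1_left minus_one_powi
    proof (intro equalityI subsetI)
      fix w assume "w \<in> {of_int m * \<omega> + of_int n * (\<omega> * \<tau>) | m n. even n}"
      then obtain m n where "w = of_int m * \<omega> + of_int n * (\<omega> * \<tau>)" "even n" by blast
      moreover from \<open>even n\<close> obtain i where "n = 2 * i" by blast
      ultimately have "w = of_int m * \<omega> + of_int i * (2 * (\<omega> * \<tau>))" by simp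
      thus "w \<in> {of_int m * \<omega> + of_int n * (2 * (\<omega> * \<tau>)) | m n. True}" by blast
    next
      fix w assume "w \<in> {of_int m * \<omega> + of_int n * (2 * (\<omega> * \<tau>)) | m n. True}"
      then obtain m n where "w = of_int m * \<omega> + of_int n * (2 * (\<omega> * \<tau>))" by blast
      hence "w = of_int m * \<omega> + of_int (2 * n) * (\<omega> * \<tau>)" by simp
      moreover have "even (2 * n)" by simp
      ultimately show "w \<in> {of_int m * \<omega> + of_int n * (\<omega> * \<tau>) | m n. even n}" by blast
    qed
    thus ?thesis using L that by blast
  next
    case 3
    have "(\<omega> + \<omega> * \<tau>) / (2 * \<omega>) = (1 + \<tau>) / 2" using \<omega>_nz by (simp add: field_simps)
    hence L: "lattice2 (2 * \<omega>) (\<omega> + \<omega> * \<tau>)" using Im2 by unfold_locales (simp only:)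
    have "periods f = lattice2.Lat (2 * \<omega>) (\<omega> + \<omega> * \<tau>)"
      unfolding periods_f lattice2.Lat_def[OF L] 3 minus_one_powi2
    proof (intro equalityI subsetI)
      fix w assume "w \<in> {of_int m * \<omega> + of_int n * (\<omega> * \<tau>) | m n. even (m + n)}"
      then obtain m n where "w = of_int m * \<omega> + of_int n * (\<omega> * \<tau>)" "even (m + n)" by blast
      moreover from \<open>even (m + n)\<close> obtain i where "m + n = 2 * i" by blast
      hence "m = 2 * (i - n) + n" by simp
      ultimately have "w = of_int (i - n) * (2 * \<omega>) + of_int n * (\<omega> + \<omega> * \<tau>)" by (simp add: algebra_simps)
      thus "w \<in> {of_int m * (2 * \<omega>) + of_int n * (\<omega> + \<omega> * \<tau>) | m n. True}" by blast
    next
      fix w assume "w \<in> {of_int m * (2 * \<omega>) + of_int n * (\<omega> + \<omega> * \<tau>) | m n. True}"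
      then obtain m n where "w = of_int m * (2 * \<omega>) + of_int n * (\<omega> + \<omega> * \<tau>)" by blast
      hence "w = of_int (2 * m + n) * \<omega> + of_int n * (\<omega> * \<tau>)" by (simp add: algebra_simps)
      moreover have "even (2 * m + n + n)" by simp
      ultimately show "w \<in> {of_int m * \<omega> + of_int n * (\<omega> * \<tau>) | m n. even (m + n)}" by blast
    qed
    thus ?thesis using L that by blast
  qed
qed

text \<open>The single class of poles modulo \<open>Lat\<close> is the union of the classes of
  \<open>p1\<close> and \<open>p2\<close> modulo the periods. Hence the product of sigmas for the
  period lattice is divisible by \<open>\<sigma> (u - theta_zero y)\<close>, and the cofactor
  \<open>H\<close> supplies the numerator required by \<open>ex_X\<close>.\<close>

lemma ex_elliptic_order2:
  assumes "S \<in> pole_sums f"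
  obtains \<omega>1 \<omega>2 p1 p2 where "elliptic_order2 \<omega>1 \<omega>2 f p1 p2" "S = p1 + p2"
proof -
  obtain p1 p2 where S: "S = p1 + p2" and p: "is_pole f p1" "is_pole f p2" "p1 - p2 \<notin> periods f"
    and all: "\<And>p. is_pole f p \<Longrightarrow> p - p1 \<in> periods f \<or> p - p2 \<in> periods f"
    using assms unfolding pole_sums_def by blast
  obtain \<omega>1 \<omega>2 where L: "lattice2 \<omega>1 \<omega>2" and per: "periods f = lattice2.Lat \<omega>1 \<omega>2"
    by (rule periods_lattice)
  interpret L: lattice2 \<omega>1 \<omega>2 by fact
  have "periods f \<subseteq> Lat" unfolding periods_f Lat_def by blast
  hence pole: "is_pole f u \<longleftrightarrow> u - p1 \<in> periods f \<or> u - p2 \<in> periods f" for u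
    using all[of u] p Lat_add[of "u - p1" "p1 - theta_zero y"] Lat_add[of "u - p2" "p2 - theta_zero y"] by (auto simp: f_pole_iff)
  let ?M = "\<lambda>u. L.\<sigma> (u - p1) * L.\<sigma> (u - p2)"
  have hol: "?M holomorphic_on UNIV" by (intro holomorphic_intros)
  obtain H where H: "H holomorphic_on UNIV" "\<And>u. ?M u = \<sigma> (u - theta_zero y) * H u"
  proof (rule entire_divide[OF hol, of "\<lambda>u. \<sigma> (u - theta_zero y)"])
    fix u assume "\<sigma> (u - theta_zero y) = 0"
    moreover from this have "is_pole f u" by (simp add: f_pole_iff \<sigma>_eq_0_iff)
    ultimately show "?M u = 0 \<and> deriv (\<lambda>u. \<sigma> (u - theta_zero y)) u \<noteq> 0"
      using deriv_\<sigma>_nz pole per by (auto simp: L.\<sigma>_eq_0_iff)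
  qed (auto intro!: holomorphic_intros)
  have "elliptic_order2 \<omega>1 \<omega>2 f p1 p2"
  proof unfold_locales
    show "p1 - p2 \<notin> L.Lat" using p per by simp
    have "\<omega>1 \<in> periods f" "\<omega>2 \<in> periods f" using per by simp_all
    thus "f (u + \<omega>1) = f u" "f (u + \<omega>2) = f u" for u by (simp_all add: periods_def)
    show "is_pole f u \<longleftrightarrow> u - p1 \<in> L.Lat \<or> u - p2 \<in> L.Lat" for u using pole per by simp
    have "(\<lambda>u. C * N x u * exp (- theta_exponent y * u) * H u) holomorphic_on UNIV"
      by (intro holomorphic_intros N_holomorphic H)
    moreover have "f u = C * N x u * exp (- theta_exponent y * u) * H u / ?M u" if "?M u \<noteq> 0" for u
    proof -
      have "\<sigma> (u - theta_zero y) \<noteq> 0" "H u \<noteq> 0" using that H(2)[of u] by auto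
      moreover from this have "f u = C * N x u / N y u" by (intro f_eq) (simp add: N_def)
      ultimately show ?thesis unfolding H(2) by (simp add: N_def exp_minus field_simps)
    qed
    ultimately show "\<exists>X. X holomorphic_on UNIV \<and> (\<forall>u. ?M u \<noteq> 0 \<longrightarrow> f u = X u / ?M u)" by blast
  qed
  thus ?thesis using S that by blast
qed

end

theorem jacobi_elliptic_order2:
  assumes \<tau>: "Im \<tau> > 0" and "p \<noteq> q" and S: "S \<in> pole_sums (jacobi \<tau> p q)"
  obtains \<omega>1 \<omega>2 p1 p2 where "elliptic_order2 \<omega>1 \<omega>2 (jacobi \<tau> p q) p1 p2" "S = p1 + p2"
proof -
  obtain u0 where pole: "is_pole (jacobi \<tau> p q) u0" using S unfolding pole_sums_def by blast
  have "quarter_K \<tau> \<noteq> 0"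
  proof
    assume "quarter_K \<tau> = 0"
    hence "over_n \<tau> x u = over_n \<tau> x 0" for x u by (cases x) (simp_all add: sn_def cn_def dn_def)
    from no_pole_if_constant[OF this] pole show False by blast
  qed
  then interpret theta_lat "2 * quarter_K \<tau>" \<tau> using \<tau> by unfold_locales simp_all
  obtain C where C: "C \<noteq> 0" "jacobi \<tau> p q = remove_sings (\<lambda>u. C * N p u / N q u)"
    using jacobi_ratio[OF refl pole] by blast
  interpret jacobi_ratio "2 * quarter_K \<tau>" \<tau> p q C "jacobi \<tau> p q"
    by unfold_locales (use C \<open>p \<noteq> q\<close> in auto)
  show ?thesis using ex_elliptic_order2[OF S] that by blast
qed

section \<open>The linear system\<close>

definition unknowns :: "nat \<Rightarrow> (nat \<Rightarrow> complex) \<times> (nat \<Rightarrow> complex) \<Rightarrow> complex vec" where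
  "unknowns n lk = vec (2 * n - 1) (\<lambda>j. if j < n then fst lk (j + 1) else snd lk (j - n + 1))"

lemma system_mat_mult_unknowns:
  assumes n: "n \<ge> 1" and i: "i < 2 * n - 1"
  shows "(system_mat f n z *\<^sub>v unknowns n lk) $ i = lincomb f n (fst lk) (snd lk) (z (i + 1))"
proof -
  let ?u = "z (i + 1)"
  let ?g = "\<lambda>j. (if j < n then f ?u ^ (j + 1) else (deriv ^^ (j - n + 1)) f ?u)
      * (if j < n then fst lk (j + 1) else snd lk (j - n + 1))"
  have "(system_mat f n z *\<^sub>v unknowns n lk) $ i = (\<Sum>j=0..<2*n-1. ?g j)"
    using i by (simp add: system_mat_def unknowns_def scalar_prod_def)
  also have "\<dots> = (\<Sum>j=0..<n. ?g j) + (\<Sum>j=n..<2*n-1. ?g j)"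
    using n by (intro sum.atLeastLessThan_concat[symmetric]) auto
  also have "(\<Sum>j=0..<n. ?g j) = (\<Sum>j=1..n. fst lk j * f ?u ^ j)"
    by (rule sum.reindex_bij_witness[of _ "\<lambda>j. j - 1" "\<lambda>j. j + 1"]) auto
  also have "(\<Sum>j=n..<2*n-1. ?g j) = (\<Sum>j=1..n-1. snd lk j * (deriv ^^ j) f ?u)"
    by (rule sum.reindex_bij_witness[of _ "\<lambda>j. n + j - 1" "\<lambda>j. j - n + 1"]) auto
  finally show ?thesis by (simp add: lincomb_def)
qed

lemma solves_system_iff:
  assumes n: "n \<ge> 1"
  shows "solves_system f n z (fst lk) (snd lk)
    \<longleftrightarrow> system_mat f n z *\<^sub>v unknowns n lk = vec (2 * n - 1) (\<lambda>_. 1)"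
proof
  assume s: "solves_system f n z (fst lk) (snd lk)"
  show "system_mat f n z *\<^sub>v unknowns n lk = vec (2 * n - 1) (\<lambda>_. 1)"
  proof (rule eq_vecI)
    fix i assume "i < dim_vec (vec (2 * n - 1) (\<lambda>_. 1 :: complex))"
    hence i: "i < 2 * n - 1" by simp
    hence "i + 1 \<in> {1..2*n-1}" by auto
    hence "lincomb f n (fst lk) (snd lk) (z (i + 1)) = 1"
      using s unfolding solves_system_def by metis
    thus "(system_mat f n z *\<^sub>v unknowns n lk) $ i = vec (2 * n - 1) (\<lambda>_. 1) $ i"
      using system_mat_mult_unknowns[OF n i] i by simp
  qed (simp add: system_mat_def)
next
  assume e: "system_mat f n z *\<^sub>v unknowns n lk = vec (2 * n - 1) (\<lambda>_. 1)"
  show "solves_system f n z (fst lk) (snd lk)"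
    unfolding solves_system_def
  proof
    fix h assume "h \<in> {1..2*n-1}"
    hence h: "h - 1 < 2 * n - 1" "h - 1 + 1 = h" by auto
    show "1 = lincomb f n (fst lk) (snd lk) (z h)"
      using system_mat_mult_unknowns[OF n h(1), of f z lk] h unfolding e by simp
  qed
qed

text \<open>The vector of unknowns determines \<open>l\<close> and \<open>k\<close> only on their
  index ranges, so \<open>extensional\<close> is what makes uniqueness meaningful.\<close>

lemma det_nonzero_imp_unique_solution:
  assumes n: "n \<ge> 1" and det: "det (system_mat f n z) \<noteq> 0"
  shows "\<exists>!lk. lk \<in> extensional {1..n} \<times> extensional {1..n-1} \<and> solves_system f n z (fst lk) (snd lk)"
proof -
  let ?m = "2 * n - 1" and ?A = "system_mat f n z" and ?o = "vec (2 * n - 1) (\<lambda>_. 1 :: complex)"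
  have A: "?A \<in> carrier_mat ?m ?m" by (simp add: system_mat_def)
  obtain B where B: "B \<in> carrier_mat ?m ?m" "B * ?A = 1\<^sub>m ?m" "?A * B = 1\<^sub>m ?m"
    using det_non_zero_imp_unit[OF A det, of undefined] by (auto simp: Units_def ring_mat_def)
  define x where "x = B *\<^sub>v ?o"
  have x: "x \<in> carrier_vec ?m" using B by (simp add: x_def)
  have "?A *\<^sub>v x = (?A * B) *\<^sub>v ?o"
    unfolding x_def by (rule assoc_mult_mat_vec[symmetric, OF A B(1)]) simp
  hence Ax: "?A *\<^sub>v x = ?o" by (simp add: B(3))
  have sol: "solves_system f n z (fst lk) (snd lk) \<longleftrightarrow> unknowns n lk = x" for lk
  proof -
    have u: "unknowns n lk \<in> carrier_vec ?m" by (simp add: unknowns_def)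
    have "unknowns n lk = x" if "?A *\<^sub>v unknowns n lk = ?o"
    proof -
      have "unknowns n lk = (B * ?A) *\<^sub>v unknowns n lk" using u by (simp add: B(2))
      also have "\<dots> = B *\<^sub>v (?A *\<^sub>v unknowns n lk)" by (rule assoc_mult_mat_vec[OF B(1) A u])
      finally show ?thesis using that by (simp add: x_def)
    qed
    thus ?thesis using Ax solves_system_iff[OF n] by metis
  qed
  \<comment> \<open>Vector indices start at 0: entry j - 1 holds the j-th lambda and entry n + j - 1
    the j-th kappa.\<close>
  define lk0 where "lk0 = (restrict (\<lambda>j. x $ (j - 1)) {1..n}, restrict (\<lambda>j. x $ (n + j - 1)) {1..n-1})"
  show ?thesis
  proof (rule ex1I[of _ lk0])
    have "unknowns n lk0 = x"
      using x by (intro eq_vecI) (auto simp: unknowns_def lk0_def)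
    thus "lk0 \<in> extensional {1..n} \<times> extensional {1..n-1} \<and> solves_system f n z (fst lk0) (snd lk0)"
      by (simp add: sol) (simp add: lk0_def)
  next
    fix lk assume lk: "lk \<in> extensional {1..n} \<times> extensional {1..n-1} \<and> solves_system f n z (fst lk) (snd lk)"
    hence u: "unknowns n lk = x" by (simp add: sol)
    have "fst lk = fst lk0"
    proof (rule extensionalityI[of _ "{1..n}"])
      fix j assume j: "j \<in> {1..n}"
      hence "unknowns n lk $ (j - 1) = fst lk j" by (auto simp: unknowns_def)
      thus "fst lk j = fst lk0 j" using j by (simp add: u lk0_def)
    qed (use lk in \<open>auto simp: lk0_def\<close>)
    moreover have "snd lk = snd lk0"
    proof (rule extensionalityI[of _ "{1..n-1}"])
      fix j assume j: "j \<in> {1..n-1}"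
      hence "unknowns n lk $ (n + j - 1) = snd lk j" by (auto simp: unknowns_def)
      thus "snd lk j = snd lk0 j" using j by (simp add: u lk0_def)
    qed (use lk in \<open>auto simp: lk0_def\<close>)
    ultimately show "lk = lk0" by (rule prod_eqI)
  qed
qed

section \<open>Determinants of size 1 and 3\<close>

lemma det_system_mat_1: "det (system_mat f 1 z) = f (z 1)"
proof -
  have "system_mat f 1 z \<in> carrier_mat 1 1" by (simp add: system_mat_def)
  from det_single[OF this] show ?thesis by (simp add: system_mat_def)
qed

lemma det_mat_2: "det (mat 2 2 g) = g (0,0) * g (1,1) - g (0,1) * g (1,0)" for g :: "nat \<times> nat \<Rightarrow> complex"
proof -
  have d: "det (mat_delete (mat 2 2 g) 0 j) = g (1, 1 - j)" if "j < 2" for j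
  proof -
    have "mat_delete (mat 2 2 g) 0 j \<in> carrier_mat 1 1" by (simp add: mat_delete_def)
    from det_single[OF this] show ?thesis using that by (auto simp: mat_delete_def less_2_cases_iff)
  qed
  have "det (mat 2 2 g) = (\<Sum>j<2. mat 2 2 g $$ (0, j) * cofactor (mat 2 2 g) 0 j)"
    by (rule laplace_expansion_row) auto
  also have "\<dots> = g (0,0) * det (mat_delete (mat 2 2 g) 0 0) - g (0,1) * det (mat_delete (mat 2 2 g) 0 1)"
    by (simp add: cofactor_def numeral_2_eq_2)
  finally show ?thesis using d[of 0] d[of 1] by simp
qed

lemma det_mat_3: "det (mat 3 3 g) = g (0,0) * (g (1,1) * g (2,2) - g (1,2) * g (2,1))
    - g (0,1) * (g (1,0) * g (2,2) - g (1,2) * g (2,0)) + g (0,2) * (g (1,0) * g (2,1) - g (1,1) * g (2,0))"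
  for g :: "nat \<times> nat \<Rightarrow> complex"
proof -
  have d: "mat_delete (mat 3 3 g) 0 j = mat 2 2 (\<lambda>(i', j'). g (Suc i', if j' < j then j' else Suc j'))" if "j < 3" for j
    using that by (intro eq_matI) (auto simp: mat_delete_def)
  have "det (mat 3 3 g) = (\<Sum>j<3. mat 3 3 g $$ (0, j) * cofactor (mat 3 3 g) 0 j)"
    by (rule laplace_expansion_row) auto
  also have "\<dots> = g (0,0) * det (mat_delete (mat 3 3 g) 0 0) - g (0,1) * det (mat_delete (mat 3 3 g) 0 1)
      + g (0,2) * det (mat_delete (mat 3 3 g) 0 2)"
    by (simp add: cofactor_def numeral_3_eq_3 numeral_2_eq_2)
  also have "det (mat_delete (mat 3 3 g) 0 0) = g (1,1) * g (2,2) - g (1,2) * g (2,1)"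
    by (subst d, simp, simp only: det_mat_2, simp add: numeral_2_eq_2)
  also have "det (mat_delete (mat 3 3 g) 0 1) = g (1,0) * g (2,2) - g (1,2) * g (2,0)"
    by (subst d, simp, simp only: det_mat_2, simp add: numeral_2_eq_2)
  also have "det (mat_delete (mat 3 3 g) 0 2) = g (1,0) * g (2,1) - g (1,1) * g (2,0)"
    by (subst d, simp, simp only: det_mat_2, simp add: numeral_2_eq_2)
  finally show ?thesis .
qed

lemma det_system_mat_2:
  "det (system_mat f 2 z) =
     f (z 1) * (f (z 2) ^ 2 * deriv f (z 3) - deriv f (z 2) * f (z 3) ^ 2)
   - f (z 1) ^ 2 * (f (z 2) * deriv f (z 3) - deriv f (z 2) * f (z 3))
   + deriv f (z 1) * (f (z 2) * f (z 3) ^ 2 - f (z 2) ^ 2 * f (z 3))"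
proof -
  have eq: "system_mat f 2 z = mat 3 3 (\<lambda>(i, j). if j < 2 then f (z (i + 1)) ^ (j + 1) else (deriv ^^ (j - 2 + 1)) f (z (i + 1)))"
    by (simp add: system_mat_def)
  show ?thesis unfolding eq det_mat_3 by (simp add: numeral_3_eq_3 numeral_2_eq_2)
qed

section \<open>Generic nonvanishing of the determinant\<close>

context elliptic_order2
begin

lemma eventually_pick:
  assumes "eventually P (at a)" "\<epsilon> > 0"
  obtains b :: complex where "dist b a < \<epsilon>" "P b" "M b \<noteq> 0"
proof -
  have "eventually (\<lambda>b. dist b a < \<epsilon>) (at a)" using assms(2) by (auto simp: eventually_at)
  from eventually_happens'[OF at_neq_bot eventually_conj[OF eventually_conj[OF this assms(1)] eventually_M_nz[of a]]]
  show ?thesis using that by blast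
qed

lemma eventually_f_neq: "eventually (\<lambda>u. f u \<noteq> k) (at a)"
proof -
  obtain u where "M u \<noteq> 0" "f u \<noteq> k" using f_nonconst .
  hence "X u - k * M u \<noteq> 0" using X(2)[of u] by (auto simp: field_simps)
  hence "eventually (\<lambda>u. X u - k * M u \<noteq> 0) (at a)"
    by (rule eventually_entire_nz[rotated]) (intro holomorphic_intros X M_holomorphic)
  with eventually_M_nz[of a] show ?thesis by eventually_elim (use X(2) in auto)
qed

text \<open>At \<open>p1\<close> the numerator X' M - X M' of the derivative reduces to - X M', and
  M' is nonzero there because \<open>p1\<close> is a simple zero of \<open>M\<close>.\<close>

lemma deriv_f_nonzero: obtains u where "M u \<noteq> 0" "deriv f u \<noteq> 0"
proof -
  have d: "((\<lambda>u. \<sigma> (u - z)) has_field_derivative deriv (\<lambda>u. \<sigma> (u - z)) u) (at u)" for u z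
    by (rule holomorphic_derivI[of _ UNIV]) (auto intro!: holomorphic_intros)
  have "(M has_field_derivative deriv (\<lambda>u. \<sigma> (u - p1)) p1 * \<sigma> (p1 - p2)) (at p1)"
    unfolding M_def[abs_def] by (rule DERIV_cong[OF DERIV_mult[OF d d]]) simp
  hence "deriv M p1 = deriv (\<lambda>u. \<sigma> (u - p1)) p1 * \<sigma> (p1 - p2)" by (rule DERIV_imp_deriv)
  hence "deriv M p1 \<noteq> 0" using deriv_\<sigma>_nz[of p1 p1] p12 by (simp add: \<sigma>_eq_0_iff)
  hence "Xd 1 p1 \<noteq> 0" using X_p1 by simp
  hence "eventually (\<lambda>u. Xd 1 u \<noteq> 0) (at p1)" by (rule eventually_entire_nz[OF Xd_holomorphic])
  then obtain u where "Xd 1 u \<noteq> 0" "M u \<noteq> 0" using eventually_pick[of _ p1 1] by auto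
  thus ?thesis using that[of u] higher_deriv_f[of u 1] by simp
qed

text \<open>Reflection changes the sign of the derivative and fixes the other two summands.\<close>

lemma eventually_combination_nz:
  assumes "c1 \<noteq> 0"
  shows "eventually (\<lambda>u. c1 * deriv f u + c2 * f u + c3 * f u ^ 2 \<noteq> 0) (at a)"
proof -
  let ?g = "\<lambda>u. c1 * deriv f u + c2 * f u + c3 * f u ^ 2"
  define F where "F = (\<lambda>u. c1 * Xd 1 u + c2 * X u * M u + c3 * X u ^ 2)"
  have F: "F u = ?g u * M u ^ 2" if "M u \<noteq> 0" for u
  proof -
    have "X u = f u * M u" "Xd 1 u = deriv f u * M u ^ 2"
      using X(2)[OF that] higher_deriv_f[OF that, of 1] that by (simp_all add: power2_eq_square)
    thus ?thesis unfolding F_def by (simp only:) (simp add: power2_eq_square algebra_simps)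
  qed
  obtain v where v: "M v \<noteq> 0" "deriv f v \<noteq> 0" by (rule deriv_f_nonzero)
  have Mv: "M (S - v) \<noteq> 0" using v(1) by (simp add: M_reflect)
  have diff: "?g v - ?g (S - v) = 2 * c1 * deriv f v"
    using higher_deriv_reflect[OF v(1), of 1] f_reflect[OF v(1)] by simp
  have "?g v - ?g (S - v) \<noteq> 0" unfolding diff using assms v(2) by simp
  hence "?g v \<noteq> 0 \<or> ?g (S - v) \<noteq> 0" by (metis diff_self)
  hence "F v \<noteq> 0 \<or> F (S - v) \<noteq> 0" using F[OF v(1)] F[OF Mv] v(1) Mv by auto
  moreover have "F holomorphic_on UNIV" unfolding F_def
    by (intro holomorphic_intros X M_holomorphic Xd_holomorphic)
  ultimately have "eventually (\<lambda>u. F u \<noteq> 0) (at a)" using eventually_entire_nz by blast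
  with eventually_M_nz[of a] show ?thesis by eventually_elim (use F in auto)
qed

lemma isCont_f: "M u \<noteq> 0 \<Longrightarrow> isCont f u"
  using higher_deriv_f_has_deriv[of u 0] DERIV_isCont by force

lemma isCont_deriv_f: "M u \<noteq> 0 \<Longrightarrow> isCont (deriv f) u"
  using higher_deriv_f_has_deriv[of u 1] DERIV_isCont by force

lemma eventually_not_pole: "M b \<noteq> 0 \<Longrightarrow> eventually (\<lambda>u. \<not> is_pole f u) (nhds b)"
  using eventually_nhds_in_open[OF open_M_nz, of b] by (simp add: M_eq_0_iff)

lemma generically_det_1:
  "generically 1 (\<lambda>z. (\<forall>h\<in>{1..1}. \<not> is_pole f (z h)) \<and> det (system_mat f 1 z) \<noteq> 0)"
  unfolding generically_def
proof (intro allI impI)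
  fix a :: "nat \<Rightarrow> complex" and \<epsilon> :: real assume \<epsilon>: "\<epsilon> > 0"
  obtain b where b: "dist b (a 1) < \<epsilon>" "f b \<noteq> 0" "M b \<noteq> 0"
    using eventually_pick[OF eventually_f_neq \<epsilon>] by blast
  have "eventually (\<lambda>u. dist u (a 1) < \<epsilon> \<and> f u \<noteq> 0 \<and> \<not> is_pole f u) (nhds b)"
  proof (intro eventually_conj eventually_not_pole b)
    have "eventually (\<lambda>u. u \<in> ball (a 1) \<epsilon>) (nhds b)"
      by (rule eventually_nhds_in_open) (use b in \<open>auto simp: dist_commute\<close>)
    thus "eventually (\<lambda>u. dist u (a 1) < \<epsilon>) (nhds b)" by (simp add: dist_commute)
    show "eventually (\<lambda>u. f u \<noteq> 0) (nhds b)"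
      using isCont_tendsto_compose[OF isCont_f[OF b(3)] filterlim_ident] b(2)
      by (rule tendsto_imp_eventually_ne)
  qed
  then obtain d where d: "d > 0" "\<And>u. dist u b < d \<Longrightarrow> dist u (a 1) < \<epsilon> \<and> f u \<noteq> 0 \<and> \<not> is_pole f u"
    by (auto simp: eventually_nhds_metric)
  show "\<exists>b. \<exists>\<delta>>0. \<forall>z. (\<forall>h\<in>{1..1}. dist (z h) (b h) < \<delta>) \<longrightarrow> (\<forall>h\<in>{1..1}. dist (z h) (a h) < \<epsilon>)
      \<and> (\<forall>h\<in>{1..1}. \<not> is_pole f (z h)) \<and> det (system_mat f 1 z) \<noteq> 0"
    using d by (intro exI[of _ "\<lambda>_. b"] exI[of _ d]) (simp add: det_system_mat_1[unfolded One_nat_def])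
qed

text \<open>Three points are chosen in succession, each avoiding isolated bad points. Continuity of
  the determinant at the chosen triple then gives a whole box.\<close>

lemma generically_det_2:
  "generically 3 (\<lambda>z. (\<forall>h\<in>{1..3}. \<not> is_pole f (z h)) \<and> det (system_mat f 2 z) \<noteq> 0)"
  unfolding generically_def
proof (intro allI impI)
  fix a :: "nat \<Rightarrow> complex" and \<epsilon> :: real assume \<epsilon>: "\<epsilon> > 0"
  let ?D = "\<lambda>u v w. f u * (f v ^ 2 * deriv f w - deriv f v * f w ^ 2)
   - f u ^ 2 * (f v * deriv f w - deriv f v * f w) + deriv f u * (f v * f w ^ 2 - f v ^ 2 * f w)"
  obtain b1 where b1: "dist b1 (a 1) < \<epsilon>" "f b1 \<noteq> 0" "M b1 \<noteq> 0"
    using eventually_pick[OF eventually_f_neq \<epsilon>] by blast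
  obtain b2 where b2: "dist b2 (a 2) < \<epsilon>" "f b2 \<noteq> 0 \<and> f b2 \<noteq> f b1" "M b2 \<noteq> 0"
    using eventually_pick[OF eventually_conj[OF eventually_f_neq eventually_f_neq] \<epsilon>] by blast
  \<comment> \<open>The cofactors of the third row: as a function of the third point, the
    determinant is c1 f' + c2 f + c3 f^2.\<close>
  define c1 where "c1 = f b1 * f b2 ^ 2 - f b1 ^ 2 * f b2"
  define c2 where "c2 = f b1 ^ 2 * deriv f b2 - deriv f b1 * f b2 ^ 2"
  define c3 where "c3 = deriv f b1 * f b2 - f b1 * deriv f b2"
  have "c1 = f b1 * f b2 * (f b2 - f b1)" by (simp add: c1_def power2_eq_square algebra_simps)
  hence "c1 \<noteq> 0" using b1 b2 by simp
  from eventually_pick[OF eventually_combination_nz[OF this] \<epsilon>]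
  obtain b3 where b3: "dist b3 (a 3) < \<epsilon>" "c1 * deriv f b3 + c2 * f b3 + c3 * f b3 ^ 2 \<noteq> 0" "M b3 \<noteq> 0"
    by blast
  have D: "?D b1 b2 b3 \<noteq> 0"
    using b3(2) by (simp add: c1_def c2_def c3_def algebra_simps)
  let ?N = "nhds (b1, b2, b3)"
  have t: "(fst \<longlongrightarrow> b1) ?N" "((\<lambda>x. fst (snd x)) \<longlongrightarrow> b2) ?N" "((\<lambda>x. snd (snd x)) \<longlongrightarrow> b3) ?N"
    by (auto intro!: tendsto_eq_intros filterlim_ident)
  note f = isCont_tendsto_compose[OF isCont_f] isCont_tendsto_compose[OF isCont_deriv_f]
  have "((\<lambda>x. ?D (fst x) (fst (snd x)) (snd (snd x))) \<longlongrightarrow> ?D b1 b2 b3) ?N"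
    by (intro tendsto_intros f t b1 b2 b3)
  hence 1: "eventually (\<lambda>x. ?D (fst x) (fst (snd x)) (snd (snd x)) \<noteq> 0) ?N"
    using D by (rule tendsto_imp_eventually_ne)
  have box: "eventually (\<lambda>u. dist u c < \<epsilon> \<and> \<not> is_pole f u) (nhds b)" if "dist b c < \<epsilon>" "M b \<noteq> 0" for b c
  proof (intro eventually_conj eventually_not_pole that)
    have "eventually (\<lambda>u. u \<in> ball c \<epsilon>) (nhds b)"
      by (rule eventually_nhds_in_open) (use that in \<open>auto simp: dist_commute\<close>)
    thus "eventually (\<lambda>u. dist u c < \<epsilon>) (nhds b)" by (simp add: dist_commute)
  qed
  have "eventually (\<lambda>x. ?D (fst x) (fst (snd x)) (snd (snd x)) \<noteq> 0
      \<and> (dist (fst x) (a 1) < \<epsilon> \<and> \<not> is_pole f (fst x))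
      \<and> (dist (fst (snd x)) (a 2) < \<epsilon> \<and> \<not> is_pole f (fst (snd x)))
      \<and> (dist (snd (snd x)) (a 3) < \<epsilon> \<and> \<not> is_pole f (snd (snd x)))) ?N"
    by (intro eventually_conj 1 eventually_compose_filterlim[OF box t(1)]
        eventually_compose_filterlim[OF box t(2)] eventually_compose_filterlim[OF box t(3)] b1 b2 b3)
  then obtain d where d: "d > 0" "\<And>u v w. dist (u, v, w) (b1, b2, b3) < d \<Longrightarrow> ?D u v w \<noteq> 0
      \<and> (dist u (a 1) < \<epsilon> \<and> \<not> is_pole f u) \<and> (dist v (a 2) < \<epsilon> \<and> \<not> is_pole f v)
      \<and> (dist w (a 3) < \<epsilon> \<and> \<not> is_pole f w)"
    unfolding eventually_nhds_metric by auto
  \<comment> \<open>The product distance is at most the sum of the three coordinate distances, hence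
    the radius d/3.\<close>
  have dist3: "dist (u, v, w) (b1, b2, b3) < d" if "dist u b1 < d / 3" "dist v b2 < d / 3" "dist w b3 < d / 3" for u v w
  proof -
    have "dist (u, v, w) (b1, b2, b3) \<le> dist u b1 + dist (v, w) (b2, b3)"
      unfolding dist_Pair_Pair[of u] by (rule sqrt_sum_squares_le_sum) auto
    also have "dist (v, w) (b2, b3) \<le> dist v b2 + dist w b3"
      unfolding dist_Pair_Pair by (rule sqrt_sum_squares_le_sum) auto
    finally show ?thesis using that by simp
  qed
  have set3: "{1..3} = {1, 2, 3::nat}" by auto
  show "\<exists>b. \<exists>\<delta>>0. \<forall>z. (\<forall>h\<in>{1..3}. dist (z h) (b h) < \<delta>) \<longrightarrow> (\<forall>h\<in>{1..3}. dist (z h) (a h) < \<epsilon>)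
      \<and> (\<forall>h\<in>{1..3}. \<not> is_pole f (z h)) \<and> det (system_mat f 2 z) \<noteq> 0"
  proof (intro exI[of _ "\<lambda>h. if h = 1 then b1 else if h = 2 then b2 else b3"] exI[of _ "d / 3"] conjI allI impI)
    show "d / 3 > 0" using d(1) by simp
    fix z :: "nat \<Rightarrow> complex"
    assume "\<forall>h\<in>{1..3}. dist (z h) (if h = 1 then b1 else if h = 2 then b2 else b3) < d / 3"
    hence "dist (z 1) b1 < d / 3" "dist (z 2) b2 < d / 3" "dist (z 3) b3 < d / 3"
      unfolding set3 by simp_all
    note * = d(2)[OF dist3[OF this]]
    show "\<forall>h\<in>{1..3}. dist (z h) (a h) < \<epsilon>" "\<forall>h\<in>{1..3}. \<not> is_pole f (z h)"
      using * unfolding set3 by simp_all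
    show "det (system_mat f 2 z) \<noteq> 0" unfolding det_system_mat_2 using * by simp
  qed
qed

lemma generically_det:
  assumes "1 \<le> n" "n \<le> 2"
  shows "generically (2*n-1) (\<lambda>z. (\<forall>h\<in>{1..2*n-1}. \<not> is_pole f (z h)) \<and> det (system_mat f n z) \<noteq> 0)"
proof -
  have "n = 1 \<or> n = 2" using assms by auto
  thus ?thesis using generically_det_1 generically_det_2 by auto
qed

end

theorem theorem3p3:
  fixes \<tau> :: complex and p q :: glaisher and f :: "complex \<Rightarrow> complex"
    and n :: nat and S\<^sub>f \<rho> :: complex
  assumes "Im \<tau> > 0" and "p \<noteq> q" and "f = jacobi \<tau> p q"
    and "n \<ge> 1" and "S\<^sub>f \<in> pole_sums f" and "\<rho> = of_nat n * S\<^sub>f"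
  shows
    "(\<forall>z. det (system_mat f n z) \<noteq> 0 \<longrightarrow>
        (\<exists>!lk. lk \<in> extensional {1..n} \<times> extensional {1..n-1} \<and> solves_system f n z (fst lk) (snd lk)))
   \<and> (n \<le> 2 \<longrightarrow>
        generically (2*n-1) (\<lambda>z. (\<forall>h\<in>{1..2*n-1}. \<not> is_pole f (z h)) \<and> det (system_mat f n z) \<noteq> 0))
   \<and> (\<forall>l k. \<exists>c. expands_phi f n l k c)
   \<and> (\<forall>z z0 l k c.
        z0 + (\<Sum>h=1..2*n-1. z h) = 0 \<longrightarrow>
        (\<forall>h\<in>{1..2*n-1}. \<not> is_pole f (z h)) \<longrightarrow>
        \<not> is_pole f (z0 + \<rho>) \<longrightarrow>
        inj_on (\<lambda>h. f (z h)) {1..2*n-1} \<longrightarrow>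
        solves_system f n z l k \<longrightarrow>
        elliptic_order (periods f) (\<lambda>u. -1 + lincomb f n l k u) = 2 * n \<longrightarrow>
        expands_phi f n l k c \<longrightarrow>
          c (2*n) \<noteq> 0
        \<and> (\<forall>j\<in>{0..2*n}.
             elem_sym j (2*n) (\<lambda>h. if h = 2*n then f (z0 + \<rho>) else f (z h))
               = (-1)^j * (c (2*n - j) / c (2*n)))
        \<and> (\<forall>j\<in>{1..2*n}. elem_sym (j-1) (2*n-1) (\<lambda>h. f (z h)) \<noteq> 0 \<longrightarrow>
             f (z0 + \<rho>) = 1 / elem_sym (j-1) (2*n-1) (\<lambda>h. f (z h))
               * ((-1)^j * (c (2*n - j) / c (2*n)) - elem_sym j (2*n-1) (\<lambda>h. f (z h)))))"
proof -
  obtain \<omega>1 \<omega>2 p1 p2 where E: "elliptic_order2 \<omega>1 \<omega>2 f p1 p2" and S\<^sub>f: "S\<^sub>f = p1 + p2"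
    using jacobi_elliptic_order2[OF assms(1,2)] assms(3,5) by metis
  interpret elliptic_order2 \<omega>1 \<omega>2 f p1 p2 by fact
  have \<rho>: "\<rho> = of_nat n * S" using assms(6) S\<^sub>f by (simp add: S_def)
  show ?thesis
    unfolding \<rho>
  proof (intro conjI allI impI)
    fix z z0 l k c
    assume "z0 + (\<Sum>h=1..2*n-1. z h) = 0" "\<forall>h\<in>{1..2*n-1}. \<not> is_pole f (z h)"
      "\<not> is_pole f (z0 + of_nat n * S)" "inj_on (\<lambda>h. f (z h)) {1..2*n-1}" "solves_system f n z l k"
      "elliptic_order (periods f) (\<lambda>u. -1 + lincomb f n l k u) = 2 * n" "expands_phi f n l k c"
    note vals = elem_sym_values[OF assms(4) this]
    show "c (2*n) \<noteq> 0" by (rule vals(1))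
    show "\<forall>j\<in>{0..2*n}. elem_sym j (2*n) (\<lambda>h. if h = 2*n then f (z0 + of_nat n * S) else f (z h))
        = (-1)^j * (c (2*n - j) / c (2*n))"
      by (intro ballI vals(2)) simp
    show "\<forall>j\<in>{1..2*n}. elem_sym (j-1) (2*n-1) (\<lambda>h. f (z h)) \<noteq> 0 \<longrightarrow>
        f (z0 + of_nat n * S) = 1 / elem_sym (j-1) (2*n-1) (\<lambda>h. f (z h))
          * ((-1)^j * (c (2*n - j) / c (2*n)) - elem_sym j (2*n-1) (\<lambda>h. f (z h)))"
      by (intro ballI impI vals(3))
  qed ((rule det_nonzero_imp_unique_solution generically_det expands_phi_exists, rule assms(4), assumption?)+)
qed

end
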